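(* Let $m\ge n\ge1$ and let $\omega$ be the permutation of $[m|n]$ (a shuffle of $\{-m,\dots,-1\}$ and $\{1,\dots,n\}$) such that $[m|n]^\omega\simeq\mathcal N(m-n)^{\preccurlyeq n}$. For $\lambda\in\mathcal P_{m|n}$, there exists a $\mathfrak{gl}_{[m|n]^\omega}$-crystal structure on $\mathbf B_{[m|n]}(\lambda)$, for which the following holds: for $(\mu,\alpha)\in\mathcal C(m-n)$, the multiplicity of $\mathbf B_{[m|n]^\omega}(\mu,\alpha)$ in $\mathbf B_{[m|n]}(\lambda)$ is equal to the number of standard tableaux $T$ of shape $\lambda/\mu$ such that $\alpha(T)=\alpha$ and the smallest entry $1$ of $T$ lies in the first column of $\lambda$.
   Context: $[m|n]=\{-m<\cdots<-1<1<\cdots<n\}$, with $-m,\dots,-1$ even and $1,\dots,n$ odd. $\mathcal P_{m|n}$ is the set of partitions $\lambda$ with $\lambda_{m+1}\le n$. For a linearly ordered $\mathbb Z_2$-graded set $\mathcal S$, a semistandard filling of a diagram has entries in $\mathcal S$ weakly increasing along rows (left to right) and columns (top to bottom), even entries strictly increasing in columns and odd entries strictly increasing in rows; $\mathbf B_{\mathcal S}(\lambda)$ is the set of semistandard fillings of the Young diagram $\lambda$. For a permutation $\sigma$ of $[m|n]$, $[m|n]^\sigma$ is the set $[m|n]$ with the same grading and the order $a\prec_\sigma b$ iff $\sigma^{-1}(a)<\sigma^{-1}(b)$. For $p\ge0$, $q\ge1$, $\mathcal N(p)^{\preccurlyeq q}=\{-p<\cdots<-1<\frac12<1<\frac32<\cdots<q\}$,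 with integers even and elements of $\frac12+\mathbb Z$ odd. $\simeq$ means order- and grading-preserving bijection. Explicitly $[m|n]^\omega$ is $-m\prec\cdots\prec-n-1\prec1\prec-n\prec2\prec-n+1\prec\cdots\prec n\prec-1$; this ordering has the maximal possible number of odd isotropic simple roots. All notions below for $\mathcal N(p)^{\preccurlyeq q}$ with $p=m-n$, $q=n$ are transported to $[m|n]^\omega$ along the unique such bijection. Put $\mathcal S=\mathcal N(p)^{\preccurlyeq q}$. $P=\bigoplus_{b\in\mathcal S}\mathbb Z\epsilon_b$ with $(\epsilon_a,\epsilon_b)=(-1)^{|a|}\delta_{ab}$. Simple roots: $\alpha_i=\epsilon_{i-1}-\epsilon_i$ for $-p+1\le i\le-1$ (non-isotropic), and, isotropic, $\alpha_0=\epsilon_{-1}-\epsilon_{1/2}$ (if $p\ge1$) and $\alpha_r=\epsilon_r-\epsilon_{r+\frac12}$ for $r\in\{\frac12,1,\dots,q-\frac12\}$. A $\mathfrak{gl}_{\mathcal S}$-crystal is a set $B$ with maps $\mathrm{wt}:B\to P$, $\varepsilon_i,\varphi_i:B\to\mathbb Z_{\ge0}$, $e_i,f_i:B\to B\cup\{\mathbf 0\}$ ($i$ indexing simple roots, $\mathbf 0$ a formal symbol) such that: (1) for $\alpha_i$ isotropic, $\varphi_i(b)+\varepsilon_i(b)$ is $1$ if $(\mathrm{wt}(b),\alpha_i)\ne0$ and $0$ otherwise; (2) for $\alpha_i$ non-isotropic, $\varphi_i(b)-\varepsilon_i(b)=(\mathrm{wt}(b),\alpha_i)$; (3) if $e_ib\in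 B$ then $\varepsilon_i,\varphi_i,\mathrm{wt}$ change by $-1,+1,+\alpha_i$; (4) if $f_ib\in B$ then they change by $+1,-1,-\alpha_i$; (5) $f_ib=b'$ iff $b=e_ib'$. It is viewed as a colored oriented graph ($b\xrightarrow{i}b'$ iff $b'=f_ib$); isomorphisms are graph isomorphisms preserving colors, $\mathrm{wt},\varepsilon_i,\varphi_i$. The multiplicity of $\mathbf B_{[m|n]^\omega}(\mu,\alpha)$ in a crystal $B$ is the number of times it occurs as a summand in a decomposition of $B$, up to isomorphism, as a direct sum (disjoint union) of crystals of this form. $\mathcal S$ is a crystal: $\mathrm{wt}(b)=\epsilon_b$, $f_i b=b'$ iff $\alpha_i=\epsilon_b-\epsilon_{b'}$; $\varepsilon_i(b)$ (resp. $\varphi_i(b)$) is $1$ if $e_ib\ne\mathbf 0$ (resp. $f_ib\neq\mathbf 0$), else $0$. Tensor product: $\mathrm{wt}$ is additive. For $i\in\mathbb Z_{\ge0}$: $e_i,f_i$ act on $b_1$ in $b_1\otimes b_2$ if $(\alpha_i,\mathrm{wt}(b_1))\ne0$, otherwise on $b_2$. For $i\in\frac12+\mathbb Z_{\ge0}$: they act on $b_2$ if $(\alpha_i,\mathrm{wt}(b_2))\neq0$, otherwise on $b_1$. In both cases $\varepsilon_i,\varphi_i$ are those of the factor acted on. For $i\le-1$: $e_i(b_1\otimes b_2)=e_ib_1\otimes b_2$ if $\varphi_i(b_1)\ge\varepsilon_i(b_2)$, else $b_1\otimes e_ib_2$; $f_i(b_1\otimes b_2)=f_ib_1\otimes b_2$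 if $\varphi_i(b_1)>\varepsilon_i(b_2)$, else $b_1\otimes f_ib_2$; $\varepsilon_i(b_1\otimes b_2)=\max\{\varepsilon_i(b_1),\varepsilon_i(b_2)-(\alpha_i,\mathrm{wt}(b_1))\}$, $\varphi_i(b_1\otimes b_2)=\max\{\varphi_i(b_1)+(\alpha_i,\mathrm{wt}(b_2)),\varphi_i(b_2)\}$. Words $w_1\cdots w_r$ in $\mathcal S$ form a crystal via $w_1\otimes\cdots\otimes w_r$ (the empty word being a trivial crystal). $\mathcal C(p)$ is the set of pairs $(\mu,\alpha)$ with $\mu=(\mu_1,\dots,\mu_p)$ a partition of length at most $p$ and $\alpha$ a (possibly empty) composition that is non-empty only if $\mu_p\neq0$; $\mathcal C(0)$ is the set of compositions (with $\mu$ empty). A composition is identified with its ribbon diagram (rows of lengths $\alpha_1,\alpha_2,\dots$ from top to bottom, the leftmost node of row $i+1$ directly below the rightmost node of row $i$). $(\mu,\alpha)$ is identified with the diagram obtained by placing the first (northwest) node of $\alpha$ (the joint) directly below the leftmost node in the $p$-th row of $\mu$ (the body). $\mathbf B_{\mathcal S}(\mu,\alpha)$ is the set of semistandard fillings of this diagram with entries in $\mathcal S$ such that all body entries are $<b$ if the joint entry $b$ is in $\mathbb Z_{>0}$, and $\le b$ if $b\in\frac12+\mathbb Z_{\ge0}$; it is a crystal by identifying a tableau with the word obtained by reading rows top to bottom, each row right to left. A standard tableau $T$ of skew shape $\lambda/\mu$ ($\mu\subset\lambda$), with $r$ nodes, is a bijection from the nodes to $\{1,\dots,r\}$ increasing along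 rows and columns. $D(T)=\{\,k\mid$ the column index of $T^{-1}(k)$ is $\ge$ that of $T^{-1}(k+1)\,\}$. If $D(T)=\{i_1<\cdots<i_s\}$ then $\alpha(T)=(i_1,i_2-i_1,\dots,r-i_s)$. If $\mu=\lambda$ there is one (empty) tableau, with $\alpha(T)$ empty and the condition on the entry $1$ void; if $\mu\not\subset\lambda$ there are none. *)

theory Defs
  imports Complex_Main "HOL-Library.FuncSet" "HOL-Combinatorics.Permutations"
begin

section \<open>Linearly ordered graded alphabets\<close>

record 'a alphabet =
  letters :: "'a set"
  lt :: "'a \<Rightarrow> 'a \<Rightarrow> bool"
  odd_letter :: "'a \<Rightarrow> bool"

definition alph_mn :: "nat \<Rightarrow> nat \<Rightarrow> int alphabet" where
  "alph_mn m n =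
     \<lparr>letters = {- int m..-1} \<union> {1..int n}, lt = (<), odd_letter = (\<lambda>a. 0 < a)\<rparr>"

definition reorder :: "'a alphabet \<Rightarrow> ('a \<Rightarrow> 'a) \<Rightarrow> 'a alphabet" where
  "reorder S \<sigma> = S\<lparr>lt := \<lambda>a b. lt S (inv \<sigma> a) (inv \<sigma> b)\<rparr>"

definition alph_N :: "nat \<Rightarrow> nat \<Rightarrow> rat alphabet" where
  "alph_N p q =
     \<lparr>letters = {of_int k | k. - int p \<le> k \<and> k \<le> -1} \<union> {of_nat k / 2 | k. 1 \<le> k \<and> k \<le> 2 * q},
      lt = (<), odd_letter = (\<lambda>a. a \<notin> \<int>)\<rparr>"

definition alphabet_iso :: "'a alphabet \<Rightarrow> 'b alphabet \<Rightarrow> ('a \<Rightarrow> 'b) \<Rightarrow> bool" where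
  "alphabet_iso S S' \<psi> \<longleftrightarrow>
     bij_betw \<psi> (letters S) (letters S') \<and>
     (\<forall>a\<in>letters S. \<forall>b\<in>letters S. lt S a b \<longleftrightarrow> lt S' (\<psi> a) (\<psi> b)) \<and>
     (\<forall>a\<in>letters S. odd_letter S a \<longleftrightarrow> odd_letter S' (\<psi> a))"


section \<open>Partitions, diagrams and semistandard fillings\<close>

text \<open>
  Partitions and compositions are lists of positive integers.  Rows and columns are numbered
  from 0, so the part \<open>part lam m\<close> is the one usually written with index \<open>m + 1\<close>.
\<close>

definition partitions :: "nat list set" where
  "partitions = {xs. sorted_wrt (\<ge>) xs \<and> 0 \<notin> set xs}"

definition part :: "nat list \<Rightarrow> nat \<Rightarrow> nat" where
  "part xs i = (if i < length xs then xs ! i else 0)"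

definition hook_partitions :: "nat \<Rightarrow> nat \<Rightarrow> nat list set" where
  "hook_partitions m n = {lam \<in> partitions. part lam m \<le> n}"

definition compositions :: "nat list set" where
  "compositions = {xs. 0 \<notin> set xs}"

text \<open>
  For partitions of length at most \<open>p\<close> and \<open>p \<ge> 1\<close>, the \<open>p\<close>-th part is nonzero iff the length
  is exactly \<open>p\<close>; for \<open>p = 0\<close> the side condition below is void, as required.
\<close>

definition pairs_C :: "nat \<Rightarrow> (nat list \<times> nat list) set" where
  "pairs_C p = {(\<mu>, \<alpha>). \<mu> \<in> partitions \<and> length \<mu> \<le> p \<and> \<alpha> \<in> compositions \<and>
                         (\<alpha> \<noteq> [] \<longrightarrow> length \<mu> = p)}"

type_synonym shape = "(nat \<times> nat) list"

text \<open>
  A diagram is given by the list of its rows, each a pair (first column, number of nodes).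
  In \<open>pair_shape \<mu> \<alpha>\<close> the ribbon of \<open>\<alpha>\<close> starts in column 0 immediately below the last row of \<open>\<mu>\<close>
  (for \<open>(\<mu>, \<alpha>) \<in> pairs_C p\<close> with \<open>\<alpha>\<close> nonempty this is row \<open>p\<close>), and each of its rows starts in
  the last column of the preceding one.
\<close>

definition pair_shape :: "nat list \<Rightarrow> nat list \<Rightarrow> shape" where
  "pair_shape \<mu> \<alpha> = map (\<lambda>a. (0, a)) \<mu> @
     map (\<lambda>i. (\<Sum>k<i. \<alpha> ! k - 1, \<alpha> ! i)) [0..<length \<alpha>]"

definition nodes :: "shape \<Rightarrow> (nat \<times> nat) set" where
  "nodes rs = {(i, j). i < length rs \<and> fst (rs ! i) \<le> j \<and> j < fst (rs ! i) + snd (rs ! i)}"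

definition young :: "nat list \<Rightarrow> (nat \<times> nat) set" where
  "young lam = nodes (pair_shape lam [])"

definition semistandard :: "'a alphabet \<Rightarrow> (nat \<times> nat) set \<Rightarrow> (nat \<times> nat \<Rightarrow> 'a) set" where
  "semistandard S D = {T \<in> D \<rightarrow>\<^sub>E letters S.
     (\<forall>i j j'. (i, j) \<in> D \<and> (i, j') \<in> D \<and> j < j' \<longrightarrow>
        lt S (T (i, j)) (T (i, j')) \<or> (T (i, j) = T (i, j') \<and> \<not> odd_letter S (T (i, j)))) \<and>
     (\<forall>i i' j. (i, j) \<in> D \<and> (i', j) \<in> D \<and> i < i' \<longrightarrow>
        lt S (T (i, j)) (T (i', j)) \<or> (T (i, j) = T (i', j) \<and> odd_letter S (T (i, j))))}"

text \<open>
  From here on, \<open>\<psi>\<close> is the isomorphism from the alphabet \<open>S\<close> onto \<open>alph_N p q\<close> along which all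
  notions for \<open>alph_N p q\<close> are transported to \<open>S\<close>.
\<close>

definition pair_tableaux ::
  "'a alphabet \<Rightarrow> ('a \<Rightarrow> rat) \<Rightarrow> nat list \<Rightarrow> nat list \<Rightarrow> (nat \<times> nat \<Rightarrow> 'a) set" where
  "pair_tableaux S \<psi> \<mu> \<alpha> = {T \<in> semistandard S (nodes (pair_shape \<mu> \<alpha>)).
     \<alpha> \<noteq> [] \<longrightarrow> (let b = T (length \<mu>, 0) in
        (\<psi> b \<in> \<int> \<and> 0 < \<psi> b \<longrightarrow> (\<forall>x\<in>young \<mu>. lt S (T x) b)) \<and>
        (\<psi> b \<notin> \<int> \<longrightarrow> (\<forall>x\<in>young \<mu>. lt S (T x) b \<or> T x = b)))}"

definition reading_word :: "shape \<Rightarrow> (nat \<times> nat \<Rightarrow> 'a) \<Rightarrow> 'a list" where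
  "reading_word rs T = concat (map (\<lambda>i.
     rev (map (\<lambda>j. T (i, j)) [fst (rs ! i)..<fst (rs ! i) + snd (rs ! i)])) [0..<length rs])"


section \<open>Weights and simple roots\<close>

text \<open>
  An element of the weight lattice is a function on letters, vanishing outside the alphabet.
\<close>

definition \<epsilon> :: "'a \<Rightarrow> 'a \<Rightarrow> int" where
  "\<epsilon> b = (\<lambda>a. of_bool (a = b))"

definition form :: "'a alphabet \<Rightarrow> ('a \<Rightarrow> int) \<Rightarrow> ('a \<Rightarrow> int) \<Rightarrow> int" where
  "form S x y = (\<Sum>b\<in>letters S. (if odd_letter S b then -1 else 1) * x b * y b)"

definition root_index :: "nat \<Rightarrow> nat \<Rightarrow> rat set" where
  "root_index p q = {of_int k | k. - int p + 1 \<le> k \<and> k \<le> -1} \<union> (if 1 \<le> p then {0} else {}) \<union>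
     {of_nat k / 2 | k. 1 \<le> k \<and> k \<le> 2 * q - 1}"

text \<open>
  The simple root with index \<open>i\<close> is \<open>\<epsilon> a - \<epsilon> b\<close> where \<open>a\<close>, \<open>b\<close> are the letters corresponding to
  the following two elements of \<open>alph_N p q\<close>; it is isotropic iff \<open>i \<ge> 0\<close>.
\<close>

definition root_src :: "rat \<Rightarrow> rat" where
  "root_src i = (if i \<le> 0 then i - 1 else i)"

definition root_tgt :: "rat \<Rightarrow> rat" where
  "root_tgt i = (if i < 0 then i else i + 1/2)"

definition simple_root :: "'a alphabet \<Rightarrow> ('a \<Rightarrow> rat) \<Rightarrow> rat \<Rightarrow> 'a \<Rightarrow> int" where
  "simple_root S \<psi> i = (\<lambda>a. \<epsilon> (inv_into (letters S) \<psi> (root_src i)) a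
                          - \<epsilon> (inv_into (letters S) \<psi> (root_tgt i)) a)"


section \<open>Crystals\<close>

text \<open>The formal symbol \<open>0\<close> is \<open>None\<close>.\<close>

record ('b, 'a) crystal =
  elems :: "'b set"
  wt :: "'b \<Rightarrow> 'a \<Rightarrow> int"
  eps :: "rat \<Rightarrow> 'b \<Rightarrow> nat"
  phi :: "rat \<Rightarrow> 'b \<Rightarrow> nat"
  e_op :: "rat \<Rightarrow> 'b \<Rightarrow> 'b option"
  f_op :: "rat \<Rightarrow> 'b \<Rightarrow> 'b option"

definition gl_crystal ::
  "'a alphabet \<Rightarrow> ('a \<Rightarrow> rat) \<Rightarrow> nat \<Rightarrow> nat \<Rightarrow> ('b, 'a) crystal \<Rightarrow> bool" where
  "gl_crystal S \<psi> p q K \<longleftrightarrow>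
     (\<forall>b\<in>elems K. \<forall>a. a \<notin> letters S \<longrightarrow> wt K b a = 0) \<and>
     (\<forall>i\<in>root_index p q. \<forall>b\<in>elems K.
        set_option (e_op K i b) \<subseteq> elems K \<and> set_option (f_op K i b) \<subseteq> elems K \<and>
        (0 \<le> i \<longrightarrow>
           phi K i b + eps K i b = (if form S (wt K b) (simple_root S \<psi> i) \<noteq> 0 then 1 else 0)) \<and>
        (i < 0 \<longrightarrow>
           int (phi K i b) - int (eps K i b) = form S (wt K b) (simple_root S \<psi> i)) \<and>
        (\<forall>b'. e_op K i b = Some b' \<longrightarrow>
           int (eps K i b') = int (eps K i b) - 1 \<and> phi K i b' = phi K i b + 1 \<and>
           wt K b' = (\<lambda>a. wt K b a + simple_root S \<psi> i a)) \<and>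
        (\<forall>b'. f_op K i b = Some b' \<longrightarrow>
           eps K i b' = eps K i b + 1 \<and> int (phi K i b') = int (phi K i b) - 1 \<and>
           wt K b' = (\<lambda>a. wt K b a - simple_root S \<psi> i a)) \<and>
        (\<forall>b'\<in>elems K. f_op K i b = Some b' \<longleftrightarrow> e_op K i b' = Some b))"

definition crystal_iso ::
  "nat \<Rightarrow> nat \<Rightarrow> ('b, 'a) crystal \<Rightarrow> ('c, 'a) crystal \<Rightarrow> bool" where
  "crystal_iso p q K L \<longleftrightarrow> (\<exists>h. bij_betw h (elems K) (elems L) \<and>
     (\<forall>b\<in>elems K. wt L (h b) = wt K b) \<and>
     (\<forall>i\<in>root_index p q. \<forall>b\<in>elems K.
        eps L i (h b) = eps K i b \<and> phi L i (h b) = phi K i b \<and>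
        (\<forall>b'\<in>elems K. f_op L i (h b) = Some (h b') \<longleftrightarrow> f_op K i b = Some b')))"

definition direct_sum :: "'j set \<Rightarrow> ('j \<Rightarrow> ('b, 'a) crystal) \<Rightarrow> ('j \<times> 'b, 'a) crystal" where
  "direct_sum J F =
     \<lparr>elems = (SIGMA j:J. elems (F j)),
      wt = (\<lambda>(j, b). wt (F j) b),
      eps = (\<lambda>i (j, b). eps (F j) i b),
      phi = (\<lambda>i (j, b). phi (F j) i b),
      e_op = (\<lambda>i (j, b). map_option (Pair j) (e_op (F j) i b)),
      f_op = (\<lambda>i (j, b). map_option (Pair j) (f_op (F j) i b))\<rparr>"

text \<open>
  The structure obtained on \<open>A\<close> by identifying \<open>x \<in> A\<close> with \<open>g x \<in> elems K\<close>, meant for \<open>g\<close>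
  injective on \<open>A\<close> and \<open>g ` A\<close> stable under the operators of \<open>K\<close>.
\<close>

definition pullback :: "'c set \<Rightarrow> ('c \<Rightarrow> 'b) \<Rightarrow> ('b, 'a) crystal \<Rightarrow> ('c, 'a) crystal" where
  "pullback A g K =
     \<lparr>elems = A,
      wt = (\<lambda>x. wt K (g x)),
      eps = (\<lambda>i x. eps K i (g x)),
      phi = (\<lambda>i x. phi K i (g x)),
      e_op = (\<lambda>i x. map_option (inv_into A g) (e_op K i (g x))),
      f_op = (\<lambda>i x. map_option (inv_into A g) (f_op K i (g x)))\<rparr>"

definition letter_e :: "'a alphabet \<Rightarrow> ('a \<Rightarrow> rat) \<Rightarrow> rat \<Rightarrow> 'a \<Rightarrow> 'a option" where
  "letter_e S \<psi> i b =
     (if \<exists>b'\<in>letters S. simple_root S \<psi> i = (\<lambda>a. \<epsilon> b' a - \<epsilon> b a)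
      then Some (THE b'. b' \<in> letters S \<and> simple_root S \<psi> i = (\<lambda>a. \<epsilon> b' a - \<epsilon> b a)) else None)"

definition letter_f :: "'a alphabet \<Rightarrow> ('a \<Rightarrow> rat) \<Rightarrow> rat \<Rightarrow> 'a \<Rightarrow> 'a option" where
  "letter_f S \<psi> i b =
     (if \<exists>b'\<in>letters S. simple_root S \<psi> i = (\<lambda>a. \<epsilon> b a - \<epsilon> b' a)
      then Some (THE b'. b' \<in> letters S \<and> simple_root S \<psi> i = (\<lambda>a. \<epsilon> b a - \<epsilon> b' a)) else None)"

definition letter_crystal :: "'a alphabet \<Rightarrow> ('a \<Rightarrow> rat) \<Rightarrow> ('a, 'a) crystal" where
  "letter_crystal S \<psi> =
     \<lparr>elems = letters S,
      wt = \<epsilon>,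
      eps = (\<lambda>i b. of_bool (letter_e S \<psi> i b \<noteq> None)),
      phi = (\<lambda>i b. of_bool (letter_f S \<psi> i b \<noteq> None)),
      e_op = letter_e S \<psi>,
      f_op = letter_f S \<psi>\<rparr>"

definition trivial_crystal :: "'b \<Rightarrow> ('b, 'a) crystal" where
  "trivial_crystal x =
     \<lparr>elems = {x}, wt = (\<lambda>_ _. 0), eps = (\<lambda>_ _. 0), phi = (\<lambda>_ _. 0),
      e_op = (\<lambda>_ _. None), f_op = (\<lambda>_ _. None)\<rparr>"

text \<open>Whether the operators with isotropic index \<open>i\<close> act on the first factor of \<open>b1 \<otimes> b2\<close>.\<close>

definition acts_first ::
  "'a alphabet \<Rightarrow> ('a \<Rightarrow> rat) \<Rightarrow> rat \<Rightarrow> ('a \<Rightarrow> int) \<Rightarrow> ('a \<Rightarrow> int) \<Rightarrow> bool" where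
  "acts_first S \<psi> i w1 w2 \<longleftrightarrow>
     (if i \<in> \<int> then form S (simple_root S \<psi> i) w1 \<noteq> 0
      else \<not> form S (simple_root S \<psi> i) w2 \<noteq> 0)"

definition tensor ::
  "'a alphabet \<Rightarrow> ('a \<Rightarrow> rat) \<Rightarrow> ('b, 'a) crystal \<Rightarrow> ('c, 'a) crystal \<Rightarrow> ('b \<times> 'c, 'a) crystal" where
  "tensor S \<psi> K L =
     \<lparr>elems = elems K \<times> elems L,
      wt = (\<lambda>(b1, b2) a. wt K b1 a + wt L b2 a),
      eps = (\<lambda>i (b1, b2).
        if 0 \<le> i then (if acts_first S \<psi> i (wt K b1) (wt L b2) then eps K i b1 else eps L i b2)
        else nat (max (int (eps K i b1))
                      (int (eps L i b2) - form S (simple_root S \<psi> i) (wt K b1)))),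
      phi = (\<lambda>i (b1, b2).
        if 0 \<le> i then (if acts_first S \<psi> i (wt K b1) (wt L b2) then phi K i b1 else phi L i b2)
        else nat (max (int (phi K i b1) + form S (simple_root S \<psi> i) (wt L b2))
                      (int (phi L i b2)))),
      e_op = (\<lambda>i (b1, b2).
        if (if 0 \<le> i then acts_first S \<psi> i (wt K b1) (wt L b2) else phi K i b1 \<ge> eps L i b2)
        then map_option (\<lambda>c. (c, b2)) (e_op K i b1)
        else map_option (\<lambda>c. (b1, c)) (e_op L i b2)),
      f_op = (\<lambda>i (b1, b2).
        if (if 0 \<le> i then acts_first S \<psi> i (wt K b1) (wt L b2) else phi K i b1 > eps L i b2)
        then map_option (\<lambda>c. (c, b2)) (f_op K i b1)
        else map_option (\<lambda>c. (b1, c)) (f_op L i b2))\<rparr>"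

text \<open>Words of length \<open>r\<close>; the iterated tensor product is bracketed to the right.\<close>

fun word_crystal :: "'a alphabet \<Rightarrow> ('a \<Rightarrow> rat) \<Rightarrow> nat \<Rightarrow> ('a list, 'a) crystal" where
  "word_crystal S \<psi> 0 = trivial_crystal []"
| "word_crystal S \<psi> (Suc 0) =
     pullback {w. length w = 1 \<and> set w \<subseteq> letters S} hd (letter_crystal S \<psi>)"
| "word_crystal S \<psi> (Suc (Suc r)) =
     pullback {w. length w = Suc (Suc r) \<and> set w \<subseteq> letters S} (\<lambda>w. (hd w, tl w))
       (tensor S \<psi> (letter_crystal S \<psi>) (word_crystal S \<psi> (Suc r)))"

definition pair_crystal ::
  "'a alphabet \<Rightarrow> ('a \<Rightarrow> rat) \<Rightarrow> nat list \<times> nat list \<Rightarrow> (nat \<times> nat \<Rightarrow> 'a, 'a) crystal" where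
  "pair_crystal S \<psi> = (\<lambda>(\<mu>, \<alpha>).
     pullback (pair_tableaux S \<psi> \<mu> \<alpha>) (reading_word (pair_shape \<mu> \<alpha>))
       (word_crystal S \<psi> (sum_list \<mu> + sum_list \<alpha>)))"


section \<open>Decompositions and multiplicities\<close>

text \<open>\<open>K\<close> is isomorphic to a direct sum in which the summand labelled \<open>x\<close> occurs \<open>c x\<close> times.\<close>

definition is_decomposition ::
  "'a alphabet \<Rightarrow> ('a \<Rightarrow> rat) \<Rightarrow> nat \<Rightarrow> nat \<Rightarrow> ('b, 'a) crystal \<Rightarrow>
   (nat list \<times> nat list \<Rightarrow> nat) \<Rightarrow> bool" where
  "is_decomposition S \<psi> p q K c \<longleftrightarrow>
     crystal_iso p q K (direct_sum (SIGMA x:pairs_C p. {..<c x}) (\<lambda>(x, k). pair_crystal S \<psi> x))"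

text \<open>
  \<open>N\<close> gives the multiplicities in \<open>K\<close>: it is realised by a decomposition, and every decomposition
  has the same multiplicities.  For a long ribbon \<open>\<alpha>\<close> the crystal of \<open>(\<mu>, \<alpha>)\<close> can be empty; such
  a summand may be added or deleted at will, so uniqueness is meaningful, and required, only
  for the nonempty ones.
\<close>

definition multiplicities ::
  "'a alphabet \<Rightarrow> ('a \<Rightarrow> rat) \<Rightarrow> nat \<Rightarrow> nat \<Rightarrow> ('b, 'a) crystal \<Rightarrow>
   (nat list \<times> nat list \<Rightarrow> nat) \<Rightarrow> bool" where
  "multiplicities S \<psi> p q K N \<longleftrightarrow>
     is_decomposition S \<psi> p q K N \<and>
     (\<forall>c. is_decomposition S \<psi> p q K c \<longrightarrow>
        (\<forall>x\<in>pairs_C p. elems (pair_crystal S \<psi> x) \<noteq> {} \<longrightarrow> c x = N x))"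


section \<open>Standard tableaux of skew shape\<close>

definition skew_nodes :: "nat list \<Rightarrow> nat list \<Rightarrow> (nat \<times> nat) set" where
  "skew_nodes lam \<mu> = young lam - young \<mu>"

definition standard_tableaux :: "nat list \<Rightarrow> nat list \<Rightarrow> (nat \<times> nat \<Rightarrow> nat) set" where
  "standard_tableaux lam \<mu> = {T. young \<mu> \<subseteq> young lam \<and>
     T \<in> extensional (skew_nodes lam \<mu>) \<and>
     bij_betw T (skew_nodes lam \<mu>) {1..card (skew_nodes lam \<mu>)} \<and>
     (\<forall>i j j'. (i, j) \<in> skew_nodes lam \<mu> \<and> (i, j') \<in> skew_nodes lam \<mu> \<and> j < j' \<longrightarrow>
        T (i, j) < T (i, j')) \<and>
     (\<forall>i i' j. (i, j) \<in> skew_nodes lam \<mu> \<and> (i', j) \<in> skew_nodes lam \<mu> \<and> i < i' \<longrightarrow>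
        T (i, j) < T (i', j))}"

definition entry_column :: "(nat \<times> nat) set \<Rightarrow> (nat \<times> nat \<Rightarrow> nat) \<Rightarrow> nat \<Rightarrow> nat" where
  "entry_column D T k = snd (inv_into D T k)"

definition descents :: "(nat \<times> nat) set \<Rightarrow> (nat \<times> nat \<Rightarrow> nat) \<Rightarrow> nat set" where
  "descents D T = {k. 1 \<le> k \<and> k < card D \<and> entry_column D T k \<ge> entry_column D T (k + 1)}"

definition descent_composition :: "(nat \<times> nat) set \<Rightarrow> (nat \<times> nat \<Rightarrow> nat) \<Rightarrow> nat list" where
  "descent_composition D T =
     (if D = {} then []
      else let ds = sorted_list_of_set (descents D T) in map2 (-) (ds @ [card D]) (0 # ds))"

definition special_tableaux ::
  "nat list \<Rightarrow> nat list \<Rightarrow> nat list \<Rightarrow> (nat \<times> nat \<Rightarrow> nat) set" where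
  "special_tableaux lam \<mu> \<alpha> = {T \<in> standard_tableaux lam \<mu>.
     descent_composition (skew_nodes lam \<mu>) T = \<alpha> \<and>
     (skew_nodes lam \<mu> \<noteq> {} \<longrightarrow> entry_column (skew_nodes lam \<mu>) T 1 = 0)}"

end

theory Submission
  imports Defs
begin

text \<open>
  The crystal structure on the semistandard fillings is obtained by transport along a bijection with
  the direct sum of the crystals of the pairs \<open>(\<mu>, \<alpha>)\<close>, so three things matter. First, these crystals
  are crystals: the operators change a single letter of the reading word, and the result is again
  semistandard. Second, the bijection exists: the number of fillings does not depend on the order of
  the alphabet, since exchanging adjacent letters of different parity exchanges the order in which a
  horizontal and a vertical strip are added; and for the alternating order, standardizing the part of
  a filling that follows the node in column 0 just below row \<open>p\<close> splits it into a standard tableau of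
  skew shape, a body, and a weakly increasing sequence with repetitions governed by the descents,
  which is a ribbon filling. Third, multiplicities are unique: each nonempty crystal of a pair
  contains an entrywise minimal tableau, whose weight is extremal and determines the pair, so the
  characters are linearly independent.
\<close>

text \<open>The alternating order matters twice. The letters 1/2, 1, 3/2, ... change parity at every
  step, so the least filling of a ribbon stays at a letter or moves to the next one according to the
  kind of each step, and its letter counts remember the whole composition. In a column the p
  negative letters, all even, cannot repeat, so the joint in row p is positive; then the two parity
  clauses at the joint amount to one column relation between every body entry and the joint.
  Standardization orders equal even letters by column and equal odd letters by row. Inside a run of
  equal letters a descent therefore occurs at every step or at none, as a ribbon filling requires,
  and between different letters both kinds of step are allowed. The restriction on the entry 1 puts
  it at the node in column 0 just below the body, so that the cut can be read off the filling. The
  two orders of the alphabet are compared by counting alone: the final bijection is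
  arbitrary.\<close>

section \<open>Crystals on stable subsets and on direct sums\<close>

text \<open>The values of \<open>inv_into A g\<close> are meaningful on the image of
  \<open>g\<close> only, so this image has to be closed under both kinds of operators.\<close>

lemma gl_crystal_pullback:
  assumes K: "gl_crystal S \<psi> p q K" and inj: "inj_on g A" and sub: "g ` A \<subseteq> elems K"
    and e: "\<And>i x b. i \<in> root_index p q \<Longrightarrow> x \<in> A \<Longrightarrow> e_op K i (g x) = Some b \<Longrightarrow> b \<in> g ` A"
    and f: "\<And>i x b. i \<in> root_index p q \<Longrightarrow> x \<in> A \<Longrightarrow> f_op K i (g x) = Some b \<Longrightarrow> b \<in> g ` A"
  shows "gl_crystal S \<psi> p q (pullback A g K)"
  unfolding gl_crystal_def
proof (intro conjI ballI)
  let ?K = "pullback A g K"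
  fix b assume "b \<in> elems ?K"
  then show "\<forall>a. a \<notin> letters S \<longrightarrow> wt ?K b a = 0"
    using K sub by (auto simp: gl_crystal_def pullback_def)
next
  let ?K = "pullback A g K"
  fix i b assume i: "i \<in> root_index p q" and b: "b \<in> elems ?K"
  have bA: "b \<in> A" using b by (simp add: pullback_def)
  then have gb: "g b \<in> elems K" using sub by blast
  have bk: "g (inv_into A g y) = y" "inv_into A g y \<in> A" if "y \<in> g ` A" for y
    using that by (auto simp: f_inv_into_f inv_into_into)
  note ax = K[unfolded gl_crystal_def, THEN conjunct2, rule_format, OF i]
  note axb = ax[OF gb]
  show "set_option (e_op ?K i b) \<subseteq> elems ?K"
    using bk(2) e[OF i bA] by (auto simp: pullback_def)
  show "set_option (f_op ?K i b) \<subseteq> elems ?K"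
    using bk(2) f[OF i bA] by (auto simp: pullback_def)
  show "0 \<le> i \<longrightarrow> phi ?K i b + eps ?K i b =
      (if form S (wt ?K b) (simple_root S \<psi> i) \<noteq> 0 then 1 else 0)"
    using axb by (simp add: pullback_def)
  show "i < 0 \<longrightarrow> int (phi ?K i b) - int (eps ?K i b) =
      form S (wt ?K b) (simple_root S \<psi> i)"
    using axb by (simp add: pullback_def)
  show "\<forall>b'. e_op ?K i b = Some b' \<longrightarrow>
      int (eps ?K i b') = int (eps ?K i b) - 1 \<and>
      phi ?K i b' = phi ?K i b + 1 \<and>
      wt ?K b' = (\<lambda>a. wt ?K b a + simple_root S \<psi> i a)"
  proof -
    have "\<forall>b'. e_op K i (g b) = Some b' \<longrightarrow>
      int (eps K i b') = int (eps K i (g b)) - 1 \<and> phi K i b' = phi K i (g b) + 1 \<and>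
      wt K b' = (\<lambda>a. wt K (g b) a + simple_root S \<psi> i a)"
      using axb by blast
    then show ?thesis
      using e[OF i bA] by (cases "e_op K i (g b)") (simp_all add: pullback_def bk)
  qed
  show "\<forall>b'. f_op ?K i b = Some b' \<longrightarrow>
      eps ?K i b' = eps ?K i b + 1 \<and>
      int (phi ?K i b') = int (phi ?K i b) - 1 \<and>
      wt ?K b' = (\<lambda>a. wt ?K b a - simple_root S \<psi> i a)"
  proof -
    have "\<forall>b'. f_op K i (g b) = Some b' \<longrightarrow>
      eps K i b' = eps K i (g b) + 1 \<and> int (phi K i b') = int (phi K i (g b)) - 1 \<and>
      wt K b' = (\<lambda>a. wt K (g b) a - simple_root S \<psi> i a)"
      using axb by blast
    then show ?thesis
      using f[OF i bA] by (cases "f_op K i (g b)") (simp_all add: pullback_def bk)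
  qed
  fix b' assume b': "b' \<in> elems ?K"
  then have b'A: "b' \<in> A" by (simp add: pullback_def)
  \<comment> \<open>An equation for the pulled back operator lifts to \<open>K\<close> once the
    value of the operator of \<open>K\<close> is known to lie in the image of
    \<open>g\<close>.\<close>
  have lift: "map_option (inv_into A g) o' = Some y \<longleftrightarrow> o' = Some (g y)"
    if "\<And>z. o' = Some z \<Longrightarrow> z \<in> g ` A" "y \<in> A" for o' y
    using that bk(1) inv_into_f_f[OF inj] by (cases o') fastforce+
  have "\<forall>c\<in>elems K. f_op K i (g b) = Some c \<longleftrightarrow> e_op K i c = Some (g b)"
    using axb by blast
  moreover have "g b' \<in> elems K" using sub b'A by blast
  ultimately have "f_op K i (g b) = Some (g b') \<longleftrightarrow> e_op K i (g b') = Some (g b)"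
    by blast
  moreover have "f_op ?K i b = Some b' \<longleftrightarrow> f_op K i (g b) = Some (g b')"
    unfolding pullback_def crystal.simps by (rule lift[OF f[OF i bA] b'A])
  moreover have "e_op ?K i b' = Some b \<longleftrightarrow> e_op K i (g b') = Some (g b)"
    unfolding pullback_def crystal.simps by (rule lift[OF e[OF i b'A] bA])
  ultimately show "(f_op ?K i b = Some b') = (e_op ?K i b' = Some b)"
    by blast
qed

lemma gl_crystal_direct_sum:
  assumes "\<And>j. j \<in> J \<Longrightarrow> gl_crystal S \<psi> p q (F j)"
  shows "gl_crystal S \<psi> p q (direct_sum J F)"
  unfolding gl_crystal_def
proof (intro conjI ballI)
  let ?K = "direct_sum J F"
  fix b assume "b \<in> elems ?K"
  then show "\<forall>a. a \<notin> letters S \<longrightarrow> wt ?K b a = 0"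
    using assms by (auto simp: gl_crystal_def direct_sum_def)
next
  let ?K = "direct_sum J F"
  fix i jb assume i: "i \<in> root_index p q" and jb: "jb \<in> elems ?K"
  obtain j b where [simp]: "jb = (j, b)" and j: "j \<in> J" and b: "b \<in> elems (F j)"
    using jb by (auto simp: direct_sum_def)
  note ax = assms[OF j, unfolded gl_crystal_def, THEN conjunct2, rule_format, OF i b]
  show "set_option (e_op ?K i jb) \<subseteq> elems ?K"
    using ax j by (auto simp: direct_sum_def)
  show "set_option (f_op ?K i jb) \<subseteq> elems ?K"
    using ax j by (auto simp: direct_sum_def)
  show "0 \<le> i \<longrightarrow> phi ?K i jb + eps ?K i jb =
      (if form S (wt ?K jb) (simple_root S \<psi> i) \<noteq> 0 then 1 else 0)"
    using ax by (simp add: direct_sum_def)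
  show "i < 0 \<longrightarrow> int (phi ?K i jb) - int (eps ?K i jb) =
      form S (wt ?K jb) (simple_root S \<psi> i)"
    using ax by (simp add: direct_sum_def)
  show "\<forall>b'. e_op ?K i jb = Some b' \<longrightarrow>
      int (eps ?K i b') = int (eps ?K i jb) - 1 \<and>
      phi ?K i b' = phi ?K i jb + 1 \<and>
      wt ?K b' = (\<lambda>a. wt ?K jb a + simple_root S \<psi> i a)"
  proof -
    have "\<forall>b'. e_op (F j) i b = Some b' \<longrightarrow>
      int (eps (F j) i b') = int (eps (F j) i b) - 1 \<and> phi (F j) i b' = phi (F j) i b + 1 \<and>
      wt (F j) b' = (\<lambda>a. wt (F j) b a + simple_root S \<psi> i a)"
      using ax by blast
    then show ?thesis by (cases "e_op (F j) i b") (simp_all add: direct_sum_def)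
  qed
  show "\<forall>b'. f_op ?K i jb = Some b' \<longrightarrow>
      eps ?K i b' = eps ?K i jb + 1 \<and>
      int (phi ?K i b') = int (phi ?K i jb) - 1 \<and>
      wt ?K b' = (\<lambda>a. wt ?K jb a - simple_root S \<psi> i a)"
  proof -
    have "\<forall>b'. f_op (F j) i b = Some b' \<longrightarrow>
      eps (F j) i b' = eps (F j) i b + 1 \<and> int (phi (F j) i b') = int (phi (F j) i b) - 1 \<and>
      wt (F j) b' = (\<lambda>a. wt (F j) b a - simple_root S \<psi> i a)"
      using ax by blast
    then show ?thesis by (cases "f_op (F j) i b") (simp_all add: direct_sum_def)
  qed
  fix b' assume b': "b' \<in> elems ?K"
  have "\<forall>c\<in>elems (F j). f_op (F j) i b = Some c \<longleftrightarrow> e_op (F j) i c = Some b"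
    using ax by blast
  then show "(f_op ?K i jb = Some b') = (e_op ?K i b' = Some jb)"
    using b' by (cases b') (auto simp: direct_sum_def)
qed

section \<open>Bracketing of words\<close>

text \<open>With \<open>a\<close> read as an opening and \<open>b\<close> as a closing bracket: no
  \<open>a\<close> in \<open>u\<close> lacks a partner to its right.\<close>

definition suffix_balanced :: "'a \<Rightarrow> 'a \<Rightarrow> 'a list \<Rightarrow> bool" where
  "suffix_balanced a b u \<longleftrightarrow> (\<forall>x y. u = x @ y \<longrightarrow> count_list y a \<le> count_list y b)"

text \<open>The companion condition for the other side: no \<open>b\<close> in \<open>v\<close>
  lacks a partner to its left.\<close>

definition prefix_balanced :: "'a \<Rightarrow> 'a \<Rightarrow> 'a list \<Rightarrow> bool" where
  "prefix_balanced a b v \<longleftrightarrow> (\<forall>x y. v = x @ y \<longrightarrow> count_list x b \<le> count_list x a)"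

text \<open>The signature rule: closing brackets \<open>b\<close> left over after each
  \<open>a\<close> has cancelled a later \<open>b\<close>. The subtraction is truncated because an
  opening bracket with nothing to cancel is ignored. For negative indices this number is
  \<open>eps\<close>.\<close>

fun unmatched :: "'a \<Rightarrow> 'a \<Rightarrow> 'a list \<Rightarrow> nat" where
  "unmatched a b [] = 0"
| "unmatched a b (c # v) =
     (if c = b then Suc (unmatched a b v) else if c = a then unmatched a b v - 1 else unmatched a b v)"

text \<open>The left-over closing brackets number the largest excess of \<open>b\<close> over
  \<open>a\<close> in a prefix. The slack \<open>k\<close> is there for the induction, in which a
  leading \<open>a\<close> raises it by one and a leading \<open>b\<close> lowers it; afterwards
  only \<open>k = 0\<close> occurs.\<close>

lemma unmatched_le_iff:
  assumes "a \<noteq> b"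
  shows "unmatched a b v \<le> k \<longleftrightarrow> (\<forall>x y. v = x @ y \<longrightarrow> count_list x b \<le> count_list x a + k)"
proof (induction v arbitrary: k)
  case (Cons c v)
  have "(\<forall>x y. c # v = x @ y \<longrightarrow> count_list x b \<le> count_list x a + k) \<longleftrightarrow>
      (\<forall>x y. v = x @ y \<longrightarrow> count_list (c # x) b \<le> count_list (c # x) a + k)"
    (is "?L \<longleftrightarrow> ?R")
  proof
    assume L: ?L
    show ?R
    proof (intro allI impI)
      fix x y assume "v = x @ y"
      then have "c # v = (c # x) @ y" by simp
      then show "count_list (c # x) b \<le> count_list (c # x) a + k" using L by blast
    qed
  next
    assume R: ?R
    show ?L
    proof (intro allI impI)
      fix x y assume "c # v = x @ y"
      then show "count_list x b \<le> count_list x a + k" using R by (cases x) auto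
    qed
  qed
  also have "\<dots> \<longleftrightarrow> unmatched a b (c # v) \<le> k"
  proof -
    consider "c = b" | "c = a" "c \<noteq> b" | "c \<noteq> a" "c \<noteq> b" by blast
    then show ?thesis
    proof cases
      case 1
      show ?thesis
      proof (cases k)
        case 0
        have "\<not> (\<forall>x y. v = x @ y \<longrightarrow> count_list (c # x) b \<le> count_list (c # x) a + k)"
          using 0 1 assms by (intro notI) (drule spec[of _ "[]"], simp)
        then show ?thesis using 0 1 by simp
      next
        case (Suc k')
        then show ?thesis using 1 assms Cons.IH[of k'] by auto
      qed
    next
      case 2
      have "unmatched a b (c # v) \<le> k \<longleftrightarrow> unmatched a b v \<le> Suc k" using 2 by auto
      then show ?thesis using 2 Cons.IH[of "Suc k"] by simp
    next
      case 3
      then show ?thesis using Cons.IH[of k] by simp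
    qed
  qed
  finally show ?case by simp
qed simp

lemma unmatched_eq_0_iff:
  "a \<noteq> b \<Longrightarrow> unmatched a b v = 0 \<longleftrightarrow> prefix_balanced a b v"
  using unmatched_le_iff[of a b v 0] by (simp add: prefix_balanced_def)

lemma suffix_balanced_Nil [simp]: "suffix_balanced a b []"
  by (simp add: suffix_balanced_def)

lemma suffix_balanced_Cons:
  "suffix_balanced a b (c # u) \<longleftrightarrow>
     suffix_balanced a b u \<and> count_list (c # u) a \<le> count_list (c # u) b"
  unfolding suffix_balanced_def by (metis Cons_eq_append_conv append_Nil)

text \<open>Every \<open>a\<close> of \<open>u\<close> is used up inside \<open>u\<close>, so none
  can cancel a \<open>b\<close> of \<open>t\<close>. The additive form avoids a difference of
  natural numbers.\<close>

lemma unmatched_append: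
  assumes "a \<noteq> b" "suffix_balanced a b u"
  shows "unmatched a b (u @ t) + count_list u a = unmatched a b t + count_list u b"
  using assms(2)
proof (induction u)
  case (Cons c u)
  then have "unmatched a b (u @ t) + count_list u a = unmatched a b t + count_list u b"
    "count_list (c # u) a \<le> count_list (c # u) b"
    by (simp_all only: suffix_balanced_Cons)
  then show ?case using assms(1) by (auto split: if_splits)
qed simp

section \<open>Letters and simple roots\<close>

lemma half_in_Ints_iff: "(of_nat k / 2 :: rat) \<in> \<int> \<longleftrightarrow> even k"
proof
  assume "(of_nat k / 2 :: rat) \<in> \<int>"
  then obtain z where "of_nat k / 2 = (of_int z :: rat)" by (auto elim: Ints_cases)
  then have "(of_int (int k) :: rat) = of_int (2 * z)" by (simp add: field_simps)
  then have "int k = 2 * z" by (simp only: of_int_eq_iff)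
  then show "even k" by presburger
next
  assume "even k"
  then obtain j where "k = 2 * j" by blast
  then show "(of_nat k / 2 :: rat) \<in> \<int>" by simp
qed

lemma root_index_cases [consumes 1]:
  assumes "i \<in> root_index p q"
  obtains (neg) k where "i = of_int k" "- int p + 1 \<le> k" "k \<le> -1" "root_src i = of_int (k - 1)" "root_tgt i = of_int k"
    | (zero) "i = 0" "1 \<le> p" "root_src i = -1" "root_tgt i = 1/2"
    | (pos) k where "i = of_nat k / 2" "1 \<le> k" "Suc k \<le> 2 * q" "root_src i = of_nat k / 2"
        "root_tgt i = of_nat (Suc k) / 2"
proof -
  from assms consider (a) k where "i = of_int k" "- int p + 1 \<le> k" "k \<le> -1" | (b) "i = 0" "1 \<le> p"
    | (c) k where "i = of_nat k / 2" "1 \<le> k" "k \<le> 2 * q - 1"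
    by (auto simp: root_index_def split: if_splits)
  then show thesis
  proof cases
    case a
    then show ?thesis by (intro neg[of k]) (auto simp: root_src_def root_tgt_def)
  next
    case b
    then show ?thesis by (intro zero) (auto simp: root_src_def root_tgt_def)
  next
    case c
    then have "0 < i" by simp
    then show ?thesis using c by (intro pos[of k]) (auto simp: root_src_def root_tgt_def field_simps)
  qed
qed

lemma alph_N_cases [consumes 1]:
  assumes "x \<in> letters (alph_N p q)"
  obtains (neg) k where "x = of_int k" "- int p \<le> k" "k \<le> -1"
    | (pos) k where "x = of_nat k / 2" "1 \<le> k" "k \<le> 2 * q"
  using assms by (auto simp: alph_N_def)

lemma root_ends_in_alph_N:
  assumes "i \<in> root_index p q" "1 \<le> q"
  shows "root_src i \<in> letters (alph_N p q)" "root_tgt i \<in> letters (alph_N p q)"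
proof -
  have nI: "of_int k \<in> letters (alph_N p q)" if "- int p \<le> k" "k \<le> -1" for k
    using that by (auto simp: alph_N_def)
  have pI: "of_nat k / 2 \<in> letters (alph_N p q)" if "1 \<le> k" "k \<le> 2 * q" for k
    using that by (auto simp: alph_N_def)
  from assms(1) show "root_src i \<in> letters (alph_N p q)"
  proof (cases rule: root_index_cases)
    case (neg k)
    then show ?thesis using nI[of "k - 1"] by simp
  next
    case zero
    then show ?thesis using nI[of "-1"] by simp
  next
    case (pos k)
    then show ?thesis using pI[of k] by (metis Suc_leD)
  qed
  from assms(1) show "root_tgt i \<in> letters (alph_N p q)"
  proof (cases rule: root_index_cases)
    case (neg k)
    then show ?thesis using nI[of k] by simp
  next
    case zero
    show ?thesis unfolding zero(4) using pI[of 1] assms(2) by simp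
  next
    case (pos k)
    then show ?thesis using pI[of "Suc k"] by (metis le_add1 plus_1_eq_Suc)
  qed
qed

text \<open>Simple roots are differences of neighbouring letters. Replacing one end by the other
  therefore leaves the comparison with every third letter unchanged, and only entries equal to one
  of the two ends can obstruct.\<close>

lemma root_ends_adjacent:
  assumes "i \<in> root_index p q" "x \<in> letters (alph_N p q)"
  shows "x \<le> root_src i \<or> root_tgt i \<le> x"
  using assms
proof (cases rule: root_index_cases)
  case (neg k)
  from assms(2) show ?thesis
  proof (cases rule: alph_N_cases)
    case (neg l)
    have "l \<le> k - 1 \<or> k \<le> l" by linarith
    then show ?thesis using neg(1) \<open>root_src i = of_int (k - 1)\<close> \<open>root_tgt i = of_int k\<close>
      by (simp only: of_int_le_iff)
  next
    case (pos l)
    have "(of_int k :: rat) < 0" using \<open>k \<le> -1\<close> by simp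
    then have "root_tgt i \<le> 0" using \<open>root_tgt i = of_int k\<close> by simp
    also have "0 \<le> x" using pos by simp
    finally show ?thesis by simp
  qed
next
  case zero
  from assms(2) show ?thesis
  proof (cases rule: alph_N_cases)
    case (neg l)
    then have "(of_int l :: rat) \<le> of_int (-1)" by (simp only: of_int_le_iff)
    then show ?thesis using neg zero by simp
  next
    case (pos l)
    then show ?thesis using zero by (simp add: field_simps)
  qed
next
  case (pos k)
  from assms(2) show ?thesis
  proof (cases rule: alph_N_cases)
    case (neg l)
    then have "(of_int l :: rat) \<le> of_int (-1)" by (simp only: of_int_le_iff)
    then have "x \<le> 0" using neg by simp
    also have "0 \<le> root_src i" using pos by simp
    finally show ?thesis by simp
  next
    case (pos l)
    have "l \<le> k \<or> Suc k \<le> l" by linarith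
    then have "(of_nat l :: rat) \<le> of_nat k \<or> (of_nat (Suc k) :: rat) \<le> of_nat l"
      by (simp only: of_nat_le_iff)
    then show ?thesis
      using pos(1) \<open>root_src i = of_nat k / 2\<close> \<open>root_tgt i = of_nat (Suc k) / 2\<close>
      by (auto simp: divide_right_mono)
  qed
qed

lemma root_ends_parity:
  assumes "i \<in> root_index p q"
  shows "root_src i \<in> \<int> \<longleftrightarrow> i \<in> \<int>" "root_tgt i \<in> \<int> \<longleftrightarrow> i < 0 \<or> i \<notin> \<int>"
proof -
  have half: "(1/2 :: rat) \<notin> \<int>" using half_in_Ints_iff[of 1] by simp
  have neg: "(of_int k :: rat) < 0" if "k \<le> -1" for k using that by simp
  from assms show "root_src i \<in> \<int> \<longleftrightarrow> i \<in> \<int>"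
    by (cases rule: root_index_cases) (simp_all only: half_in_Ints_iff, simp_all)
  from assms show "root_tgt i \<in> \<int> \<longleftrightarrow> i < 0 \<or> i \<notin> \<int>"
    by (cases rule: root_index_cases) (simp_all only: half_in_Ints_iff neg, simp_all add: half)
qed

lemma root_src_less_tgt: "root_src i < root_tgt i"
  by (auto simp: root_src_def root_tgt_def)

lemma negative_root_in_Ints: "i \<in> root_index p q \<Longrightarrow> i < 0 \<Longrightarrow> i \<in> \<int>"
  by (cases rule: root_index_cases) auto

locale crystal_alphabet =
  fixes S :: "'a alphabet" and \<psi> :: "'a \<Rightarrow> rat" and p q :: nat
  assumes iso: "alphabet_iso S (alph_N p q) \<psi>" and q_pos: "1 \<le> q"
begin

definition src :: "rat \<Rightarrow> 'a" where "src i = inv_into (letters S) \<psi> (root_src i)"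
definition tgt :: "rat \<Rightarrow> 'a" where "tgt i = inv_into (letters S) \<psi> (root_tgt i)"

lemma inj_\<psi>: "inj_on \<psi> (letters S)"
  and image_\<psi>: "\<psi> ` letters S = letters (alph_N p q)"
  using iso by (auto simp: alphabet_iso_def bij_betw_def)

lemma \<psi>_eq_iff: "c \<in> letters S \<Longrightarrow> d \<in> letters S \<Longrightarrow> \<psi> c = \<psi> d \<longleftrightarrow> c = d"
  using inj_\<psi> by (auto dest: inj_onD)

lemma lt_iff: "c \<in> letters S \<Longrightarrow> d \<in> letters S \<Longrightarrow> lt S c d \<longleftrightarrow> \<psi> c < \<psi> d"
  using iso by (auto simp: alphabet_iso_def alph_N_def)

lemma odd_iff: "c \<in> letters S \<Longrightarrow> odd_letter S c \<longleftrightarrow> \<psi> c \<notin> \<int>"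
  using iso by (auto simp: alphabet_iso_def alph_N_def)

lemma finite_letters: "finite (letters S)"
proof -
  have "{of_int k :: rat | k. - int p \<le> k \<and> k \<le> -1} = of_int ` {- int p..-1}"
    "{of_nat k / 2 :: rat | k. 1 \<le> k \<and> k \<le> 2 * q} = (\<lambda>k. of_nat k / 2) ` {1..2 * q}"
    by auto
  then have "finite (letters (alph_N p q))" by (simp add: alph_N_def)
  then show ?thesis using image_\<psi> inj_\<psi> by (metis finite_imageD)
qed

context
  fixes i assumes i: "i \<in> root_index p q"
begin

lemma \<psi>_src: "\<psi> (src i) = root_src i" and \<psi>_tgt: "\<psi> (tgt i) = root_tgt i"
  and src_letter: "src i \<in> letters S" and tgt_letter: "tgt i \<in> letters S"
  using root_ends_in_alph_N[OF i q_pos]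
  by (simp_all add: src_def tgt_def f_inv_into_f inv_into_into image_\<psi>)

lemma src_neq_tgt: "src i \<noteq> tgt i"
  using root_src_less_tgt[of i] \<psi>_src \<psi>_tgt by force

lemma src_odd_iff: "odd_letter S (src i) \<longleftrightarrow> i \<notin> \<int>"
  using odd_iff[OF src_letter] root_ends_parity[OF i] \<psi>_src by simp

lemma tgt_odd_iff: "odd_letter S (tgt i) \<longleftrightarrow> 0 \<le> i \<and> i \<in> \<int>"
  using odd_iff[OF tgt_letter] root_ends_parity[OF i] \<psi>_tgt by auto

lemma simple_root_eq: "simple_root S \<psi> i = (\<lambda>x. \<epsilon> (src i) x - \<epsilon> (tgt i) x)"
  by (simp add: simple_root_def src_def tgt_def)

text \<open>Evaluation at the two ends recovers them from their difference, which gives the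
  \<open>THE\<close> in \<open>letter_e\<close> and \<open>letter_f\<close> a unique
  candidate.\<close>

lemma simple_root_eq_iff: "simple_root S \<psi> i = (\<lambda>x. \<epsilon> c x - \<epsilon> d x) \<longleftrightarrow> c = src i \<and> d = tgt i"
proof
  assume eq: "simple_root S \<psi> i = (\<lambda>x. \<epsilon> c x - \<epsilon> d x)"
  have *: "\<epsilon> (src i) x - \<epsilon> (tgt i) x = \<epsilon> c x - \<epsilon> d x" for x
    using fun_cong[OF eq] by (simp add: simple_root_eq)
  show "c = src i \<and> d = tgt i"
    using *[of "src i"] *[of "tgt i"] src_neq_tgt by (auto simp: \<epsilon>_def of_bool_def split: if_splits)
qed (simp add: simple_root_eq)

lemma letter_f_eq: "letter_f S \<psi> i c = (if c = src i then Some (tgt i) else None)"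
  unfolding letter_f_def simple_root_eq_iff using tgt_letter by (auto intro!: the_equality)

lemma letter_e_eq: "letter_e S \<psi> i c = (if c = tgt i then Some (src i) else None)"
  unfolding letter_e_def simple_root_eq_iff using src_letter by (auto intro!: the_equality)

lemma form_simple_root:
  "form S (simple_root S \<psi> i) w =
     (if odd_letter S (src i) then -1 else 1) * w (src i)
     - (if odd_letter S (tgt i) then -1 else 1) * w (tgt i)"
proof -
  have *: "(\<Sum>b\<in>letters S. g b * \<epsilon> c b * w b) = g c * w c" if "c \<in> letters S" for g :: "'a \<Rightarrow> int" and c
  proof -
    have "(\<Sum>b\<in>letters S. g b * \<epsilon> c b * w b) = (\<Sum>b\<in>letters S. if b = c then g b * w b else 0)"
      by (rule sum.cong) (auto simp: \<epsilon>_def)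
    then show ?thesis using that finite_letters by simp
  qed
  show ?thesis
    unfolding form_def simple_root_eq
    using *[OF src_letter] *[OF tgt_letter]
    by (simp add: left_diff_distrib right_diff_distrib sum_subtractf)
qed

lemma form_simple_root':
  "form S w (simple_root S \<psi> i) = form S (simple_root S \<psi> i) w"
  by (simp add: form_def mult.assoc mult.commute[of "w _"])

text \<open>The ends of an isotropic root have opposite parity, so the sign in the form compensates
  the sign in the root: up to a common sign the form adds the two letter counts, and it cannot
  vanish by cancellation.\<close>

lemma form_isotropic_neq_0_iff:
  assumes "0 \<le> i"
  shows "form S (simple_root S \<psi> i) (\<lambda>x. int (count_list w x)) \<noteq> 0 \<longleftrightarrow> src i \<in> set w \<or> tgt i \<in> set w"
proof -
  have "form S (simple_root S \<psi> i) (\<lambda>x. int (count_list w x)) =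
     (if odd_letter S (src i) then -1 else 1) * (int (count_list w (src i)) + int (count_list w (tgt i)))"
    unfolding form_simple_root using assms src_odd_iff tgt_odd_iff by simp
  then have "form S (simple_root S \<psi> i) (\<lambda>x. int (count_list w x)) = 0 \<longleftrightarrow>
     count_list w (src i) = 0 \<and> count_list w (tgt i) = 0"
    by (auto split: if_splits)
  then show ?thesis by (auto simp: count_list_0_iff)
qed

lemma form_negative:
  assumes "i < 0"
  shows "form S (simple_root S \<psi> i) w = w (src i) - w (tgt i)"
  unfolding form_simple_root using assms src_odd_iff tgt_odd_iff negative_root_in_Ints[OF i] by simp

end

lemma \<epsilon>_eq_count: "\<epsilon> c = (\<lambda>x. int (count_list [c] x))"
  by (auto simp: \<epsilon>_def)

section \<open>The crystal of words\<close>

definition words :: "nat \<Rightarrow> 'a list set" where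
  "words r = {w. length w = r \<and> set w \<subseteq> letters S}"

lemma Nil_words: "v \<in> words 0 \<longleftrightarrow> v = []"
  by (auto simp: words_def)

lemma Cons_words: "c # v \<in> words (Suc r) \<longleftrightarrow> c \<in> letters S \<and> v \<in> words r"
  by (auto simp: words_def)

abbreviation W :: "nat \<Rightarrow> ('a list, 'a) crystal" where "W \<equiv> word_crystal S \<psi>"

abbreviation weight :: "'a list \<Rightarrow> 'a \<Rightarrow> int" where "weight w \<equiv> (\<lambda>x. int (count_list w x))"

lemma W_one: "W (Suc 0) = pullback (words 1) hd (letter_crystal S \<psi>)"
  by (simp add: words_def)

lemma W_Suc: "W (Suc (Suc r)) = pullback (words (Suc (Suc r))) (\<lambda>w. (hd w, tl w))
    (tensor S \<psi> (letter_crystal S \<psi>) (W (Suc r)))"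
  by (simp add: words_def)

declare word_crystal.simps(2,3) [simp del]

lemma elems_W: "elems (W r) = words r"
  by (cases r rule: word_crystal.cases[of "(S, \<psi>, r)" for r]; simp add: Nil_words words_def W_one W_Suc)
    (auto simp: trivial_crystal_def pullback_def words_def word_crystal.simps)

lemma wt_W: "w \<in> words r \<Longrightarrow> wt (W r) w = weight w"
proof (induction w arbitrary: r)
  case Nil
  then show ?case by (auto simp: words_def trivial_crystal_def)
next
  case (Cons c v)
  obtain r' where r: "r = Suc r'" using Cons.prems by (auto simp: words_def)
  show ?case
  proof (cases r')
    case 0
    then have "v = []" using Cons.prems r by (simp add: words_def)
    then show ?thesis using 0 r
      by (simp add: W_one[simplified] pullback_def letter_crystal_def \<epsilon>_eq_count)
  next
    case (Suc r'')
    have "wt (W r') v = weight v" using Cons r by (simp add: Cons_words)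
    then show ?thesis using Suc r
      by (auto simp: W_Suc pullback_def letter_crystal_def tensor_def \<epsilon>_eq_count)
  qed
qed

text \<open>The isotropic tensor rule for a letter in front of a word, with nonvanishing of the form
  turned into occurrence of an end of the root. Iterated, an integral index selects the leftmost
  such occurrence and a half-integral index the rightmost.\<close>

definition acts :: "rat \<Rightarrow> 'a \<Rightarrow> 'a list \<Rightarrow> bool" where
  "acts i c v \<longleftrightarrow> (if i \<in> \<int> then c = src i \<or> c = tgt i else src i \<notin> set v \<and> tgt i \<notin> set v)"

lemma acts_first_iff:
  assumes "i \<in> root_index p q" "0 \<le> i"
  shows "acts_first S \<psi> i (\<epsilon> c) (weight v) \<longleftrightarrow> acts i c v"
  unfolding acts_first_def acts_def \<epsilon>_eq_count form_isotropic_neq_0_iff[OF assms] by auto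

text \<open>Words of length one are defined apart, but tensoring a letter with the empty word
  changes nothing, so this recursion, like those for \<open>phi\<close>, \<open>e_op\<close> and
  \<open>f_op\<close> below, covers all lengths.\<close>

lemma eps_W_Cons:
  assumes i: "i \<in> root_index p q" and c: "c \<in> letters S" and v: "v \<in> words r"
  shows "eps (W (Suc r)) i (c # v) =
     (if 0 \<le> i then (if acts i c v then of_bool (c = tgt i) else eps (W r) i v)
      else nat (max (of_bool (c = tgt i)) (int (eps (W r) i v) - form S (simple_root S \<psi> i) (\<epsilon> c))))"
proof (cases r)
  case 0
  then have "v = []" using v by (simp add: Nil_words)
  then show ?thesis using 0 i
    by (auto simp: W_one[simplified] pullback_def letter_crystal_def letter_e_eq acts_def
        trivial_crystal_def form_negative \<epsilon>_def src_neq_tgt)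
next
  case (Suc r')
  then show ?thesis using i c v wt_W[OF v] acts_first_iff[OF i, of c v]
    by (auto simp: W_Suc pullback_def letter_crystal_def letter_e_eq tensor_def)
qed

lemma phi_W_Cons:
  assumes i: "i \<in> root_index p q" and c: "c \<in> letters S" and v: "v \<in> words r"
  shows "phi (W (Suc r)) i (c # v) =
     (if 0 \<le> i then (if acts i c v then of_bool (c = src i) else phi (W r) i v)
      else nat (max (of_bool (c = src i) + form S (simple_root S \<psi> i) (weight v)) (int (phi (W r) i v))))"
proof (cases r)
  case 0
  then have "v = []" using v by (simp add: Nil_words)
  then show ?thesis using 0 i
    by (auto simp: W_one[simplified] pullback_def letter_crystal_def letter_f_eq acts_def
        trivial_crystal_def form_negative \<epsilon>_def src_neq_tgt)
next
  case (Suc r')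
  then show ?thesis using i c v wt_W[OF v] acts_first_iff[OF i, of c v]
    by (auto simp: W_Suc pullback_def letter_crystal_def letter_f_eq tensor_def)
qed

lemma inv_into_hd_tl:
  assumes "c \<in> letters S" "v \<in> words r"
  shows "inv_into (words (Suc r)) (\<lambda>w. (hd w, tl w)) (c, v) = c # v"
proof (rule inv_into_f_eq)
  show "inj_on (\<lambda>w. (hd w, tl w)) (words (Suc r))"
  proof (rule inj_onI)
    fix x y assume "x \<in> words (Suc r)" "y \<in> words (Suc r)" "(hd x, tl x) = (hd y, tl y)"
    then show "x = y" by (cases x; cases y) (auto simp: words_def)
  qed
qed (use assms in \<open>auto simp: Cons_words\<close>)

lemma inv_into_hd:
  assumes "c \<in> letters S"
  shows "inv_into (words (Suc 0)) hd c = [c]"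
proof (rule inv_into_f_eq)
  show "inj_on hd (words (Suc 0))"
  proof (rule inj_onI)
    fix x y assume "x \<in> words (Suc 0)" "y \<in> words (Suc 0)" "hd x = hd y"
    then show "x = y" by (cases x; cases y) (auto simp: words_def)
  qed
qed (use assms in \<open>auto simp: words_def\<close>)

lemma e_op_W_closed:
  "i \<in> root_index p q \<Longrightarrow> w \<in> words r \<Longrightarrow> e_op (W r) i w = Some w' \<Longrightarrow> w' \<in> words r"
  and f_op_W_closed:
  "i \<in> root_index p q \<Longrightarrow> w \<in> words r \<Longrightarrow> f_op (W r) i w = Some w' \<Longrightarrow> w' \<in> words r"
proof (induction w arbitrary: r w')
  case Nil
  { case 1 then show ?case by (auto simp: words_def trivial_crystal_def) }
  { case 2 then show ?case by (auto simp: words_def trivial_crystal_def) }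
next
  case (Cons c v)
  { case 1
    then obtain r' where r: "r = Suc r'" by (auto simp: words_def)
    show ?case
    proof (cases r')
      case 0
      then have "v = []" using 1 r by (auto simp: words_def)
      then show ?thesis using 0 1 r
        by (auto simp: W_one[simplified] pullback_def letter_crystal_def letter_e_eq inv_into_hd src_letter
           Cons_words split: if_splits)
    next
      case (Suc k)
      have v: "v \<in> words (Suc k)" "c \<in> letters S" using 1 r Suc by (simp_all add: Cons_words)
      show ?thesis using 1 r Suc Cons.IH(1)[OF 1(1) v(1)] v
        by (auto simp: W_Suc pullback_def letter_crystal_def letter_e_eq tensor_def src_letter
          inv_into_hd_tl Cons_words split: if_splits)
    qed
  }
  { case 2
    then obtain r' where r: "r = Suc r'" by (auto simp: words_def)
    show ?case
    proof (cases r')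
      case 0
      then have "v = []" using 2 r by (auto simp: words_def)
      then show ?thesis using 0 2 r
        by (auto simp: W_one[simplified] pullback_def letter_crystal_def letter_f_eq inv_into_hd tgt_letter
           Cons_words split: if_splits)
    next
      case (Suc k)
      have v: "v \<in> words (Suc k)" "c \<in> letters S" using 2 r Suc by (simp_all add: Cons_words)
      show ?thesis using 2 r Suc Cons.IH(2)[OF 2(1) v(1)] v
        by (auto simp: W_Suc pullback_def letter_crystal_def letter_f_eq tensor_def tgt_letter
          inv_into_hd_tl Cons_words split: if_splits)
    qed
  }
qed

lemma e_op_W_Cons:
  assumes i: "i \<in> root_index p q" and c: "c \<in> letters S" and v: "v \<in> words r"
  shows "e_op (W (Suc r)) i (c # v) =
     (if (if 0 \<le> i then acts i c v else eps (W r) i v \<le> of_bool (c = src i))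
      then (if c = tgt i then Some (src i # v) else None)
      else map_option (Cons c) (e_op (W r) i v))"
proof (cases r)
  case 0
  then have "v = []" using v by (simp add: Nil_words)
  then show ?thesis using 0 i
    by (auto simp: W_one[simplified] pullback_def letter_crystal_def letter_e_eq acts_def
        trivial_crystal_def form_negative \<epsilon>_def src_neq_tgt inv_into_hd src_letter)
next
  case (Suc k)
  define inv_W where "inv_W = inv_into (words (Suc (Suc k))) (\<lambda>w. (hd w, tl w))"
  define A where "A \<longleftrightarrow> (if 0 \<le> i then acts i c v else eps (W r) i v \<le> of_bool (c = src i))"
  have inv_W: "inv_W (c', v') = c' # v'" if "c' \<in> letters S" "v' \<in> words r" for c' v'
    using inv_into_hd_tl[OF that] by (simp add: inv_W_def Suc)
  have "e_op (W (Suc r)) i (c # v) = map_option inv_W (if A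
      then map_option (\<lambda>c'. (c', v)) (letter_e S \<psi> i c) else map_option (Pair c) (e_op (W r) i v))"
    using wt_W[OF v] acts_first_iff[OF i, of c v]
    by (simp add: Suc W_Suc pullback_def tensor_def letter_crystal_def inv_W_def A_def letter_f_eq[OF i])
  also have "\<dots> = (if A then (if c = tgt i then Some (src i # v) else None)
      else map_option (Cons c) (e_op (W r) i v))"
  proof (cases "e_op (W r) i v")
    case None
    then show ?thesis using inv_W[OF src_letter[OF i] v] by (simp add: letter_e_eq[OF i])
  next
    case (Some v')
    then show ?thesis using inv_W[OF src_letter[OF i] v] inv_W[OF c e_op_W_closed[OF i v Some]]
      by (simp add: letter_e_eq[OF i])
  qed
  finally show ?thesis by (simp only: A_def)
qed

lemma f_op_W_Cons:
  assumes i: "i \<in> root_index p q" and c: "c \<in> letters S" and v: "v \<in> words r"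
  shows "f_op (W (Suc r)) i (c # v) =
     (if (if 0 \<le> i then acts i c v else eps (W r) i v < of_bool (c = src i))
      then (if c = src i then Some (tgt i # v) else None)
      else map_option (Cons c) (f_op (W r) i v))"
proof (cases r)
  case 0
  then have "v = []" using v by (simp add: Nil_words)
  then show ?thesis using 0 i
    by (auto simp: W_one[simplified] pullback_def letter_crystal_def letter_f_eq acts_def
        trivial_crystal_def form_negative \<epsilon>_def src_neq_tgt inv_into_hd tgt_letter)
next
  case (Suc k)
  define inv_W where "inv_W = inv_into (words (Suc (Suc k))) (\<lambda>w. (hd w, tl w))"
  define A where "A \<longleftrightarrow> (if 0 \<le> i then acts i c v else eps (W r) i v < of_bool (c = src i))"
  have inv_W: "inv_W (c', v') = c' # v'" if "c' \<in> letters S" "v' \<in> words r" for c' v'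
    using inv_into_hd_tl[OF that] by (simp add: inv_W_def Suc)
  have "f_op (W (Suc r)) i (c # v) = map_option inv_W (if A
      then map_option (\<lambda>c'. (c', v)) (letter_f S \<psi> i c) else map_option (Pair c) (f_op (W r) i v))"
    using wt_W[OF v] acts_first_iff[OF i, of c v]
    by (simp add: Suc W_Suc pullback_def tensor_def letter_crystal_def inv_W_def A_def letter_f_eq[OF i])
  also have "\<dots> = (if A then (if c = src i then Some (tgt i # v) else None)
      else map_option (Cons c) (f_op (W r) i v))"
  proof (cases "f_op (W r) i v")
    case None
    then show ?thesis using inv_W[OF tgt_letter[OF i] v] by (simp add: letter_f_eq[OF i])
  next
    case (Some v')
    then show ?thesis using inv_W[OF tgt_letter[OF i] v] inv_W[OF c f_op_W_closed[OF i v Some]]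
      by (simp add: letter_f_eq[OF i])
  qed
  finally show ?thesis by (simp only: A_def)
qed

text \<open>
  Words related by \<open>f_op\<close> differ in one letter; the condition on the surrounding factors is the
  same for \<open>e_op\<close> and \<open>f_op\<close>, which makes them mutually inverse.
\<close>

definition acts_between :: "rat \<Rightarrow> 'a list \<Rightarrow> 'a list \<Rightarrow> bool" where
  "acts_between i u v \<longleftrightarrow>
     (if i < 0 then suffix_balanced (src i) (tgt i) u \<and> prefix_balanced (src i) (tgt i) v
      else if i \<in> \<int> then src i \<notin> set u \<and> tgt i \<notin> set u
      else src i \<notin> set v \<and> tgt i \<notin> set v)"

lemma eps_W_negative:
  assumes i: "i \<in> root_index p q" and "i < 0" and "w \<in> words r"
  shows "eps (W r) i w = unmatched (src i) (tgt i) w"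
  using assms(3)
proof (induction w arbitrary: r)
  case Nil
  then show ?case by (simp add: words_def trivial_crystal_def)
next
  case (Cons c v)
  then obtain r' where r: "r = Suc r'" by (auto simp: words_def)
  have c: "c \<in> letters S" and v: "v \<in> words r'" using Cons r by (simp_all add: Cons_words)
  show ?case
    using Cons.IH[OF v] \<open>i < 0\<close> src_neq_tgt[OF i]
    by (auto simp: r eps_W_Cons[OF i c v] form_negative[OF i] \<epsilon>_def)
qed

lemma phi_W_negative:
  assumes i: "i \<in> root_index p q" and "i < 0" and "w \<in> words r"
  shows "int (phi (W r) i w) =
     int (unmatched (src i) (tgt i) w) + int (count_list w (src i)) - int (count_list w (tgt i))"
  using assms(3)
proof (induction w arbitrary: r)
  case Nil
  then show ?case by (simp add: words_def trivial_crystal_def)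
next
  case (Cons c v)
  then obtain r' where r: "r = Suc r'" by (auto simp: words_def)
  have c: "c \<in> letters S" and v: "v \<in> words r'" using Cons r by (simp_all add: Cons_words)
  show ?case
    using Cons.IH[OF v] \<open>i < 0\<close> src_neq_tgt[OF i]
    by (auto simp: r phi_W_Cons[OF i c v] form_negative[OF i] \<epsilon>_def)
qed

lemma eps_phi_W_isotropic:
  assumes i: "i \<in> root_index p q" and "0 \<le> i" and "w \<in> words r"
  shows "eps (W r) i w = of_bool (e_op (W r) i w \<noteq> None)"
    and "phi (W r) i w = of_bool (f_op (W r) i w \<noteq> None)"
    and "phi (W r) i w + eps (W r) i w = of_bool (src i \<in> set w \<or> tgt i \<in> set w)"
proof -
  have "eps (W r) i w = of_bool (e_op (W r) i w \<noteq> None) \<and>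
    phi (W r) i w = of_bool (f_op (W r) i w \<noteq> None) \<and>
    phi (W r) i w + eps (W r) i w = of_bool (src i \<in> set w \<or> tgt i \<in> set w)"
    using assms(3)
  proof (induction w arbitrary: r)
    case Nil
    then show ?case by (simp add: words_def trivial_crystal_def)
  next
    case (Cons c v)
    then obtain r' where r: "r = Suc r'" by (auto simp: words_def)
    have c: "c \<in> letters S" and v: "v \<in> words r'" using Cons r by (simp_all add: Cons_words)
    show ?case
      using Cons.IH[OF v] \<open>0 \<le> i\<close> src_neq_tgt[OF i]
      by (auto simp: r eps_W_Cons[OF i c v] phi_W_Cons[OF i c v] e_op_W_Cons[OF i c v]
          f_op_W_Cons[OF i c v] acts_def)
  qed
  then show "eps (W r) i w = of_bool (e_op (W r) i w \<noteq> None)"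
    and "phi (W r) i w = of_bool (f_op (W r) i w \<noteq> None)"
    and "phi (W r) i w + eps (W r) i w = of_bool (src i \<in> set w \<or> tgt i \<in> set w)"
    by blast+
qed

text \<open>Either the change is at the head, or it happens later and the condition sees a longer
  prefix. This is the shape of the recursions for \<open>e_op\<close> and \<open>f_op\<close>, so
  they can be unrolled by induction.\<close>

lemma ex_split_Cons:
  "(\<exists>u v. c # w = u @ a # v \<and> w' = u @ b # v \<and> P u v) \<longleftrightarrow>
     (c = a \<and> w' = b # w \<and> P [] w) \<or>
     (\<exists>w''. w' = c # w'' \<and> (\<exists>u v. w = u @ a # v \<and> w'' = u @ b # v \<and> P (c # u) v))"
  (is "?L \<longleftrightarrow> ?R")
proof
  assume ?L
  then obtain u v where "c # w = u @ a # v" "w' = u @ b # v" "P u v" by blast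
  then show ?R by (cases u) auto
next
  assume ?R
  then show ?L
  proof
    assume "c = a \<and> w' = b # w \<and> P [] w"
    then show ?L by (intro exI[of _ "[]"] exI[of _ w]) simp
  next
    assume "\<exists>w''. w' = c # w'' \<and> (\<exists>u v. w = u @ a # v \<and> w'' = u @ b # v \<and> P (c # u) v)"
    then obtain u v where "w = u @ a # v" "w' = c # u @ b # v" "P (c # u) v" by blast
    then show ?L by (intro exI[of _ "c # u"] exI[of _ v]) simp
  qed
qed

text \<open>Unrolling the recursion gives the signature rule: for a negative index the changed
  letter is the leftmost unmatched source. For other indices it is the first (integral) or last
  (half-integral) occurrence of an end of the root, provided that this is a source.\<close>

lemma f_op_W_iff:
  assumes i: "i \<in> root_index p q" and "w \<in> words r"
  shows "f_op (W r) i w = Some w' \<longleftrightarrow>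
     (\<exists>u v. w = u @ src i # v \<and> w' = u @ tgt i # v \<and> acts_between i u v)"
  using assms(2)
proof (induction w arbitrary: r w')
  case Nil
  then show ?case by (simp add: words_def trivial_crystal_def)
next
  case (Cons c v0)
  then obtain r' where r: "r = Suc r'" by (auto simp: words_def)
  have c: "c \<in> letters S" and v: "v0 \<in> words r'" using Cons r by (simp_all add: Cons_words)
  note neq = src_neq_tgt[OF i]
  note IH = Cons.IH[OF v]
  \<comment> \<open>For such a splitting the unmatched targets in the word are the surplus of
    targets over sources in \<open>u\<close>. So a further source in front of \<open>u\<close> keeps
    it balanced exactly when this number is positive.\<close>
  have unm: "unmatched (src i) (tgt i) (u @ src i # v) + count_list u (src i) = count_list u (tgt i)"
    if "suffix_balanced (src i) (tgt i) u" "prefix_balanced (src i) (tgt i) v" for u v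
    using unmatched_append[OF neq that(1), of "src i # v"] that(2) neq
    by (simp add: unmatched_eq_0_iff[OF neq, symmetric])
  let ?goal = "((if if 0 \<le> i then acts i c v0 else eps (W r') i v0 < of_bool (c = src i)
          then if c = src i then Some (tgt i # v0) else None
          else map_option ((#) c) (f_op (W r') i v0)) = Some w') =
      ((c = src i \<and> w' = tgt i # v0 \<and> acts_between i [] v0) \<or>
       (\<exists>w''. w' = c # w'' \<and> (\<exists>u v. v0 = u @ src i # v \<and> w'' = u @ tgt i # v \<and> acts_between i (c # u) v)))"
  show ?case
    unfolding ex_split_Cons r f_op_W_Cons[OF i c v]
  proof (cases "i < 0")
    case False
    then show ?goal
      using IH neq by (auto simp: acts_def acts_between_def)
  next
    case True
    note eps = eps_W_negative[OF i True v]
    have Nil: "acts_between i [] v0 \<longleftrightarrow> unmatched (src i) (tgt i) v0 = 0"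
      using True by (simp add: acts_between_def unmatched_eq_0_iff[OF neq])
    have Cons_other: "acts_between i (c # u) v \<longleftrightarrow> acts_between i u v" if "c \<noteq> src i" for u v
    proof -
      have "count_list u (src i) \<le> count_list u (tgt i)" if "suffix_balanced (src i) (tgt i) u"
        using that by (auto simp: suffix_balanced_def)
      then show ?thesis using that True by (auto simp: acts_between_def suffix_balanced_Cons)
    qed
    have Cons_src: "acts_between i (src i # u) v \<longleftrightarrow> acts_between i u v \<and> unmatched (src i) (tgt i) v0 > 0"
      if "v0 = u @ src i # v" for u v
      using unm[of u v] that True neq by (auto simp: acts_between_def suffix_balanced_Cons)
    show ?goal
    proof (cases "c = src i")
      case False
      then show ?thesis using True IH by (auto simp: Cons_other)
    next
      case c: True
      show ?thesis
      proof (cases "unmatched (src i) (tgt i) v0 = 0")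
        case z: True
        then show ?thesis using c True eps Nil Cons_src by auto
      next
        case nz: False
        have "(\<exists>u v. v0 = u @ src i # v \<and> w'' = u @ tgt i # v \<and> acts_between i (c # u) v) \<longleftrightarrow>
            f_op (W r') i v0 = Some w''" for w''
          unfolding IH using c nz Cons_src by blast
        then show ?thesis using c True eps Nil nz by auto
      qed
    qed
  qed
qed

lemma e_op_W_iff:
  assumes i: "i \<in> root_index p q" and "w \<in> words r"
  shows "e_op (W r) i w = Some w' \<longleftrightarrow>
     (\<exists>u v. w = u @ tgt i # v \<and> w' = u @ src i # v \<and> acts_between i u v)"
  using assms(2)
proof (induction w arbitrary: r w')
  case Nil
  then show ?case by (simp add: words_def trivial_crystal_def)
next
  case (Cons c v0)
  then obtain r' where r: "r = Suc r'" by (auto simp: words_def)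
  have c: "c \<in> letters S" and v: "v0 \<in> words r'" using Cons r by (simp_all add: Cons_words)
  note neq = src_neq_tgt[OF i]
  note IH = Cons.IH[OF v]
  \<comment> \<open>Here the letter to be changed is itself an unmatched target, hence the
    \<open>Suc\<close>.\<close>
  have unm: "unmatched (src i) (tgt i) (u @ tgt i # v) + count_list u (src i) = Suc (count_list u (tgt i))"
    if "suffix_balanced (src i) (tgt i) u" "prefix_balanced (src i) (tgt i) v" for u v
    using unmatched_append[OF neq that(1), of "tgt i # v"] that(2) neq
    by (simp add: unmatched_eq_0_iff[OF neq, symmetric])
  have le: "count_list u (src i) \<le> count_list u (tgt i)" if "suffix_balanced (src i) (tgt i) u" for u
    using that by (auto simp: suffix_balanced_def)
  let ?goal = "((if if 0 \<le> i then acts i c v0 else eps (W r') i v0 \<le> of_bool (c = src i)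
          then if c = tgt i then Some (src i # v0) else None
          else map_option ((#) c) (e_op (W r') i v0)) = Some w') =
      ((c = tgt i \<and> w' = src i # v0 \<and> acts_between i [] v0) \<or>
       (\<exists>w''. w' = c # w'' \<and> (\<exists>u v. v0 = u @ tgt i # v \<and> w'' = u @ src i # v \<and> acts_between i (c # u) v)))"
  show ?case
    unfolding ex_split_Cons r e_op_W_Cons[OF i c v]
  proof (cases "i < 0")
    case False
    then show ?goal
      using IH neq by (auto simp: acts_def acts_between_def)
  next
    case True
    note eps = eps_W_negative[OF i True v]
    have Nil: "acts_between i [] v0 \<longleftrightarrow> unmatched (src i) (tgt i) v0 = 0"
      using True by (simp add: acts_between_def unmatched_eq_0_iff[OF neq])
    have Cons_iff: "acts_between i (c # u) v \<longleftrightarrow>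
        acts_between i u v \<and> unmatched (src i) (tgt i) v0 > of_bool (c = src i)"
      if "v0 = u @ tgt i # v" for u v
      using unm[of u v] le[of u] that True neq by (auto simp: acts_between_def suffix_balanced_Cons)
    show ?goal
    proof (cases "unmatched (src i) (tgt i) v0 > of_bool (c = src i)")
      case gt: True
      have "(\<exists>u v. v0 = u @ tgt i # v \<and> w'' = u @ src i # v \<and> acts_between i (c # u) v) \<longleftrightarrow>
          e_op (W r') i v0 = Some w''" for w''
        unfolding IH using gt Cons_iff by blast
      then show ?thesis using True eps Nil gt by auto
    next
      case ngt: False
      then show ?thesis using True eps Nil Cons_iff neq by auto
    qed
  qed
qed

lemma gl_crystal_W: "gl_crystal S \<psi> p q (W r)"
  unfolding gl_crystal_def elems_W
proof (intro conjI ballI)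
  fix w assume w: "w \<in> words r"
  show "\<forall>a. a \<notin> letters S \<longrightarrow> wt (W r) w a = 0"
    using w by (auto simp: wt_W[OF w] words_def count_list_0_iff)
next
  fix i w assume i: "i \<in> root_index p q" and w: "w \<in> words r"
  note neq = src_neq_tgt[OF i]
  show "set_option (e_op (W r) i w) \<subseteq> words r" "set_option (f_op (W r) i w) \<subseteq> words r"
    using e_op_W_closed[OF i w] f_op_W_closed[OF i w] by auto
  show "0 \<le> i \<longrightarrow> phi (W r) i w + eps (W r) i w =
      (if form S (wt (W r) w) (simple_root S \<psi> i) \<noteq> 0 then 1 else 0)"
    using eps_phi_W_isotropic(3)[OF i _ w] form_isotropic_neq_0_iff[OF i, of w]
    by (auto simp: wt_W[OF w] form_simple_root'[OF i])
  show "i < 0 \<longrightarrow> int (phi (W r) i w) - int (eps (W r) i w) =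
      form S (wt (W r) w) (simple_root S \<psi> i)"
    using phi_W_negative[OF i _ w] eps_W_negative[OF i _ w]
    by (auto simp: wt_W[OF w] form_simple_root'[OF i] form_negative[OF i])
  have inverse: "f_op (W r) i w = Some w' \<longleftrightarrow> e_op (W r) i w' = Some w"
    if "w \<in> words r" "w' \<in> words r" for w w'
    using f_op_W_iff[OF i that(1)] e_op_W_iff[OF i that(2)] by auto
  then show "\<And>w'. w' \<in> words r \<Longrightarrow> f_op (W r) i w = Some w' \<longleftrightarrow> e_op (W r) i w' = Some w"
    using w by blast
  \<comment> \<open>Only \<open>f_op\<close> is checked directly; the operators being inverse to
    each other, the axiom for \<open>e_op\<close> is the same fact read backwards.\<close>
  have step: "eps (W r) i w' = eps (W r) i w + 1 \<and> int (phi (W r) i w') = int (phi (W r) i w) - 1 \<and>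
      wt (W r) w' = (\<lambda>a. wt (W r) w a - simple_root S \<psi> i a)"
    if w: "w \<in> words r" and f: "f_op (W r) i w = Some w'" for w w'
  proof -
    have w': "w' \<in> words r" using f_op_W_closed[OF i w f] .
    have e: "e_op (W r) i w' = Some w" using inverse[OF w w'] f by simp
    obtain u v where uv: "w = u @ src i # v" "w' = u @ tgt i # v" "acts_between i u v"
      using iffD1[OF f_op_W_iff[OF i w] f] by blast
    have wt: "weight w' = (\<lambda>a. weight w a - simple_root S \<psi> i a)"
      by (rule ext) (simp add: uv simple_root_eq[OF i] \<epsilon>_def)
    show ?thesis
    proof (cases "i < 0")
      case True
      then have sb: "suffix_balanced (src i) (tgt i) u" and "prefix_balanced (src i) (tgt i) v"
        using uv(3) by (auto simp: acts_between_def)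
      then have "unmatched (src i) (tgt i) v = 0" by (simp add: unmatched_eq_0_iff[OF neq])
      then have "unmatched (src i) (tgt i) w' = unmatched (src i) (tgt i) w + 1"
        using unmatched_append[OF neq sb, of "src i # v"] unmatched_append[OF neq sb, of "tgt i # v"] neq uv
        by simp
      then show ?thesis
        using phi_W_negative[OF i True w] phi_W_negative[OF i True w'] neq
        by (simp add: eps_W_negative[OF i True w] eps_W_negative[OF i True w'] wt_W[OF w] wt_W[OF w'] wt)
          (simp add: uv)
    next
      case False
      then have "0 \<le> i" by simp
      note iso = eps_phi_W_isotropic[OF i this]
      \<comment> \<open>Both words contain an end of the root, so \<open>phi\<close> and
        \<open>eps\<close> add up to 1 on each. That \<open>f_op\<close> is defined on
        \<open>w\<close> and \<open>e_op\<close> on \<open>w'\<close> decides which of them is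
        1.\<close>
      have "src i \<in> set w" "tgt i \<in> set w'" using uv by simp_all
      then have "phi (W r) i w = 1" "eps (W r) i w' = 1"
          "phi (W r) i w + eps (W r) i w = 1" "phi (W r) i w' + eps (W r) i w' = 1"
        using iso[OF w] iso[OF w'] e f by simp_all
      then show ?thesis by (simp add: wt_W[OF w] wt_W[OF w'] wt)
    qed
  qed
  show "\<forall>w'. f_op (W r) i w = Some w' \<longrightarrow>
      eps (W r) i w' = eps (W r) i w + 1 \<and> int (phi (W r) i w') = int (phi (W r) i w) - 1 \<and>
      wt (W r) w' = (\<lambda>a. wt (W r) w a - simple_root S \<psi> i a)"
    using step[OF w] by blast
  show "\<forall>w'. e_op (W r) i w = Some w' \<longrightarrow>
      int (eps (W r) i w') = int (eps (W r) i w) - 1 \<and> phi (W r) i w' = phi (W r) i w + 1 \<and>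
      wt (W r) w' = (\<lambda>a. wt (W r) w a + simple_root S \<psi> i a)"
  proof (intro allI impI)
    fix w' assume e: "e_op (W r) i w = Some w'"
    have w': "w' \<in> words r" using e_op_W_closed[OF i w e] .
    have st: "eps (W r) i w = eps (W r) i w' + 1 \<and> int (phi (W r) i w) = int (phi (W r) i w') - 1 \<and>
      wt (W r) w = (\<lambda>a. wt (W r) w' a - simple_root S \<psi> i a)"
      using step[OF w'] inverse[OF w' w] e by blast
    moreover have "wt (W r) w' = (\<lambda>a. wt (W r) w a + simple_root S \<psi> i a)"
      by (rule ext) (simp add: st)
    ultimately show "int (eps (W r) i w') = int (eps (W r) i w) - 1 \<and> phi (W r) i w' = phi (W r) i w + 1 \<and>
      wt (W r) w' = (\<lambda>a. wt (W r) w a + simple_root S \<psi> i a)"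
      by (intro conjI) linarith+
  qed
qed

end

section \<open>Diagrams and their reading order\<close>

definition cells :: "shape \<Rightarrow> (nat \<times> nat) list" where
  "cells rs = concat (map (\<lambda>i. rev (map (Pair i) [fst (rs ! i)..<fst (rs ! i) + snd (rs ! i)]))
     [0..<length rs])"

definition before :: "nat \<times> nat \<Rightarrow> nat \<times> nat \<Rightarrow> bool" where
  "before x y \<longleftrightarrow> fst x < fst y \<or> (fst x = fst y \<and> snd y < snd x)"

lemma reading_word_eq: "reading_word rs T = map T (cells rs)"
  unfolding reading_word_def cells_def map_concat map_map
  by (intro arg_cong[where f = concat] map_cong) (simp_all add: rev_map)

lemma set_cells: "set (cells rs) = nodes rs"
  by (auto simp: cells_def nodes_def)

lemma sorted_cells: "sorted_wrt before (cells rs)"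
proof -
  have "sorted_wrt before (concat (map (\<lambda>i. rev (map (Pair i) [f i..<g i])) [0..<n]))" for f g :: "nat \<Rightarrow> nat" and n
  proof (induction n)
    case (Suc n)
    have "sorted_wrt before (rev (map (Pair n) [f n..<g n]))"
      by (simp add: sorted_wrt_rev sorted_wrt_map before_def)
    moreover have "\<forall>x\<in>set (concat (map (\<lambda>i. rev (map (Pair i) [f i..<g i])) [0..<n])).
        \<forall>y\<in>set (rev (map (Pair n) [f n..<g n])). before x y"
      by (auto simp: before_def)
    ultimately show ?case using Suc by (simp add: sorted_wrt_append)
  qed simp
  then show ?thesis by (simp add: cells_def)
qed

lemma before_asym: "before x y \<Longrightarrow> \<not> before y x" and before_irrefl: "\<not> before x x"
  by (auto simp: before_def)

lemma distinct_cells: "distinct (cells rs)"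
proof -
  have "sorted_wrt before xs \<Longrightarrow> distinct xs" for xs
    by (induction xs) (auto simp: before_irrefl)
  then show ?thesis using sorted_cells .
qed

lemma cells_split:
  assumes "cells rs = u @ x # v"
  shows "set u = {y \<in> nodes rs. before y x}" "set v = {y \<in> nodes rs. before x y}"
proof -
  have "sorted_wrt before (u @ x # v)" using sorted_cells[of rs] assms by simp
  then have "\<forall>y\<in>set u. before y x" "\<forall>y\<in>set v. before x y" by (auto simp: sorted_wrt_append)
  moreover have "nodes rs = set u \<union> {x} \<union> set v" using set_cells[of rs] assms by auto
  ultimately show "set u = {y \<in> nodes rs. before y x}" "set v = {y \<in> nodes rs. before x y}"
    using before_asym before_irrefl by blast+
qed

lemma length_cells: "length (cells rs) = sum_list (map snd rs)"
proof -
  have "length (cells rs) = (\<Sum>i\<leftarrow>[0..<length rs]. snd (rs ! i))"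
    by (simp add: cells_def length_concat o_def)
  also have "\<dots> = sum_list (map snd (map ((!) rs) [0..<length rs]))" by (simp add: o_def)
  finally show ?thesis by (simp only: map_nth)
qed

lemma count_list_map_distinct:
  "distinct xs \<Longrightarrow> count_list (map T xs) a = card {x \<in> set xs. T x = a}"
proof (induction xs)
  case (Cons x xs)
  have "{y \<in> set (x # xs). T y = a} = (if T x = a then {x} else {}) \<union> {y \<in> set xs. T y = a}" by auto
  then show ?case using Cons by (auto simp: card_insert_if)
qed simp

lemma mem_young: "(i, j) \<in> young \<mu> \<longleftrightarrow> i < length \<mu> \<and> j < \<mu> ! i"
  by (auto simp: young_def nodes_def pair_shape_def)

lemma mem_nodes_pair_shape:
  "(i, j) \<in> nodes (pair_shape \<mu> \<alpha>) \<longleftrightarrow> (i, j) \<in> young \<mu> \<or>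
     (\<exists>k<length \<alpha>. i = length \<mu> + k \<and> (\<Sum>l<k. \<alpha> ! l - 1) \<le> j \<and> j < (\<Sum>l<k. \<alpha> ! l - 1) + \<alpha> ! k)"
proof (cases "i < length \<mu>")
  case True
  then show ?thesis by (auto simp: mem_young nodes_def pair_shape_def nth_append)
next
  case False
  then obtain k where "i = length \<mu> + k" by (metis le_Suc_ex linorder_not_less)
  then show ?thesis by (auto simp: mem_young nodes_def pair_shape_def nth_append)
qed

lemma compositions_nth: "\<alpha> \<in> compositions \<Longrightarrow> k < length \<alpha> \<Longrightarrow> 0 < \<alpha> ! k"
  by (auto simp: compositions_def) (metis gr0I nth_mem)

lemma partition_nth_antimono:
  "\<mu> \<in> partitions \<Longrightarrow> i \<le> i' \<Longrightarrow> i' < length \<mu> \<Longrightarrow> \<mu> ! i' \<le> \<mu> ! i"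
  by (cases "i = i'") (auto simp: partitions_def sorted_wrt_iff_nth_less)

lemma young_down_closed:
  assumes "\<mu> \<in> partitions" "(i, j) \<in> young \<mu>" "i' \<le> i" "j' \<le> j"
  shows "(i', j') \<in> young \<mu>"
  using assms partition_nth_antimono[of \<mu> i' i] by (auto simp: mem_young)

lemma young_first_column: "\<mu> \<in> partitions \<Longrightarrow> (i, 0) \<in> young \<mu> \<longleftrightarrow> i < length \<mu>"
  by (auto simp: mem_young partitions_def) (metis gr0I nth_mem)

context crystal_alphabet
begin

section \<open>Relations between letters along rows and columns\<close>

definition rowrel :: "'a \<Rightarrow> 'a \<Rightarrow> bool" where
  "rowrel c d \<longleftrightarrow> \<psi> c < \<psi> d \<or> (c = d \<and> \<psi> c \<in> \<int>)"

definition colrel :: "'a \<Rightarrow> 'a \<Rightarrow> bool" where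
  "colrel c d \<longleftrightarrow> \<psi> c < \<psi> d \<or> (c = d \<and> \<psi> c \<notin> \<int>)"

definition row_pair :: "nat \<times> nat \<Rightarrow> nat \<times> nat \<Rightarrow> bool" where
  "row_pair x y \<longleftrightarrow> fst x = fst y \<and> snd x < snd y"

definition col_pair :: "nat \<times> nat \<Rightarrow> nat \<times> nat \<Rightarrow> bool" where
  "col_pair x y \<longleftrightarrow> snd x = snd y \<and> fst x < fst y"

lemma \<psi>_letter: "c \<in> letters S \<Longrightarrow> \<psi> c \<in> letters (alph_N p q)"
  using image_\<psi> by blast

lemma non_integer_positive: "c \<in> letters S \<Longrightarrow> \<psi> c \<notin> \<int> \<Longrightarrow> 0 < \<psi> c"
  by (drule \<psi>_letter, cases rule: alph_N_cases) auto

lemma \<psi>_neq_0: "c \<in> letters S \<Longrightarrow> \<psi> c \<noteq> 0"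
  by (drule \<psi>_letter, cases rule: alph_N_cases) auto

lemma \<psi>_ge:
  assumes "c \<in> letters S"
  shows "- of_nat p \<le> \<psi> c"
  using \<psi>_letter[OF assms]
proof (cases rule: alph_N_cases)
  case (neg k)
  have "(of_int (- int p) :: rat) \<le> of_int k" using neg(2) by (simp only: of_int_le_iff)
  then show ?thesis using neg by simp
next
  case (pos k)
  then show ?thesis by (simp add: order_trans[of _ 0])
qed

text \<open>Negative letters are consecutive integers and all others are positive. For
  \<open>k = -1\<close> the bound obtained is 0, which is not the value of a letter.\<close>

lemma \<psi>_integer_step:
  assumes "c \<in> letters S" "of_int k < \<psi> c" "k < 0"
  shows "of_int (k + 1) \<le> \<psi> c"
  using \<psi>_letter[OF assms(1)]
proof (cases rule: alph_N_cases)
  case (neg l)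
  then have "k < l" using assms(2) by simp
  then have "k + 1 \<le> l" by simp
  then show ?thesis using neg(1) by (simp only: of_int_le_iff)
next
  case (pos l)
  have "(of_int (k + 1) :: rat) \<le> of_int 0" using assms(3) by (simp only: of_int_le_iff)
  then show ?thesis using pos by (simp add: order_trans[of _ 0])
qed

lemma semistandard_iff:
  "T \<in> semistandard S D \<longleftrightarrow> T \<in> D \<rightarrow>\<^sub>E letters S \<and>
     (\<forall>x\<in>D. \<forall>y\<in>D. (row_pair x y \<longrightarrow> rowrel (T x) (T y)) \<and> (col_pair x y \<longrightarrow> colrel (T x) (T y)))"
proof (cases "T \<in> D \<rightarrow>\<^sub>E letters S")
  case True
  then have *: "T x \<in> letters S" if "x \<in> D" for x using that by auto
  show ?thesis
    unfolding semistandard_def row_pair_def col_pair_def rowrel_def colrel_def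
    using True by (auto simp: * lt_iff odd_iff split_paired_Ball_Sigma) (metis * lt_iff odd_iff fst_conv snd_conv)+
qed (simp add: semistandard_def)

section \<open>Stability of the tableaux under the crystal operators\<close>

text \<open>Negative letters are even and do not repeat in a column, so from the least possible
  value -p each step down gains at least 1 until 0 is reached. The case \<open>i = p\<close> is
  included on purpose: it makes the joint positive.\<close>

lemma column_lower_bound:
  assumes T: "T \<in> semistandard S D" and D: "\<And>i'. i' \<le> i \<Longrightarrow> (i', j) \<in> D" and "i \<le> p"
  shows "of_int (int i - int p) \<le> \<psi> (T (i, j))"
  using D \<open>i \<le> p\<close>
proof (induction i)
  case 0
  then have "T (0, j) \<in> letters S" using T by (auto simp: semistandard_iff)
  then show ?case using \<psi>_ge by simp
next
  case (Suc i)
  have in_D: "(i, j) \<in> D" "(Suc i, j) \<in> D" using Suc.prems by auto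
  then have l: "T (Suc i, j) \<in> letters S" and r: "colrel (T (i, j)) (T (Suc i, j))"
    using T by (auto simp: semistandard_iff col_pair_def)
  have IH: "of_int (int i - int p) \<le> \<psi> (T (i, j))" using Suc by simp
  show ?case
  proof (cases "\<psi> (T (i, j)) < \<psi> (T (Suc i, j))")
    case True
    then have "of_int (int i - int p) < \<psi> (T (Suc i, j))" using IH by simp
    then show ?thesis using \<psi>_integer_step[OF l, of "int i - int p"] Suc.prems(2) by (simp add: algebra_simps)
  next
    case False
    then have "0 < \<psi> (T (Suc i, j))" using r non_integer_positive[OF l] by (auto simp: colrel_def)
    moreover have "(of_int (int (Suc i) - int p) :: rat) \<le> of_int 0"
      using Suc.prems(2) by (simp only: of_int_le_iff)
    ultimately show ?thesis by simp
  qed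
qed

lemma rowrel_le: "rowrel c d \<Longrightarrow> \<psi> c \<le> \<psi> d" and colrel_le: "colrel c d \<Longrightarrow> \<psi> c \<le> \<psi> d"
  by (auto simp: rowrel_def colrel_def)

section \<open>Fillings of a fixed pair, and what a change of one entry does to them\<close>

context
  fixes \<mu> \<alpha> :: "nat list" and D J
  assumes in_C: "(\<mu>, \<alpha>) \<in> pairs_C p"
  defines "D \<equiv> nodes (pair_shape \<mu> \<alpha>)" and "J \<equiv> (length \<mu>, 0 :: nat)"
begin

lemma pairs_C_D: "\<mu> \<in> partitions" "\<alpha> \<in> compositions" "length \<mu> \<le> p" "\<alpha> \<noteq> [] \<Longrightarrow> length \<mu> = p"
  using in_C by (auto simp: pairs_C_def)

lemma young_subset_D: "x \<in> young \<mu> \<Longrightarrow> x \<in> D"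
  by (cases x) (simp add: D_def mem_nodes_pair_shape)

lemma joint_in_D: "\<alpha> \<noteq> [] \<Longrightarrow> J \<in> D"
  using compositions_nth[OF pairs_C_D(2), of 0] by (auto simp: D_def J_def mem_nodes_pair_shape)

lemma joint_positive:
  assumes T: "T \<in> semistandard S D" and "\<alpha> \<noteq> []"
  shows "0 < \<psi> (T J)"
proof -
  have l: "length \<mu> = p" using pairs_C_D(4) assms(2) by simp
  have "(i, 0) \<in> D" if "i \<le> p" for i
    using that joint_in_D[OF assms(2)] young_subset_D[of "(i, 0)"] young_first_column[OF pairs_C_D(1)] l
    by (cases "i = p") (auto simp: J_def)
  then have "0 \<le> \<psi> (T (p, 0))" using column_lower_bound[OF T, of p 0] by simp
  moreover have "\<psi> (T (p, 0)) \<noteq> 0"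
    using T joint_in_D[OF assms(2)] l by (intro \<psi>_neq_0) (auto simp: semistandard_iff J_def)
  ultimately show ?thesis by (simp add: J_def l)
qed

text \<open>
  The joint behaves as if it were placed below every body entry; this is the parity condition
  in the definition, the joint entry being positive.
\<close>

definition below :: "nat \<times> nat \<Rightarrow> nat \<times> nat \<Rightarrow> bool" where
  "below x y \<longleftrightarrow> col_pair x y \<or> (\<alpha> \<noteq> [] \<and> x \<in> young \<mu> \<and> y = J)"

lemma below_before: "below x y \<Longrightarrow> before x y"
  by (cases x) (auto simp: below_def col_pair_def before_def mem_young J_def)

lemma row_pair_before: "row_pair x y \<Longrightarrow> before y x"
  by (auto simp: row_pair_def before_def)

lemma pair_tableaux_iff:
  "T \<in> pair_tableaux S \<psi> \<mu> \<alpha> \<longleftrightarrow> T \<in> D \<rightarrow>\<^sub>E letters S \<and>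
     (\<forall>x\<in>D. \<forall>y\<in>D. (row_pair x y \<longrightarrow> rowrel (T x) (T y)) \<and> (below x y \<longrightarrow> colrel (T x) (T y)))"
proof (cases "T \<in> semistandard S D")
  case True
  then have l: "T x \<in> letters S" if "x \<in> D" for x using that by (auto simp: semistandard_iff)
  have "(\<alpha> \<noteq> [] \<longrightarrow> (let b = T (length \<mu>, 0) in
        (\<psi> b \<in> \<int> \<and> 0 < \<psi> b \<longrightarrow> (\<forall>x\<in>young \<mu>. lt S (T x) b)) \<and>
        (\<psi> b \<notin> \<int> \<longrightarrow> (\<forall>x\<in>young \<mu>. lt S (T x) b \<or> T x = b)))) \<longleftrightarrow>
     (\<alpha> \<noteq> [] \<longrightarrow> (\<forall>x\<in>young \<mu>. colrel (T x) (T J)))"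
  proof (cases "\<alpha> = []")
    case False
    have "lt S (T x) (T J) \<longleftrightarrow> \<psi> (T x) < \<psi> (T J)" if "x \<in> young \<mu>" for x
      using lt_iff l young_subset_D[OF that] joint_in_D[OF False] by blast
    then show ?thesis
      using joint_positive[OF True False] False by (auto simp: Let_def colrel_def J_def)
  qed simp
  then show ?thesis
    using True joint_in_D young_subset_D
    by (auto simp: pair_tableaux_def semistandard_iff below_def D_def[symmetric])
next
  case False
  then show ?thesis
    by (auto simp: pair_tableaux_def semistandard_iff below_def D_def[symmetric])
qed

text \<open>Entries weakly increase along the ribbon, which starts at the joint. Since the joint is
  positive, this confines all negative entries, and with them all bracketing arguments, to the
  body.\<close>

lemma ribbon_ge_joint:
  assumes T: "T \<in> semistandard S D" and x: "x \<in> D" "x \<notin> young \<mu>"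
  shows "\<alpha> \<noteq> []" "\<psi> (T J) \<le> \<psi> (T x)"
proof -
  obtain k j where k: "k < length \<alpha>" "x = (length \<mu> + k, j)" "(\<Sum>l<k. \<alpha> ! l - 1) \<le> j"
      "j < (\<Sum>l<k. \<alpha> ! l - 1) + \<alpha> ! k"
    using x by (cases x) (auto simp: D_def mem_nodes_pair_shape)
  then show "\<alpha> \<noteq> []" by auto
  have mono: "\<psi> (T y) \<le> \<psi> (T z)" if "y \<in> D" "z \<in> D" "row_pair y z \<or> col_pair y z \<or> y = z" for y z
    using that T rowrel_le colrel_le by (auto simp: semistandard_iff)
  have "\<psi> (T J) \<le> \<psi> (T (length \<mu> + k, j))"
    using k(1,3,4)
  proof (induction k arbitrary: j)
    case 0
    then have "(length \<mu>, j) \<in> D" by (auto simp: D_def mem_nodes_pair_shape)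
    then show ?case using mono[of J "(length \<mu>, j)"] joint_in_D[OF \<open>\<alpha> \<noteq> []\<close>]
      by (auto simp: row_pair_def J_def)
  next
    case (Suc k)
    \<comment> \<open>The column shared by the ribbon rows \<open>k\<close> and
      \<open>Suc k\<close>, through which the chain of inequalities passes downwards.\<close>
    define s where "s = (\<Sum>l<Suc k. \<alpha> ! l - 1)"
    have "0 < \<alpha> ! k" "0 < \<alpha> ! Suc k" using Suc.prems compositions_nth[OF pairs_C_D(2)] by auto
    then have D': "(length \<mu> + k, s) \<in> D" "(length \<mu> + Suc k, s) \<in> D" "(length \<mu> + Suc k, j) \<in> D"
      and s: "(\<Sum>l<k. \<alpha> ! l - 1) \<le> s" "s < (\<Sum>l<k. \<alpha> ! l - 1) + \<alpha> ! k"
      using Suc.prems by (auto simp: D_def mem_nodes_pair_shape s_def)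
    have "\<psi> (T J) \<le> \<psi> (T (length \<mu> + k, s))" using Suc s by simp
    also have "\<dots> \<le> \<psi> (T (length \<mu> + Suc k, s))" using mono D' by (simp add: col_pair_def)
    also have "\<dots> \<le> \<psi> (T (length \<mu> + Suc k, j))"
    proof -
      have "s \<le> j" using Suc.prems(2) by (simp only: s_def)
      then show ?thesis using mono[of "(length \<mu> + Suc k, s)" "(length \<mu> + Suc k, j)"] D'
        by (cases "s = j") (auto simp: row_pair_def)
    qed
    finally show ?case .
  qed
  then show "\<psi> (T J) \<le> \<psi> (T x)" using k(2) by simp
qed

lemma negative_in_young:
  assumes T: "T \<in> semistandard S D" and "x \<in> D" "\<psi> (T x) < 0"
  shows "x \<in> young \<mu>"
  using ribbon_ge_joint[OF T \<open>x \<in> D\<close>] joint_positive[OF T] assms(3) by fastforce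

text \<open>The ends are neighbours, so only entries equal to \<open>a\<close> or \<open>b\<close>
  can obstruct. For integral \<open>i\<close>, where the source is even and the target odd, none of
  these lies to the right of \<open>x\<close> or above it; to the left the source may repeat in the
  row, and below the target may repeat in the column. For half-integral \<open>i\<close> the
  parities and the directions are exchanged.\<close>

lemma isotropic_stable:
  assumes i: "i \<in> root_index p q" "0 \<le> i" and T: "T \<in> pair_tableaux S \<psi> \<mu> \<alpha>" and x: "x \<in> D"
    and ab: "T x = a" "{a, b} = {src i, tgt i}"
    and far: "\<And>y. y \<in> D \<Longrightarrow> (if i \<in> \<int> then before y x else before x y) \<Longrightarrow> T y \<noteq> a \<and> T y \<noteq> b"
  shows "T(x := b) \<in> pair_tableaux S \<psi> \<mu> \<alpha>"
proof -
  have T': "T \<in> D \<rightarrow>\<^sub>E letters S" "\<And>x y. x \<in> D \<Longrightarrow> y \<in> D \<Longrightarrow> row_pair x y \<Longrightarrow> rowrel (T x) (T y)"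
    "\<And>x y. x \<in> D \<Longrightarrow> y \<in> D \<Longrightarrow> below x y \<Longrightarrow> colrel (T x) (T y)"
    using T by (auto simp: pair_tableaux_iff)
  have l: "T y \<in> letters S" if "y \<in> D" for y using that T' by auto
  have bl: "b \<in> letters S" using ab(2) src_letter[OF i(1)] tgt_letter[OF i(1)] by (auto simp: doubleton_eq_iff)
  have adj: "\<psi> (T y) \<le> \<psi> (src i) \<or> \<psi> (tgt i) \<le> \<psi> (T y)" if "y \<in> D" for y
    using root_ends_adjacent[OF i(1) \<psi>_letter[OF l[OF that]]] \<psi>_src \<psi>_tgt i(1) by simp
  have less: "\<psi> (src i) < \<psi> (tgt i)" using root_src_less_tgt[of i] \<psi>_src \<psi>_tgt i(1) by simp
  have par: "\<psi> (src i) \<in> \<int> \<longleftrightarrow> i \<in> \<int>" "\<psi> (tgt i) \<in> \<int> \<longleftrightarrow> i \<notin> \<int>"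
    using root_ends_parity[OF i(1)] \<psi>_src \<psi>_tgt i by simp_all
  have eq: "\<psi> (T y) = \<psi> (src i) \<longleftrightarrow> T y = src i" "\<psi> (T y) = \<psi> (tgt i) \<longleftrightarrow> T y = tgt i" if "y \<in> D" for y
    using \<psi>_eq_iff l[OF that] src_letter[OF i(1)] tgt_letter[OF i(1)] by blast+
  have ab': "(a = src i \<and> b = tgt i) \<or> (a = tgt i \<and> b = src i)"
    using ab(2) by (auto simp: doubleton_eq_iff)
  have R1: "rowrel b (T y)" if y: "y \<in> D" "row_pair x y" for y
  proof -
    have "rowrel a (T y)" using T'(2)[OF x y] ab(1) by simp
    moreover have "T y \<noteq> a \<and> T y \<noteq> b" if "i \<in> \<int>" using far[OF y(1)] that row_pair_before[OF y(2)] by simp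
    ultimately show ?thesis using adj[OF y(1)] less par eq[OF y(1)] ab' unfolding rowrel_def
      by (cases "i \<in> \<int>") auto
  qed
  have R2: "rowrel (T y) b" if y: "y \<in> D" "row_pair y x" for y
  proof -
    have "rowrel (T y) a" using T'(2)[OF y(1) x y(2)] ab(1) by simp
    moreover have "T y \<noteq> a \<and> T y \<noteq> b" if "i \<notin> \<int>" using far[OF y(1)] that row_pair_before[OF y(2)] by simp
    ultimately show ?thesis using adj[OF y(1)] less par eq[OF y(1)] ab' unfolding rowrel_def
      by (cases "i \<in> \<int>") auto
  qed
  have C1: "colrel b (T y)" if y: "y \<in> D" "below x y" for y
  proof -
    have "colrel a (T y)" using T'(3)[OF x y] ab(1) by simp
    moreover have "T y \<noteq> a \<and> T y \<noteq> b" if "i \<notin> \<int>" using far[OF y(1)] that below_before[OF y(2)] by simp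
    ultimately show ?thesis using adj[OF y(1)] less par eq[OF y(1)] ab' unfolding colrel_def
      by (cases "i \<in> \<int>") auto
  qed
  have C2: "colrel (T y) b" if y: "y \<in> D" "below y x" for y
  proof -
    have "colrel (T y) a" using T'(3)[OF y(1) x y(2)] ab(1) by simp
    moreover have "T y \<noteq> a \<and> T y \<noteq> b" if "i \<in> \<int>" using far[OF y(1)] that below_before[OF y(2)] by simp
    ultimately show ?thesis using adj[OF y(1)] less par eq[OF y(1)] ab' unfolding colrel_def
      by (cases "i \<in> \<int>") auto
  qed
  have "\<not> row_pair x x" "\<not> below x x"
    using row_pair_before below_before before_irrefl by blast+
  moreover have "T(x := b) \<in> D \<rightarrow>\<^sub>E letters S" using T'(1) x bl by (auto simp: PiE_iff extensional_def)
  ultimately show ?thesis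
    unfolding pair_tableaux_iff using T'(2,3) R1 R2 C1 C2 by auto
qed

text \<open>
  Around a node where \<open>f_op\<close> acts for a negative index, bracketing rules out the neighbours which
  would make the result fail to be semistandard: the entries \<open>src i\<close> of a row are matched by the
  entries \<open>tgt i\<close> directly below them.
\<close>

context
  fixes i T u x v a b
  assumes i: "i \<in> root_index p q" "i < 0" and T: "T \<in> pair_tableaux S \<psi> \<mu> \<alpha>"
    and split: "cells (pair_shape \<mu> \<alpha>) = u @ x # v"
    and u: "suffix_balanced (src i) (tgt i) (map T u)" and v: "prefix_balanced (src i) (tgt i) (map T v)"
  defines "a \<equiv> src i" and "b \<equiv> tgt i"
begin

lemma T_rel: "T \<in> D \<rightarrow>\<^sub>E letters S"
  "y \<in> D \<Longrightarrow> z \<in> D \<Longrightarrow> row_pair y z \<Longrightarrow> rowrel (T y) (T z)"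
  "y \<in> D \<Longrightarrow> z \<in> D \<Longrightarrow> below y z \<Longrightarrow> colrel (T y) (T z)"
  using T by (auto simp: pair_tableaux_iff)

lemma T_semistandard: "T \<in> semistandard S D"
  using T_rel by (auto simp: semistandard_iff below_def)

lemma T_letter: "y \<in> D \<Longrightarrow> T y \<in> letters S"
  using T_rel(1) by auto

lemma ends_letters: "a \<in> letters S" "b \<in> letters S"
  using src_letter[OF i(1)] tgt_letter[OF i(1)] by (auto simp: a_def b_def)

lemma T_adjacent: "y \<in> D \<Longrightarrow> \<psi> (T y) \<le> \<psi> a \<or> \<psi> b \<le> \<psi> (T y)"
  using root_ends_adjacent[OF i(1) \<psi>_letter[OF T_letter]] \<psi>_src \<psi>_tgt i(1) by (simp add: a_def b_def)

lemma ends_less: "\<psi> a < \<psi> b" and ends_Ints: "\<psi> a \<in> \<int>" "\<psi> b \<in> \<int>" and tgt_negative: "\<psi> b < 0"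
  using root_src_less_tgt[of i] root_ends_parity[OF i(1)] \<psi>_src \<psi>_tgt i negative_root_in_Ints[OF i]
  by (simp_all add: a_def b_def root_tgt_def)

lemma T_eq_iff: "y \<in> D \<Longrightarrow> \<psi> (T y) = \<psi> a \<longleftrightarrow> T y = a" "y \<in> D \<Longrightarrow> \<psi> (T y) = \<psi> b \<longleftrightarrow> T y = b"
  using \<psi>_eq_iff T_letter ends_letters by blast+

lemma x_in_D: "x \<in> D"
  using set_cells[of "pair_shape \<mu> \<alpha>"] split by (auto simp: D_def)

lemma split_distinct: "distinct (u @ x # v)"
  using distinct_cells[of "pair_shape \<mu> \<alpha>"] split by simp

lemmas split_sets = cells_split[OF split, folded D_def]

lemma update_stable:
  assumes c: "c \<in> letters S"
    and R1: "\<And>y. y \<in> D \<Longrightarrow> row_pair x y \<Longrightarrow> rowrel c (T y)"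
    and C1: "\<And>y. y \<in> D \<Longrightarrow> below x y \<Longrightarrow> colrel c (T y)"
    and R2: "\<And>y. y \<in> D \<Longrightarrow> row_pair y x \<Longrightarrow> rowrel (T y) c"
    and C2: "\<And>y. y \<in> D \<Longrightarrow> below y x \<Longrightarrow> colrel (T y) c"
  shows "T(x := c) \<in> pair_tableaux S \<psi> \<mu> \<alpha>"
proof -
  have "\<not> row_pair x x" "\<not> below x x"
    using row_pair_before below_before before_irrefl by blast+
  moreover have "T(x := c) \<in> D \<rightarrow>\<^sub>E letters S"
    using T_rel(1) x_in_D c by (auto simp: PiE_iff extensional_def)
  ultimately show ?thesis
    unfolding pair_tableaux_iff using T_rel(2,3) R1 R2 C1 C2 by auto
qed

lemma negative_f_stable:
  assumes Tx: "T x = a"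
  shows "T(x := b) \<in> pair_tableaux S \<psi> \<mu> \<alpha>"
proof -
  note T' = T_rel and ss = T_semistandard and l = T_letter and ab_l = ends_letters
    and adj = T_adjacent and less = ends_less and par = ends_Ints and neg = tgt_negative
    and eq = T_eq_iff and xD = x_in_D and dist = split_distinct and sets = split_sets
    and young_D = young_subset_D
  have x_young: "x \<in> young \<mu>"
    using negative_in_young[OF ss xD] Tx less neg by simp
  obtain R j where x: "x = (R, j)" by (cases x)
  \<comment> \<open>An \<open>a\<close> to the right of \<open>x\<close> is read earlier, and only
    entries \<open>a\<close> are read between the two. The part of \<open>u\<close> that starts
    there contains an \<open>a\<close> and no \<open>b\<close>, against the balance of
    \<open>u\<close>.\<close>
  have R1: "T y \<noteq> a" if y: "y \<in> D" "row_pair x y" for y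
  proof
    assume Ty: "T y = a"
    have "y \<in> set u" using y row_pair_before sets by blast
    then obtain u1 u2 where u12: "u = u1 @ y # u2" by (meson split_list)
    have "T z = a" if "z \<in> set u2" for z
    proof -
      have "cells (pair_shape \<mu> \<alpha>) = u1 @ y # (u2 @ x # v)" using split u12 by simp
      from cells_split(2)[OF this] that have zD: "z \<in> D" and "before y z" by (auto simp: D_def)
      moreover have "before z x" using that sets(1) u12 by auto
      ultimately have "row_pair x z" "row_pair z y" using y(2) by (auto simp: before_def row_pair_def)
      then have "rowrel a (T z)" "rowrel (T z) a" using T'(2)[OF xD zD] T'(2)[OF zD y(1)] Tx Ty by simp_all
      then show "T z = a" by (auto simp: rowrel_def)
    qed
    then have "count_list (map T u2) b = 0" using less by (auto simp: count_list_0_iff)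
    moreover have "map T u = map T u1 @ map T (y # u2)" using u12 by simp
    then have "count_list (map T (y # u2)) a \<le> count_list (map T (y # u2)) b"
      using u unfolding suffix_balanced_def a_def b_def by blast
    ultimately show False using Ty less by (auto split: if_splits)
  qed
  \<comment> \<open>A \<open>b\<close> below \<open>x\<close> forces a \<open>b\<close> directly
    under every \<open>a\<close> of this row from \<open>x\<close> leftwards. Reading on from
    \<open>x\<close>, one then meets more \<open>b\<close> than \<open>a\<close>.\<close>
  have C1: "T y \<noteq> b" if y: "y \<in> D" "below x y" for y
  proof
    assume Ty: "T y = b"
    have "y \<in> young \<mu>" using negative_in_young[OF ss y(1)] Ty neg by simp
    then have cp: "col_pair x y" using y(2) by (auto simp: below_def J_def mem_young)
    obtain R2 where y_eq: "y = (R2, j)" "R < R2" using cp x by (cases y) (auto simp: col_pair_def)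
    have belowD: "(R + 1, j') \<in> young \<mu>" if "j' \<le> j" for j'
      using young_down_closed[OF pairs_C_D(1)] \<open>y \<in> young \<mu>\<close> y_eq that by (metis Suc_eq_plus1 Suc_leI)
    have rowD: "(R, j') \<in> young \<mu>" if "j' \<le> j" for j'
      using young_down_closed[OF pairs_C_D(1)] x_young x that by (metis order_refl)
    have colD: "colrel (T (R, j')) (T (R + 1, j'))" if "j' \<le> j" for j'
      using T'(3)[OF young_D[OF rowD[OF that]] young_D[OF belowD[OF that]]] by (simp add: below_def col_pair_def)
    have z: "\<psi> (T (R + 1, j)) \<le> \<psi> b"
    proof (cases "R2 = R + 1")
      case False
      then have "below (R + 1, j) y" using y_eq by (simp add: below_def col_pair_def)
      then show ?thesis using T'(3)[OF young_D[OF belowD[of j]] y(1)] Ty colrel_le by simp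
    qed (use y_eq Ty in simp)
    \<comment> \<open>The columns of these \<open>a\<close>. The prefix \<open>P\<close> of
      \<open>v\<close> will end at the entry under the leftmost of them, so that it contains the
      whole block of \<open>b\<close> underneath.\<close>
    define A where "A = {j'. j' \<le> j \<and> T (R, j') = a}"
    have "finite A" "j \<in> A" using Tx x by (auto simp: A_def)
    define j0 where "j0 = Min A"
    have j0: "j0 \<in> A" "\<And>j'. j' \<in> A \<Longrightarrow> j0 \<le> j'" using \<open>finite A\<close> \<open>j \<in> A\<close> by (auto simp: j0_def intro: Min_in)
    define y0 where "y0 = (R + 1, j0)"
    have y0: "y0 \<in> young \<mu>" using belowD j0 by (auto simp: y0_def A_def)
    then have "y0 \<in> set v" using young_D sets(2) by (auto simp: before_def x y0_def)
    then obtain v1 v2 where v12: "v = v1 @ y0 # v2" by (meson split_list)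
    define P where "P = v1 @ [y0]"
    have "cells (pair_shape \<mu> \<alpha>) = (u @ x # v1) @ y0 # v2" using split v12 by simp
    note sets0 = cells_split[OF this, folded D_def]
    have setP: "set P = {z \<in> D. before x z \<and> (before z y0 \<or> z = y0)}"
    proof -
      have "z \<in> set P \<longleftrightarrow> before x z \<and> (before z y0 \<or> z = y0)" if "z \<in> D" for z
      proof -
        have "z \<in> set v \<longleftrightarrow> before x z" using sets that by simp
        moreover have "z \<in> set (u @ x # v1) \<longleftrightarrow> before z y0" "z \<in> set v2 \<longleftrightarrow> before y0 z" using sets0 that by simp_all
        moreover have "z \<notin> set v1" if "z \<in> set (u @ [x])" using that dist v12 by auto
        ultimately show ?thesis using dist v12 before_asym[of z y0] before_irrefl
          by (auto simp: P_def)
      qed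
      moreover have "set P \<subseteq> D" using sets v12 by (auto simp: P_def)
      ultimately show ?thesis by blast
    qed
    have distP: "distinct P" using dist v12 by (simp add: P_def)
    have "{z \<in> set P. T z = a} \<subseteq> Pair R ` (A - {j})"
    proof
      fix z assume z: "z \<in> {z \<in> set P. T z = a}"
      obtain R' j' where z_eq: "z = (R', j')" by (cases z)
      have zD: "z \<in> D" and bz: "before x z" "before z y0 \<or> z = y0" and Tz: "T z = a" using z setP by auto
      consider "R' = R" "j' < j" | "R' = R + 1" "j0 \<le> j'"
        using bz by (auto simp: z_eq x y0_def before_def)
      then show "z \<in> Pair R ` (A - {j})"
      proof cases
        case 1
        then show ?thesis using Tz by (auto simp: z_eq A_def)
      next
        case 2
        have "\<psi> (T y0) \<le> \<psi> (T z)"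
        proof (cases "j' = j0")
          case False
          then have "row_pair y0 z" using 2 by (simp add: row_pair_def y0_def z_eq)
          then show ?thesis using T'(2)[OF young_D[OF y0] zD] rowrel_le by blast
        qed (use 2 in \<open>simp add: y0_def z_eq\<close>)
        moreover have "\<psi> a < \<psi> (T y0)" using colD[of j0] j0(1) par by (auto simp: A_def colrel_def y0_def)
        ultimately show ?thesis using Tz by simp
      qed
    qed
    then have "card {z \<in> set P. T z = a} \<le> card (Pair R ` (A - {j}))"
      using \<open>finite A\<close> by (intro card_mono) auto
    also have "\<dots> = card (A - {j})" by (simp add: card_image inj_on_def)
    \<comment> \<open>The strict inequality comes from \<open>x\<close> itself: it is read before
      \<open>P\<close>, so its column counts for the \<open>b\<close> only.\<close>
    also have "\<dots> < card A" using \<open>finite A\<close> \<open>j \<in> A\<close> by (rule card_Diff1_less)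
    also have "card A = card (Pair (R + 1) ` A)" by (simp add: card_image inj_on_def)
    also have "\<dots> \<le> card {z \<in> set P. T z = b}"
    proof (rule card_mono)
      show "Pair (R + 1) ` A \<subseteq> {z \<in> set P. T z = b}"
      proof
        fix z assume "z \<in> Pair (R + 1) ` A"
        then obtain j' where j': "z = (R + 1, j')" "j' \<in> A" by blast
        then have "j' \<le> j" by (simp add: A_def)
        have zD: "z \<in> D" using young_D[OF belowD[OF \<open>j' \<le> j\<close>]] j' by simp
        have "\<psi> a < \<psi> (T z)" using colD[OF \<open>j' \<le> j\<close>] j' par by (auto simp: A_def colrel_def)
        moreover have "\<psi> (T z) \<le> \<psi> b"
        proof (cases "j' = j")
          case False
          then have "row_pair z (R + 1, j)" using \<open>j' \<le> j\<close> j' by (simp add: row_pair_def)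
          then have "\<psi> (T z) \<le> \<psi> (T (R + 1, j))" using T'(2)[OF zD young_D[OF belowD[of j]]] rowrel_le by simp
          then show ?thesis using z by simp
        qed (use z j' in simp)
        ultimately have "\<psi> (T z) = \<psi> b" using adj[OF zD] by linarith
        then have "T z = b" by (simp only: eq(2)[OF zD])
        moreover have "z \<in> set P" using setP zD j0(2)[OF j'(2)] by (auto simp: j' x y0_def before_def)
        ultimately show "z \<in> {z \<in> set P. T z = b}" by simp
      qed
    qed simp
    finally have "card {z \<in> set P. T z = a} < card {z \<in> set P. T z = b}" .
    then have "count_list (map T P) a < count_list (map T P) b"
      by (simp only: count_list_map_distinct[OF distP])
    moreover have "map T v = map T P @ map T v2" by (simp add: P_def v12)
    ultimately show False using v unfolding prefix_balanced_def a_def b_def by fastforce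
  qed
  show ?thesis
  proof (rule update_stable)
    show "rowrel b (T y)" if y: "y \<in> D" "row_pair x y" for y
      using T'(2)[OF xD y] R1[OF y] adj[OF y(1)] eq[OF y(1)] par Tx by (auto simp: rowrel_def)
    show "colrel b (T y)" if y: "y \<in> D" "below x y" for y
      using T'(3)[OF xD y] C1[OF y] adj[OF y(1)] eq[OF y(1)] par Tx by (auto simp: colrel_def)
    show "rowrel (T y) b" if y: "y \<in> D" "row_pair y x" for y
      using T'(2)[OF y(1) xD y(2)] less Tx by (auto simp: rowrel_def)
    show "colrel (T y) b" if y: "y \<in> D" "below y x" for y
      using T'(3)[OF y(1) xD y(2)] less Tx by (auto simp: colrel_def)
  qed (use ab_l in simp)
qed

text \<open>Mirror image of \<open>negative_f_stable\<close>: the dangerous neighbours are a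
  \<open>b\<close> to the left of \<open>x\<close>, excluded by the balance of \<open>v\<close>, and
  an \<open>a\<close> above it, excluded by the balance of \<open>u\<close>.\<close>

lemma negative_e_stable:
  assumes Tx: "T x = b"
  shows "T(x := a) \<in> pair_tableaux S \<psi> \<mu> \<alpha>"
proof -
  note T' = T_rel and ss = T_semistandard and l = T_letter and ab_l = ends_letters
    and adj = T_adjacent and less = ends_less and par = ends_Ints and neg = tgt_negative
    and eq = T_eq_iff and xD = x_in_D and dist = split_distinct and sets = split_sets
    and young_D = young_subset_D
  have x_young: "x \<in> young \<mu>"
    using negative_in_young[OF ss xD] Tx neg by simp
  obtain R j where x: "x = (R, j)" by (cases x)
  have R2: "T y \<noteq> b" if y: "y \<in> D" "row_pair y x" for y
  proof
    assume Ty: "T y = b"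
    have "y \<in> set v" using y row_pair_before sets by blast
    then obtain v1 v2 where v12: "v = v1 @ y # v2" by (meson split_list)
    have "T z = b" if "z \<in> set v1" for z
    proof -
      have "cells (pair_shape \<mu> \<alpha>) = (u @ x # v1) @ y # v2" using split v12 by simp
      from cells_split(1)[OF this] that have zD: "z \<in> D" and "before z y" by (auto simp: D_def)
      moreover have "before x z" using that sets(2) v12 by auto
      ultimately have "row_pair z x" "row_pair y z" using y(2) by (auto simp: before_def row_pair_def)
      then have "rowrel b (T z)" "rowrel (T z) b" using T'(2)[OF zD xD] T'(2)[OF y(1) zD] Tx Ty by simp_all
      then show "T z = b" by (auto simp: rowrel_def)
    qed
    then have "count_list (map T v1) a = 0" using less by (auto simp: count_list_0_iff)
    moreover have "map T v = map T (v1 @ [y]) @ map T v2" using v12 by simp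
    then have "count_list (map T (v1 @ [y])) b \<le> count_list (map T (v1 @ [y])) a"
      using v unfolding prefix_balanced_def a_def b_def by blast
    ultimately show False using Ty less by (auto split: if_splits)
  qed
  have C2: "T y \<noteq> a" if y: "y \<in> D" "below y x" for y
  proof
    assume Ty: "T y = a"
    have cp: "col_pair y x" using y(2) x_young by (auto simp: below_def J_def mem_young)
    then obtain R2 R0 where R: "y = (R2, j)" "R2 \<le> R0" "R = R0 + 1"
      using x by (cases y; cases R) (auto simp: col_pair_def)
    have aboveD: "(R0, j') \<in> young \<mu>" if "(R, j') \<in> young \<mu>" for j'
      using young_down_closed[OF pairs_C_D(1) that] R(3) by simp
    have colD: "colrel (T (R0, j')) (T (R, j'))" if "(R, j') \<in> young \<mu>" for j'
      using T'(3)[OF young_D[OF aboveD[OF that]] young_D[OF that]] R(3) by (simp add: below_def col_pair_def)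
    have z: "\<psi> a \<le> \<psi> (T (R0, j))"
    proof (cases "R2 = R0")
      case False
      then have "below y (R0, j)" using R by (simp add: below_def col_pair_def)
      then show ?thesis using T'(3)[OF y(1) young_D[OF aboveD[of j]]] Ty colrel_le x_young x by simp
    qed (use R Ty in simp)
    \<comment> \<open>The columns of the \<open>b\<close> from \<open>x\<close> to the right, each
      with an \<open>a\<close> directly above. The end of \<open>u\<close> that starts over the
      rightmost of them contains an \<open>a\<close> for every column of \<open>B\<close>, but a
      \<open>b\<close> at most for those other than \<open>j\<close>.\<close>
    define B where "B = {j'. j \<le> j' \<and> (R, j') \<in> young \<mu> \<and> T (R, j') = b}"
    have "finite B" by (rule finite_subset[of _ "{..<\<mu> ! R}"]) (auto simp: B_def mem_young)
    have "j \<in> B" using Tx x x_young by (auto simp: B_def)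
    define j1 where "j1 = Max B"
    have j1: "j1 \<in> B" "\<And>j'. j' \<in> B \<Longrightarrow> j' \<le> j1" using \<open>finite B\<close> \<open>j \<in> B\<close> by (auto simp: j1_def intro: Max_in)
    define y0 where "y0 = (R0, j1)"
    have y0: "y0 \<in> young \<mu>" using aboveD j1 by (auto simp: y0_def B_def)
    then have "y0 \<in> set u" using young_D sets(1) R(3) by (auto simp: before_def x y0_def)
    then obtain u1 u2 where u12: "u = u1 @ y0 # u2" by (meson split_list)
    define P where "P = y0 # u2"
    have "cells (pair_shape \<mu> \<alpha>) = u1 @ y0 # (u2 @ x # v)" using split u12 by simp
    note sets0 = cells_split[OF this, folded D_def]
    have setP: "set P = {z \<in> D. before z x \<and> (before y0 z \<or> z = y0)}"
    proof -
      have "z \<in> set P \<longleftrightarrow> before z x \<and> (before y0 z \<or> z = y0)" if "z \<in> D" for z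
      proof -
        have "z \<in> set u \<longleftrightarrow> before z x" using sets that by simp
        moreover have "z \<in> set (u2 @ x # v) \<longleftrightarrow> before y0 z" "z \<in> set u1 \<longleftrightarrow> before z y0" using sets0 that by simp_all
        moreover have "z \<notin> set u2" if "z \<in> set (x # v)" using that dist u12 by auto
        ultimately show ?thesis using dist u12 before_asym[of z y0] before_irrefl
          by (auto simp: P_def)
      qed
      moreover have "set P \<subseteq> D" using sets u12 by (auto simp: P_def)
      ultimately show ?thesis by blast
    qed
    have distP: "distinct P" using dist u12 by (simp add: P_def)
    have "{z \<in> set P. T z = b} \<subseteq> Pair R ` (B - {j})"
    proof
      fix z assume z: "z \<in> {z \<in> set P. T z = b}"
      obtain R' j' where z_eq: "z = (R', j')" by (cases z)
      have zD: "z \<in> D" and bz: "before z x" "before y0 z \<or> z = y0" and Tz: "T z = b" using z setP by auto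
      have zy: "z \<in> young \<mu>" using negative_in_young[OF ss zD] Tz neg by simp
      consider "R' = R" "j < j'" | "R' = R0" "j' \<le> j1"
        using bz R(3) by (auto simp: z_eq x y0_def before_def)
      then show "z \<in> Pair R ` (B - {j})"
      proof cases
        case 1
        then show ?thesis using Tz zy by (auto simp: z_eq B_def)
      next
        case 2
        have "\<psi> (T z) \<le> \<psi> (T y0)"
        proof (cases "j' = j1")
          case False
          then have "row_pair z y0" using 2 by (simp add: row_pair_def y0_def z_eq)
          then show ?thesis using T'(2)[OF zD young_D[OF y0]] rowrel_le by blast
        qed (use 2 in \<open>simp add: y0_def z_eq\<close>)
        moreover have "\<psi> (T y0) < \<psi> b"
          using colD[of j1] j1(1) par eq(2)[OF young_D[OF y0]] by (auto simp: B_def colrel_def y0_def)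
        ultimately show ?thesis using Tz by simp
      qed
    qed
    then have "card {z \<in> set P. T z = b} \<le> card (Pair R ` (B - {j}))"
      using \<open>finite B\<close> by (intro card_mono) auto
    also have "\<dots> = card (B - {j})" by (simp add: card_image inj_on_def)
    also have "\<dots> < card B" using \<open>finite B\<close> \<open>j \<in> B\<close> by (rule card_Diff1_less)
    also have "card B = card (Pair R0 ` B)" by (simp add: card_image inj_on_def)
    also have "\<dots> \<le> card {z \<in> set P. T z = a}"
    proof (rule card_mono)
      show "Pair R0 ` B \<subseteq> {z \<in> set P. T z = a}"
      proof
        fix z assume "z \<in> Pair R0 ` B"
        then obtain j' where j': "z = (R0, j')" "j' \<in> B" by blast
        then have "j \<le> j'" and jy: "(R, j') \<in> young \<mu>" and Tj: "T (R, j') = b" by (simp_all add: B_def)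
        have zD: "z \<in> D" using young_D[OF aboveD[OF jy]] j' by simp
        have "\<psi> (T z) < \<psi> b" using colD[OF jy] j' Tj par eq(2)[OF zD] by (auto simp: colrel_def)
        moreover have "\<psi> a \<le> \<psi> (T z)"
        proof (cases "j' = j")
          case False
          then have "row_pair (R0, j) z" using \<open>j \<le> j'\<close> j' by (simp add: row_pair_def)
          then have "\<psi> (T (R0, j)) \<le> \<psi> (T z)"
            using T'(2)[OF young_D[OF aboveD[of j]] zD] x_young x rowrel_le by simp
          then show ?thesis using z by simp
        qed (use z j' in simp)
        ultimately have "\<psi> (T z) = \<psi> a" using adj[OF zD] by linarith
        then have "T z = a" by (simp only: eq(1)[OF zD])
        moreover have "z \<in> set P" using setP zD j1(2)[OF j'(2)] R(3) by (auto simp: j' x y0_def before_def)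
        ultimately show "z \<in> {z \<in> set P. T z = a}" by simp
      qed
    qed simp
    finally have "card {z \<in> set P. T z = b} < card {z \<in> set P. T z = a}" .
    then have "count_list (map T P) b < count_list (map T P) a"
      by (simp only: count_list_map_distinct[OF distP])
    moreover have "map T u = map T u1 @ map T P" by (simp add: P_def u12)
    ultimately show False using u unfolding suffix_balanced_def a_def b_def by fastforce
  qed
  show ?thesis
  proof (rule update_stable)
    show "rowrel (T y) a" if y: "y \<in> D" "row_pair y x" for y
      using T'(2)[OF y(1) xD y(2)] R2[OF y] adj[OF y(1)] eq[OF y(1)] par Tx by (auto simp: rowrel_def)
    show "colrel (T y) a" if y: "y \<in> D" "below y x" for y
      using T'(3)[OF y(1) xD y(2)] C2[OF y] adj[OF y(1)] eq[OF y(1)] par Tx by (auto simp: colrel_def)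
    show "rowrel a (T y)" if y: "y \<in> D" "row_pair x y" for y
      using T'(2)[OF xD y] less Tx by (auto simp: rowrel_def)
    show "colrel a (T y)" if y: "y \<in> D" "below x y" for y
      using T'(3)[OF xD y] less Tx by (auto simp: colrel_def)
  qed (use ab_l in simp)
qed

end

lemma pair_tableaux_stable:
  assumes i: "i \<in> root_index p q" and T: "T \<in> pair_tableaux S \<psi> \<mu> \<alpha>"
    and w: "reading_word (pair_shape \<mu> \<alpha>) T = u @ c # v" and between: "acts_between i u v"
    and cd: "c = src i \<and> d = tgt i \<or> c = tgt i \<and> d = src i"
  shows "u @ d # v \<in> reading_word (pair_shape \<mu> \<alpha>) ` pair_tableaux S \<psi> \<mu> \<alpha>"
proof -
  obtain u' x v' where split: "cells (pair_shape \<mu> \<alpha>) = u' @ x # v'"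
    and uv: "u = map T u'" "c = T x" "v = map T v'"
    using w unfolding reading_word_eq by (auto simp: map_eq_append_conv map_eq_Cons_conv)
  have "T(x := d) \<in> pair_tableaux S \<psi> \<mu> \<alpha>"
  proof (cases "i < 0")
    case True
    then have *: "suffix_balanced (src i) (tgt i) (map T u')" "prefix_balanced (src i) (tgt i) (map T v')"
      using between uv by (auto simp: acts_between_def)
    show ?thesis
      using cd uv negative_f_stable[OF i True T split *] negative_e_stable[OF i True T split *] by auto
  next
    case False
    have xD: "x \<in> D" using set_cells[of "pair_shape \<mu> \<alpha>"] split by (auto simp: D_def)
    show ?thesis
    proof (rule isotropic_stable[OF i _ T xD])
      show "T y \<noteq> c \<and> T y \<noteq> d" if "y \<in> D" "if i \<in> \<int> then before y x else before x y" for y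
      proof -
        have "y \<in> (if i \<in> \<int> then set u' else set v')"
          using that cells_split[OF split, folded D_def] by simp
        then have "T y \<in> (if i \<in> \<int> then set u else set v)" by (auto simp: uv split: if_splits)
        then show ?thesis using between False cd by (auto simp: acts_between_def split: if_splits)
      qed
    qed (use False cd uv in auto)
  qed
  moreover have "reading_word (pair_shape \<mu> \<alpha>) (T(x := d)) = u @ d # v"
    using split distinct_cells[of "pair_shape \<mu> \<alpha>"] by (auto simp: reading_word_eq uv)
  ultimately show ?thesis by (metis image_eqI)
qed

lemma reading_word_words:
  assumes "T \<in> pair_tableaux S \<psi> \<mu> \<alpha>"
  shows "reading_word (pair_shape \<mu> \<alpha>) T \<in> words (sum_list \<mu> + sum_list \<alpha>)"
proof -
  have "map snd (pair_shape \<mu> \<alpha>) = \<mu> @ map ((!) \<alpha>) [0..<length \<alpha>]"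
    by (simp add: pair_shape_def o_def)
  then have "length (cells (pair_shape \<mu> \<alpha>)) = sum_list \<mu> + sum_list \<alpha>"
    by (simp add: length_cells map_nth)
  moreover have "set (reading_word (pair_shape \<mu> \<alpha>) T) \<subseteq> letters S"
    using assms by (auto simp: reading_word_eq set_cells pair_tableaux_iff D_def)
  ultimately show ?thesis by (simp add: words_def reading_word_eq)
qed

lemma inj_reading_word: "inj_on (reading_word (pair_shape \<mu> \<alpha>)) (pair_tableaux S \<psi> \<mu> \<alpha>)"
proof (rule inj_onI)
  fix T T' assume T: "T \<in> pair_tableaux S \<psi> \<mu> \<alpha>" "T' \<in> pair_tableaux S \<psi> \<mu> \<alpha>"
    and eq: "reading_word (pair_shape \<mu> \<alpha>) T = reading_word (pair_shape \<mu> \<alpha>) T'"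
  have "T x = T' x" if "x \<in> D" for x
    using eq that by (simp add: reading_word_eq set_cells D_def)
  moreover have "T \<in> D \<rightarrow>\<^sub>E letters S" "T' \<in> D \<rightarrow>\<^sub>E letters S" using T by (simp_all add: pair_tableaux_iff)
  ultimately show "T = T'" by (metis PiE_ext)
qed

lemma gl_crystal_pair: "gl_crystal S \<psi> p q (pair_crystal S \<psi> (\<mu>, \<alpha>))"
proof -
  let ?g = "reading_word (pair_shape \<mu> \<alpha>)" and ?A = "pair_tableaux S \<psi> \<mu> \<alpha>"
  let ?r = "sum_list \<mu> + sum_list \<alpha>"
  have "gl_crystal S \<psi> p q (pullback ?A ?g (W ?r))"
  proof (rule gl_crystal_pullback[OF gl_crystal_W inj_reading_word])
    show "?g ` ?A \<subseteq> elems (W ?r)" using reading_word_words elems_W by auto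
  next
    fix i T w assume i: "i \<in> root_index p q" and T: "T \<in> ?A" and e: "e_op (W ?r) i (?g T) = Some w"
    obtain u v where "?g T = u @ tgt i # v" "w = u @ src i # v" "acts_between i u v"
      using iffD1[OF e_op_W_iff[OF i reading_word_words[OF T]] e] by blast
    then show "w \<in> ?g ` ?A" using pair_tableaux_stable[OF i T] by blast
  next
    fix i T w assume i: "i \<in> root_index p q" and T: "T \<in> ?A" and f: "f_op (W ?r) i (?g T) = Some w"
    obtain u v where "?g T = u @ src i # v" "w = u @ tgt i # v" "acts_between i u v"
      using iffD1[OF f_op_W_iff[OF i reading_word_words[OF T]] f] by blast
    then show "w \<in> ?g ` ?A" using pair_tableaux_stable[OF i T] by blast
  qed
  then show ?thesis by (simp add: pair_crystal_def)
qed

end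

end

section \<open>Compositions and ribbons\<close>

definition psum :: "nat list \<Rightarrow> nat \<Rightarrow> nat" where
  "psum \<alpha> k = sum_list (take k \<alpha>)"

text \<open>The subset of inner positions that encodes a composition: the ribbon steps down on
  arrival at these positions and to the right at the others.\<close>

definition breaks :: "nat list \<Rightarrow> nat set" where
  "breaks \<alpha> = psum \<alpha> ` {0<..<length \<alpha>}"

text \<open>The ribbon row of the node in position \<open>l\<close>, positions being counted from 0
  along the ribbon.\<close>

fun rowidx :: "nat list \<Rightarrow> nat \<Rightarrow> nat" where
  "rowidx [] l = 0"
| "rowidx (a # \<alpha>) l = (if l < a then 0 else Suc (rowidx \<alpha> (l - a)))"

lemma psum_0 [simp]: "psum \<alpha> 0 = 0"
  and psum_length [simp]: "psum \<alpha> (length \<alpha>) = sum_list \<alpha>"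
  by (simp_all add: psum_def)

lemma psum_Suc: "k < length \<alpha> \<Longrightarrow> psum \<alpha> (Suc k) = psum \<alpha> k + \<alpha> ! k"
  by (simp add: psum_def take_Suc_conv_app_nth)

lemma psum_strict_mono:
  assumes "\<alpha> \<in> compositions" "k < k'" "k' \<le> length \<alpha>"
  shows "psum \<alpha> k < psum \<alpha> k'"
  using assms(2,3)
proof (induction k')
  case (Suc k')
  then have "psum \<alpha> k' < psum \<alpha> (Suc k')" using compositions_nth[OF assms(1), of k'] by (simp add: psum_Suc)
  then show ?case using Suc by (cases "k = k'") auto
qed simp

lemma psum_mono: "\<alpha> \<in> compositions \<Longrightarrow> k \<le> k' \<Longrightarrow> k' \<le> length \<alpha> \<Longrightarrow> psum \<alpha> k \<le> psum \<alpha> k'"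
  using psum_strict_mono[of \<alpha> k k'] by (cases "k = k'") auto

lemma le_psum:
  assumes "\<alpha> \<in> compositions"
  shows "k \<le> length \<alpha> \<Longrightarrow> k \<le> psum \<alpha> k"
proof (induction k)
  case (Suc k)
  then show ?case using compositions_nth[OF assms, of k] by (simp add: psum_Suc)
qed simp

text \<open>Consecutive ribbon rows share a column, so each earlier row shifts by its length minus
  one. All parts being positive, the truncated subtractions lose nothing.\<close>

lemma ribbon_offset:
  assumes "\<alpha> \<in> compositions" "k \<le> length \<alpha>"
  shows "(\<Sum>l<k. \<alpha> ! l - 1) = psum \<alpha> k - k"
  using assms(2)
proof (induction k)
  case (Suc k)
  have "0 < \<alpha> ! k" "k \<le> psum \<alpha> k" using Suc compositions_nth[OF assms(1)] le_psum[OF assms(1)] by simp_all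
  then show ?case using Suc by (simp add: psum_Suc)
qed simp

lemma rowidx_bounds:
  "l < sum_list \<alpha> \<Longrightarrow> rowidx \<alpha> l < length \<alpha> \<and> psum \<alpha> (rowidx \<alpha> l) \<le> l \<and> l < psum \<alpha> (Suc (rowidx \<alpha> l))"
proof (induction \<alpha> arbitrary: l)
  case (Cons a \<alpha>)
  show ?case
  proof (cases "l < a")
    case False
    then have "l - a < sum_list \<alpha>" using Cons.prems by auto
    note IH = Cons.IH[OF this]
    then have "psum (a # \<alpha>) (Suc (rowidx \<alpha> (l - a))) \<le> l"
        "l < psum (a # \<alpha>) (Suc (Suc (rowidx \<alpha> (l - a))))"
      using False unfolding psum_def take_Suc_Cons sum_list.Cons by linarith+
    then show ?thesis using IH False by simp
  qed (simp add: psum_def)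
qed simp

lemma rowidx_eqI:
  assumes "\<alpha> \<in> compositions" "k < length \<alpha>" "psum \<alpha> k \<le> l" "l < psum \<alpha> (Suc k)"
  shows "rowidx \<alpha> l = k"
proof -
  have "l < sum_list \<alpha>" using assms psum_mono[OF assms(1), of "Suc k" "length \<alpha>"] by simp
  note b = rowidx_bounds[OF this]
  show ?thesis
  proof (rule linorder_cases[of "rowidx \<alpha> l" k])
    assume "rowidx \<alpha> l < k"
    then have "psum \<alpha> (Suc (rowidx \<alpha> l)) \<le> psum \<alpha> k" using assms by (intro psum_mono) auto
    then show ?thesis using b assms by simp
  next
    assume "k < rowidx \<alpha> l"
    then have "psum \<alpha> (Suc k) \<le> psum \<alpha> (rowidx \<alpha> l)" using assms b by (intro psum_mono) auto
    then show ?thesis using b assms by simp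
  qed
qed

lemma rowidx_Suc:
  assumes "\<alpha> \<in> compositions" "Suc l < sum_list \<alpha>"
  shows "rowidx \<alpha> (Suc l) = (if Suc l \<in> breaks \<alpha> then Suc (rowidx \<alpha> l) else rowidx \<alpha> l)"
proof -
  define k where "k = rowidx \<alpha> l"
  have k: "k < length \<alpha>" "psum \<alpha> k \<le> l" "l < psum \<alpha> (Suc k)"
    using rowidx_bounds[of l \<alpha>] assms(2) by (simp_all add: k_def)
  show ?thesis
  proof (cases "Suc l < psum \<alpha> (Suc k)")
    case True
    have "Suc l \<notin> breaks \<alpha>"
    proof
      assume "Suc l \<in> breaks \<alpha>"
      then obtain k' where k': "k' < length \<alpha>" "Suc l = psum \<alpha> k'" by (auto simp: breaks_def)
      have "k < k'" using k(1,2) k' psum_mono[OF assms(1), of k' k] by (cases "k < k'") auto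
      then have "psum \<alpha> (Suc k) \<le> psum \<alpha> k'" using k' by (intro psum_mono[OF assms(1)]) auto
      then show False using True k' by simp
    qed
    moreover have "rowidx \<alpha> (Suc l) = k" using True k by (intro rowidx_eqI[OF assms(1)]) auto
    ultimately show ?thesis by (simp add: k_def)
  next
    case False
    then have l: "Suc l = psum \<alpha> (Suc k)" using k by simp
    then have "Suc k \<noteq> length \<alpha>" using assms(2) by auto
    then have k1: "Suc k < length \<alpha>" using k(1) by simp
    then have "Suc l \<in> breaks \<alpha>" unfolding breaks_def l by (intro imageI) simp
    moreover have "rowidx \<alpha> (Suc l) = Suc k"
      using k1 l psum_strict_mono[OF assms(1), of "Suc k" "Suc (Suc k)"] by (intro rowidx_eqI[OF assms(1)]) auto
    ultimately show ?thesis by (simp add: k_def)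
  qed
qed

lemma rowidx_le:
  assumes "\<alpha> \<in> compositions" "l < sum_list \<alpha>"
  shows "rowidx \<alpha> l \<le> l"
  using rowidx_bounds[OF assms(2)] le_psum[OF assms(1), of "rowidx \<alpha> l"] by simp

lemma rowidx_0: "\<alpha> \<in> compositions \<Longrightarrow> rowidx \<alpha> 0 = 0"
  by (cases \<alpha>) (auto simp: compositions_def)

lemma breaks_subset:
  assumes "\<alpha> \<in> compositions"
  shows "breaks \<alpha> \<subseteq> {1..<sum_list \<alpha>}"
proof
  fix b assume "b \<in> breaks \<alpha>"
  then obtain k where k: "0 < k" "k < length \<alpha>" "b = psum \<alpha> k" by (auto simp: breaks_def)
  then show "b \<in> {1..<sum_list \<alpha>}"
    using psum_strict_mono[OF assms, of 0 k] psum_strict_mono[OF assms, of k "length \<alpha>"] by simp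
qed

text \<open>The right-hand side is the formula of \<open>descent_composition\<close>; through it a
  nonempty composition is determined by its size and its breaks.\<close>

lemma composition_from_breaks:
  assumes "\<alpha> \<in> compositions" "\<alpha> \<noteq> []"
  shows "\<alpha> = (let ds = sorted_list_of_set (breaks \<alpha>) in map2 (-) (ds @ [sum_list \<alpha>]) (0 # ds))"
proof -
  define ds where "ds = map (psum \<alpha>) [1..<length \<alpha>]"
  have "sorted_wrt (<) ds"
    unfolding ds_def sorted_wrt_map
    by (rule sorted_wrt_mono_rel[of _ "(<)"]) (auto intro: psum_strict_mono[OF assms(1)])
  moreover have "set ds = breaks \<alpha>" by (auto simp: ds_def breaks_def)
  ultimately have ds: "sorted_list_of_set (breaks \<alpha>) = ds"
    by (metis sorted_list_of_set.idem_if_sorted_distinct strict_sorted_iff)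
  have len: "length ds = length \<alpha> - 1" by (simp add: ds_def)
  have "map2 (-) (ds @ [sum_list \<alpha>]) (0 # ds) = \<alpha>"
  proof (rule nth_equalityI)
    show "length (map2 (-) (ds @ [sum_list \<alpha>]) (0 # ds)) = length \<alpha>" using len assms(2) by simp
    fix k assume "k < length (map2 (-) (ds @ [sum_list \<alpha>]) (0 # ds))"
    then have k: "k < length \<alpha>" using len assms(2) by simp
    have "(ds @ [sum_list \<alpha>]) ! k = psum \<alpha> (Suc k)"
    proof (cases "Suc k = length \<alpha>")
      case True
      then have "k = length ds" using len by simp
      then have "(ds @ [sum_list \<alpha>]) ! k = sum_list \<alpha>" by simp
      then show ?thesis using psum_length[of \<alpha>] True by simp
    next
      case False
      then have "k < length ds" using len k by simp
      then show ?thesis by (simp add: nth_append ds_def)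
    qed
    moreover have "(0 # ds) ! k = psum \<alpha> k"
      using k len by (cases k) (auto simp: ds_def)
    ultimately show "map2 (-) (ds @ [sum_list \<alpha>]) (0 # ds) ! k = \<alpha> ! k"
      using k len psum_Suc[OF k] by simp
  qed
  then show ?thesis by (simp add: ds Let_def)
qed

text \<open>The converse of \<open>composition_from_breaks\<close>: every set of inner positions
  occurs, in particular the descent set of a tableau.\<close>

lemma composition_of_breaks:
  assumes "B \<subseteq> {1..<r}" "0 < r" and \<alpha>: "\<alpha> = (let ds = sorted_list_of_set B in map2 (-) (ds @ [r]) (0 # ds))"
  shows "\<alpha> \<in> compositions" "\<alpha> \<noteq> []" "sum_list \<alpha> = r" "breaks \<alpha> = B"
proof -
  have "finite B" using assms(1) finite_subset by blast
  define ds where "ds = sorted_list_of_set B"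
  have ds: "sorted_wrt (<) ds" "set ds = B" using \<open>finite B\<close> by (simp_all add: ds_def)
  \<comment> \<open>Padded with 0 and \<open>r\<close>, the breaks form one increasing list whose
    consecutive differences are the parts, so the partial sums telescope.\<close>
  define es where "es = 0 # ds @ [r]"
  have es_sorted: "sorted_wrt (<) es"
    using ds assms(1,2) by (fastforce simp: es_def sorted_wrt_append)
  have len: "length \<alpha> = Suc (length ds)" "length es = Suc (Suc (length ds))"
    by (simp_all add: \<alpha> ds_def[symmetric] Let_def es_def)
  have nth: "\<alpha> ! k = es ! Suc k - es ! k" if "k < length \<alpha>" for k
  proof -
    have "\<alpha> ! k = (ds @ [r]) ! k - (0 # ds) ! k"
      using that len by (simp add: \<alpha> ds_def[symmetric] Let_def)
    moreover have "(0 # ds) ! k = es ! k"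
      using that len nth_append[of "0 # ds" "[r]" k] by (simp add: es_def)
    ultimately show ?thesis by (simp add: es_def)
  qed
  have less: "es ! k < es ! Suc k" if "k < length \<alpha>" for k
    using es_sorted that len by (simp add: sorted_wrt_iff_nth_less)
  show "\<alpha> \<in> compositions"
    using nth less by (fastforce simp: compositions_def in_set_conv_nth)
  show "\<alpha> \<noteq> []" using len by auto
  have psum: "psum \<alpha> k = es ! k" if "k \<le> length \<alpha>" for k
    using that
  proof (induction k)
    case 0
    then show ?case by (simp add: es_def)
  next
    case (Suc k)
    then show ?case using nth[of k] less[of k] by (simp add: psum_Suc)
  qed
  show "sum_list \<alpha> = r"
    using psum[of "length \<alpha>"] len unfolding psum_length by (simp add: es_def)
  have "breaks \<alpha> = (\<lambda>k. es ! k) ` {0<..<length \<alpha>}"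
    unfolding breaks_def by (rule image_cong) (simp_all add: psum)
  also have "{0<..<length \<alpha>} = Suc ` {..<length ds}"
    using len by (auto simp: image_Suc_lessThan)
  also have "(\<lambda>k. es ! k) ` Suc ` {..<length ds} = (\<lambda>k. ds ! k) ` {..<length ds}"
    by (simp add: image_image es_def nth_append)
  also have "\<dots> = B" using ds by (auto simp: in_set_conv_nth)
  finally show "breaks \<alpha> = B" .
qed

lemma chain_rel:
  assumes "transp R" "\<And>t. l \<le> t \<Longrightarrow> t < l' \<Longrightarrow> R (V t) (V (Suc t))" "l < (l' :: nat)"
  shows "R (V l) (V l')"
  using assms(3,2)
proof (induction l')
  case (Suc l')
  show ?case
  proof (cases "l = l'")
    case False
    then have "R (V l) (V l')" using Suc by simp
    then show ?thesis using Suc.prems(2)[of l'] Suc.prems(1) assms(1) by (auto dest: transpD)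
  qed (use Suc in simp)
qed simp

section \<open>Ribbons as lattice paths\<close>

text \<open>A ribbon step raises either the row or the column by one, so the row within the ribbon
  and the column add up to the position \<open>l\<close>. This sum recovers positions from nodes in
  \<open>min_tableau\<close> and in the standardization.\<close>

definition node :: "nat list \<Rightarrow> nat list \<Rightarrow> nat \<Rightarrow> nat \<times> nat" where
  "node \<mu> \<alpha> l = (length \<mu> + rowidx \<alpha> l, l - rowidx \<alpha> l)"

lemma node_0: "\<alpha> \<in> compositions \<Longrightarrow> node \<mu> \<alpha> 0 = (length \<mu>, 0)"
  by (simp add: node_def rowidx_0)

lemma node_notin_young: "node \<mu> \<alpha> l \<notin> young \<mu>"
  by (simp add: node_def mem_young)

lemma inj_on_node:
  assumes "\<alpha> \<in> compositions"
  shows "inj_on (node \<mu> \<alpha>) {..<sum_list \<alpha>}"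
proof (rule inj_onI)
  fix l l' assume "l \<in> {..<sum_list \<alpha>}" "l' \<in> {..<sum_list \<alpha>}" "node \<mu> \<alpha> l = node \<mu> \<alpha> l'"
  then show "l = l'"
    using rowidx_le[OF assms, of l] rowidx_le[OF assms, of l'] by (auto simp: node_def)
qed

lemma nodes_pair_shape_eq:
  assumes "\<alpha> \<in> compositions"
  shows "nodes (pair_shape \<mu> \<alpha>) = young \<mu> \<union> node \<mu> \<alpha> ` {..<sum_list \<alpha>}"
proof -
  have "(\<exists>k<length \<alpha>. i = length \<mu> + k \<and> (\<Sum>l<k. \<alpha> ! l - 1) \<le> j \<and> j < (\<Sum>l<k. \<alpha> ! l - 1) + \<alpha> ! k) \<longleftrightarrow>
      (i, j) \<in> node \<mu> \<alpha> ` {..<sum_list \<alpha>}" (is "?L \<longleftrightarrow> ?R") for i j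
  proof
    assume ?L
    then obtain k where k: "k < length \<alpha>" "i = length \<mu> + k" "psum \<alpha> k - k \<le> j" "j < psum \<alpha> k - k + \<alpha> ! k"
      using ribbon_offset[OF assms] by auto
    then have *: "psum \<alpha> k \<le> k + j" "k + j < psum \<alpha> (Suc k)"
      using le_psum[OF assms, of k] by (simp_all add: psum_Suc)
    then have "rowidx \<alpha> (k + j) = k" using k by (intro rowidx_eqI[OF assms])
    moreover have "k + j < sum_list \<alpha>" using * psum_mono[OF assms, of "Suc k" "length \<alpha>"] k by simp
    ultimately show ?R using k by (intro image_eqI[of _ _ "k + j"]) (auto simp: node_def)
  next
    assume ?R
    then obtain l where l: "l < sum_list \<alpha>" "i = length \<mu> + rowidx \<alpha> l" "j = l - rowidx \<alpha> l"
      by (auto simp: node_def)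
    note b = rowidx_bounds[OF l(1)]
    have "rowidx \<alpha> l \<le> psum \<alpha> (rowidx \<alpha> l)" using b by (intro le_psum[OF assms]) simp
    then show ?L using b l ribbon_offset[OF assms, of "rowidx \<alpha> l"]
      by (intro exI[of _ "rowidx \<alpha> l"]) (auto simp: psum_Suc)
  qed
  then have "(i, j) \<in> nodes (pair_shape \<mu> \<alpha>) \<longleftrightarrow> (i, j) \<in> young \<mu> \<union> node \<mu> \<alpha> ` {..<sum_list \<alpha>}" for i j
    unfolding mem_nodes_pair_shape by simp
  then show ?thesis by (intro set_eqI) (metis surj_pair)
qed

context crystal_alphabet
begin

lemma transp_rowrel: "transp rowrel" and transp_colrel: "transp colrel"
  by (auto simp: rowrel_def colrel_def intro!: transpI)

text \<open>
  A ribbon filling is a weakly increasing sequence along the ribbon which may only repeat even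
  letters along horizontal and odd letters along vertical steps.
\<close>

definition compatible :: "nat set \<Rightarrow> nat \<Rightarrow> (nat \<Rightarrow> 'a) \<Rightarrow> bool" where
  "compatible B r V \<longleftrightarrow> (\<forall>l. Suc l < r \<longrightarrow>
     (if Suc l \<in> B then colrel (V l) (V (Suc l)) else rowrel (V l) (V (Suc l))))"

lemma compatible_mono:
  assumes "compatible B r V" "l \<le> l'" "l' < r"
  shows "\<psi> (V l) \<le> \<psi> (V l')"
  using assms(2,3)
proof (induction l' rule: dec_induct)
  case (step l')
  then have "\<psi> (V l') \<le> \<psi> (V (Suc l'))"
    using assms(1) rowrel_le colrel_le by (auto simp: compatible_def split: if_splits)
  then show ?case using step by simp
qed simp

text \<open>Monotonicity makes all entries between two equal ones equal. An even letter can repeat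
  along row steps only and an odd letter along column steps only, so the steps of the run are all
  breaks or none is.\<close>

lemma compatible_plateau:
  assumes "compatible B r V" "\<And>l. l < r \<Longrightarrow> V l \<in> letters S" "l < l'" "l' < r" "V l = V l'" "l < t" "t \<le> l'"
  shows "t \<in> B \<longleftrightarrow> \<psi> (V l) \<notin> \<int>"
proof -
  obtain t' where t': "t = Suc t'" using assms(6) by (cases t) auto
  have "\<psi> (V l) \<le> \<psi> (V t')" "\<psi> (V t') \<le> \<psi> (V l')" "\<psi> (V l) \<le> \<psi> (V t)" "\<psi> (V t) \<le> \<psi> (V l')"
    using compatible_mono[OF assms(1), of l t'] compatible_mono[OF assms(1), of t' l']
      compatible_mono[OF assms(1), of l t] compatible_mono[OF assms(1), of t l'] assms(3-7) t' by simp_all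
  then have "\<psi> (V t') = \<psi> (V l)" "\<psi> (V t) = \<psi> (V l)" using assms(5) by auto
  moreover have "if t \<in> B then colrel (V t') (V t) else rowrel (V t') (V t)"
    using assms(1,4,7) t' by (auto simp: compatible_def)
  ultimately show ?thesis by (auto simp: rowrel_def colrel_def split: if_splits)
qed

text \<open>On the ribbon only consecutive nodes matter: two nodes in one row are joined by
  horizontal steps, two in one column by vertical ones, and both relations are transitive. A body
  node meets the ribbon through the joint, from which on the entries weakly increase.\<close>

lemma pair_tableaux_path_iff:
  assumes C: "(\<mu>, \<alpha>) \<in> pairs_C p"
  shows "T \<in> pair_tableaux S \<psi> \<mu> \<alpha> \<longleftrightarrow> T \<in> nodes (pair_shape \<mu> \<alpha>) \<rightarrow>\<^sub>E letters S \<and>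
     (\<forall>x\<in>young \<mu>. \<forall>y\<in>young \<mu>. (row_pair x y \<longrightarrow> rowrel (T x) (T y)) \<and> (col_pair x y \<longrightarrow> colrel (T x) (T y))) \<and>
     (\<alpha> \<noteq> [] \<longrightarrow> (\<forall>x\<in>young \<mu>. colrel (T x) (T (node \<mu> \<alpha> 0)))) \<and>
     compatible (breaks \<alpha>) (sum_list \<alpha>) (\<lambda>l. T (node \<mu> \<alpha> l))"
    (is "_ \<longleftrightarrow> ?R")
proof -
  have \<alpha>: "\<alpha> \<in> compositions" using C by (simp add: pairs_C_def)
  note iff = pair_tableaux_iff[OF C] and eq = nodes_pair_shape_eq[OF \<alpha>, of \<mu>]
  have nonempty: "\<alpha> \<noteq> [] \<longleftrightarrow> 0 < sum_list \<alpha>"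
    using \<alpha> by (cases \<alpha>) (auto simp: compositions_def)
  have node_D: "node \<mu> \<alpha> l \<in> nodes (pair_shape \<mu> \<alpha>)" if "l < sum_list \<alpha>" for l
    using that eq by auto
  have step: "if Suc l \<in> breaks \<alpha> then col_pair (node \<mu> \<alpha> l) (node \<mu> \<alpha> (Suc l))
      else row_pair (node \<mu> \<alpha> l) (node \<mu> \<alpha> (Suc l))" if "Suc l < sum_list \<alpha>" for l
    using rowidx_Suc[OF \<alpha> that] rowidx_le[OF \<alpha>, of l] that
    by (auto simp: node_def row_pair_def col_pair_def)
  show ?thesis
  proof
    assume T: "T \<in> pair_tableaux S \<psi> \<mu> \<alpha>"
    have "colrel (T x) (T (node \<mu> \<alpha> 0))" if "\<alpha> \<noteq> []" "x \<in> young \<mu>" for x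
      using T that eq node_D[of 0] nonempty unfolding iff by (auto simp: below_def[OF C] node_0[OF \<alpha>])
    moreover have "compatible (breaks \<alpha>) (sum_list \<alpha>) (\<lambda>l. T (node \<mu> \<alpha> l))"
      unfolding compatible_def
    proof (intro allI impI)
      fix l assume l: "Suc l < sum_list \<alpha>"
      have D: "node \<mu> \<alpha> l \<in> nodes (pair_shape \<mu> \<alpha>)" "node \<mu> \<alpha> (Suc l) \<in> nodes (pair_shape \<mu> \<alpha>)"
        using l by (auto intro: node_D)
      show "if Suc l \<in> breaks \<alpha> then colrel (T (node \<mu> \<alpha> l)) (T (node \<mu> \<alpha> (Suc l)))
          else rowrel (T (node \<mu> \<alpha> l)) (T (node \<mu> \<alpha> (Suc l)))"
        using T step[OF l] D unfolding iff below_def[OF C] by (simp split: if_splits)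
    qed
    ultimately show ?R
      using T eq unfolding iff by (auto simp: below_def[OF C])
  next
    assume A: ?R
    define V where "V = (\<lambda>l. T (node \<mu> \<alpha> l))"
    have comp: "compatible (breaks \<alpha>) (sum_list \<alpha>) V" using A by (simp add: V_def)
    have V_letter: "V l \<in> letters S" if "l < sum_list \<alpha>" for l using A node_D[OF that] by (auto simp: V_def)
    have stepV: "if Suc t \<in> breaks \<alpha> then colrel (V t) (V (Suc t)) else rowrel (V t) (V (Suc t))"
      if "Suc t < sum_list \<alpha>" for t using comp that by (simp add: compatible_def)
    \<comment> \<open>Row and column both grow weakly along the path. If one of them agrees at two
      nodes, it is constant in between and every step there changes the other.\<close>
    have rowidx_mono: "rowidx \<alpha> l \<le> rowidx \<alpha> l' \<and> l - rowidx \<alpha> l \<le> l' - rowidx \<alpha> l'" if "l \<le> l'" "l' < sum_list \<alpha>" for l l'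
      using that
    proof (induction l' rule: dec_induct)
      case (step l')
      then show ?case using rowidx_Suc[OF \<alpha>, of l'] by auto
    qed simp
    have young_ribbon: "colrel (T x) (V l)" if x: "x \<in> young \<mu>" and l: "l < sum_list \<alpha>" for x l
    proof -
      have "colrel (T x) (V 0)" using A x l nonempty by (auto simp: V_def)
      moreover have "\<psi> (V 0) \<le> \<psi> (V l)" using compatible_mono[OF comp _ l] by simp
      moreover have "\<psi> (V 0) = \<psi> (V l) \<longleftrightarrow> V 0 = V l" using \<psi>_eq_iff V_letter l by simp
      ultimately show ?thesis by (auto simp: colrel_def)
    qed
    have ribbon_row: "rowrel (V l) (V l')"
      if l: "l < sum_list \<alpha>" "l' < sum_list \<alpha>" and rp: "row_pair (node \<mu> \<alpha> l) (node \<mu> \<alpha> l')" for l l'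
    proof -
      have eq: "rowidx \<alpha> l = rowidx \<alpha> l'" and "l < l'" using rp by (auto simp: row_pair_def node_def)
      show ?thesis
      proof (rule chain_rel[OF transp_rowrel _ \<open>l < l'\<close>])
        fix t assume t: "l \<le> t" "t < l'"
        then have "rowidx \<alpha> (Suc t) = rowidx \<alpha> t"
          using rowidx_mono[of l t] rowidx_mono[of t "Suc t"] rowidx_mono[of "Suc t" l'] eq l(2) by simp
        then show "rowrel (V t) (V (Suc t))"
          using rowidx_Suc[OF \<alpha>, of t] stepV[of t] t l(2) by (simp split: if_splits)
      qed
    qed
    have ribbon_col: "colrel (V l) (V l')"
      if l: "l < sum_list \<alpha>" "l' < sum_list \<alpha>" and cp: "col_pair (node \<mu> \<alpha> l) (node \<mu> \<alpha> l')" for l l'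
    proof -
      have eq: "l - rowidx \<alpha> l = l' - rowidx \<alpha> l'" and "rowidx \<alpha> l < rowidx \<alpha> l'"
        using cp by (auto simp: col_pair_def node_def)
      then have "l < l'" using rowidx_mono[of l' l] l by (cases "l < l'") auto
      show ?thesis
      proof (rule chain_rel[OF transp_colrel _ \<open>l < l'\<close>])
        fix t assume t: "l \<le> t" "t < l'"
        then have "Suc t - rowidx \<alpha> (Suc t) = t - rowidx \<alpha> t"
          using rowidx_mono[of l t] rowidx_mono[of t "Suc t"] rowidx_mono[of "Suc t" l'] eq l(2) by simp
        then have "Suc t \<in> breaks \<alpha>"
          using rowidx_Suc[OF \<alpha>, of t] rowidx_le[OF \<alpha>, of t] t l(2) by (simp split: if_splits)
        then show "colrel (V t) (V (Suc t))" using stepV[of t] t l(2) by simp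
      qed
    qed
    have "(row_pair x y \<longrightarrow> rowrel (T x) (T y)) \<and> (below \<mu> \<alpha> x y \<longrightarrow> colrel (T x) (T y))"
      if x: "x \<in> nodes (pair_shape \<mu> \<alpha>)" and y: "y \<in> nodes (pair_shape \<mu> \<alpha>)" for x y
    proof -
      have joint: "(length \<mu>, 0) \<notin> young \<mu>" by (simp add: mem_young)
      consider "x \<in> young \<mu>" "y \<in> young \<mu>"
        | l where "x \<in> young \<mu>" "l < sum_list \<alpha>" "y = node \<mu> \<alpha> l"
        | l where "y \<in> young \<mu>" "l < sum_list \<alpha>" "x = node \<mu> \<alpha> l"
        | l l' where "l < sum_list \<alpha>" "l' < sum_list \<alpha>" "x = node \<mu> \<alpha> l" "y = node \<mu> \<alpha> l'"
        using x y unfolding eq by blast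
      then show ?thesis
      proof cases
        case 1
        then show ?thesis using A joint by (auto simp: below_def[OF C])
      next
        case (2 l)
        then have "\<not> row_pair x y" by (cases x) (auto simp: row_pair_def node_def mem_young)
        then show ?thesis using young_ribbon[OF 2(1,2)] 2(3) by (simp add: V_def)
      next
        case (3 l)
        then have "\<not> row_pair x y" "\<not> col_pair x y"
          by (cases y; auto simp: row_pair_def col_pair_def node_def mem_young)+
        then show ?thesis using 3 node_notin_young[of \<mu> \<alpha> l] by (auto simp: below_def[OF C])
      next
        case (4 l l')
        then show ?thesis
          using ribbon_row[OF 4(1,2)] ribbon_col[OF 4(1,2)] node_notin_young[of \<mu> \<alpha> l]
          by (auto simp: below_def[OF C] V_def)
      qed
    qed
    then show "T \<in> pair_tableaux S \<psi> \<mu> \<alpha>" unfolding iff using A by blast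
  qed
qed

end

section \<open>Minimal tableaux and uniqueness of multiplicities\<close>

text \<open>The greedy least filling of a ribbon with breaks \<open>B\<close>. Index k stands for
  the value k/2, so the start 1 is the least positive letter and odd indices are odd letters. A
  letter is kept when its parity permits repetition along the step, and otherwise replaced by the
  next one.\<close>

fun min_index :: "nat set \<Rightarrow> nat \<Rightarrow> nat" where
  "min_index B 0 = 1"
| "min_index B (Suc l) =
     (if (Suc l \<in> B) = odd (min_index B l) then min_index B l else Suc (min_index B l))"

lemma min_index_pos: "1 \<le> min_index B l"
  by (induction l) auto

lemma min_index_mono: "l \<le> l' \<Longrightarrow> min_index B l \<le> min_index B l'"
  by (rule lift_Suc_mono_le[of "min_index B"]) auto

text \<open>The greedy sequence forgets nothing: the parity of the current index together with its
  being kept or not reveals the kind of the step.\<close>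

lemma break_iff_min_index:
  "Suc l \<in> B \<longleftrightarrow> (min_index B (Suc l) = min_index B l) = odd (min_index B l)"
  by auto

context crystal_alphabet
begin

lemma wt_pair_crystal:
  assumes "(\<mu>, \<alpha>) \<in> pairs_C p" "T \<in> pair_tableaux S \<psi> \<mu> \<alpha>"
  shows "wt (pair_crystal S \<psi> (\<mu>, \<alpha>)) T = (\<lambda>c. int (card {x \<in> nodes (pair_shape \<mu> \<alpha>). T x = c}))"
  using reading_word_words[OF assms(1,2)] distinct_cells[of "pair_shape \<mu> \<alpha>"]
  by (simp add: pair_crystal_def pullback_def wt_W reading_word_eq count_list_map_distinct set_cells)

lemma elems_pair_crystal: "elems (pair_crystal S \<psi> (\<mu>, \<alpha>)) = pair_tableaux S \<psi> \<mu> \<alpha>"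
  by (simp add: pair_crystal_def pullback_def)

definition letter :: "rat \<Rightarrow> 'a" where "letter v = inv_into (letters S) \<psi> v"

lemma letter: "v \<in> letters (alph_N p q) \<Longrightarrow> letter v \<in> letters S \<and> \<psi> (letter v) = v"
  by (simp add: letter_def inv_into_into f_inv_into_f image_\<psi>)

lemma negative_value: "i < p \<Longrightarrow> of_int (int i - int p) \<in> letters (alph_N p q)"
  by (auto simp: alph_N_def intro!: exI[of _ "int i - int p"])

lemma positive_value: "1 \<le> k \<Longrightarrow> k \<le> 2 * q \<Longrightarrow> of_nat k / 2 \<in> letters (alph_N p q)"
  by (auto simp: alph_N_def)

lemma positive_letter_cases:
  assumes "c \<in> letters S" "0 < \<psi> c"
  obtains k where "\<psi> c = of_nat k / 2" "1 \<le> k" "k \<le> 2 * q" "\<psi> c \<in> \<int> \<longleftrightarrow> even k"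
  using \<psi>_letter[OF assms(1)]
proof (cases rule: alph_N_cases)
  case (neg k)
  then have "(of_int k :: rat) < of_int 0" by (simp only: of_int_less_iff)
  then show ?thesis using neg assms(2) by simp
next
  case (pos k)
  then show ?thesis using that[of k] by (simp only: half_in_Ints_iff)
qed

text \<open>Induction along the ribbon: a filling strictly above the greedy index has already
  reached the next one, and a filling that agrees with it has the same parity and is forced to move
  whenever the greedy sequence moves.\<close>

lemma min_index_le:
  assumes "compatible B r V" "\<And>l. l < r \<Longrightarrow> V l \<in> letters S" "0 < \<psi> (V 0)" "l < r"
  shows "of_nat (min_index B l) / 2 \<le> \<psi> (V l)"
  using assms(4)
proof (induction l)
  case 0
  then have "V 0 \<in> letters S" using assms(2) by simp
  then obtain k where k: "\<psi> (V 0) = of_nat k / 2" "1 \<le> k"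
    using assms(3) positive_letter_cases by blast
  have "(of_nat 1 :: rat) \<le> of_nat k" using k(2) by (simp only: of_nat_le_iff)
  then show ?case using k(1) by simp
next
  case (Suc l)
  have pos: "0 < \<psi> (V l')" if "l' < r" for l'
    using compatible_mono[OF assms(1), of 0 l'] that assms(3) by simp
  obtain k where k: "\<psi> (V l) = of_nat k / 2" "\<psi> (V l) \<in> \<int> \<longleftrightarrow> even k"
    using positive_letter_cases[OF assms(2) pos] Suc.prems by (metis Suc_lessD)
  obtain k' where k': "\<psi> (V (Suc l)) = of_nat k' / 2"
    using positive_letter_cases[OF assms(2) pos] Suc.prems by blast
  have rel: "if Suc l \<in> B then colrel (V l) (V (Suc l)) else rowrel (V l) (V (Suc l))"
    using assms(1) Suc.prems by (simp add: compatible_def)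
  have "\<psi> (V l) \<le> \<psi> (V (Suc l))" using compatible_mono[OF assms(1), of l "Suc l"] Suc.prems by simp
  then have kk': "k \<le> k'" using k k' by (simp add: divide_le_cancel)
  have m: "min_index B l \<le> k" using Suc k by (simp add: divide_le_cancel)
  have "min_index B (Suc l) \<le> k'"
  proof (cases "(Suc l \<in> B) = odd (min_index B l)")
    case False
    have "Suc (min_index B l) \<le> k'"
    proof (cases "k = min_index B l")
      case True
      then have "V l \<noteq> V (Suc l)" "\<psi> (V l) < \<psi> (V (Suc l)) \<or> V l = V (Suc l)"
        using rel False k(2) by (auto simp: colrel_def rowrel_def split: if_splits)
      then have "k < k'" using k k' by (simp add: divide_less_cancel)
      then show ?thesis using True by simp
    qed (use m kk' in simp)
    then show ?thesis using False by simp
  qed (use m kk' in simp)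
  then show ?case using k' by (simp add: divide_le_cancel)
qed

text \<open>It plays the part of a highest weight element. Strictness of negative letters in columns
  dictates the body, row by row; the difference plus the column in the second branch is the position
  along the ribbon.\<close>

definition min_tableau :: "nat list \<Rightarrow> nat list \<Rightarrow> nat \<times> nat \<Rightarrow> 'a" where
  "min_tableau \<mu> \<alpha> x = (if x \<in> young \<mu> then letter (of_int (int (fst x) - int p))
     else if x \<in> nodes (pair_shape \<mu> \<alpha>)
       then letter (of_nat (min_index (breaks \<alpha>) (fst x - length \<mu> + snd x)) / 2)
     else undefined)"

lemma min_tableau_node:
  assumes "\<alpha> \<in> compositions" "l < sum_list \<alpha>"
  shows "min_tableau \<mu> \<alpha> (node \<mu> \<alpha> l) = letter (of_nat (min_index (breaks \<alpha>) l) / 2)"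
  using assms rowidx_le[OF assms] nodes_pair_shape_eq[OF assms(1), of \<mu>] node_notin_young[of \<mu> \<alpha> l]
  by (auto simp: min_tableau_def) (simp add: node_def)

context
  fixes \<mu> \<alpha> :: "nat list" and T
  assumes C: "(\<mu>, \<alpha>) \<in> pairs_C p" and T: "T \<in> pair_tableaux S \<psi> \<mu> \<alpha>"
begin

lemma \<alpha>_comp: "\<alpha> \<in> compositions" and \<mu>_partition: "\<mu> \<in> partitions" and length_\<mu>: "length \<mu> \<le> p"
  using C by (auto simp: pairs_C_def)

lemma min_index_le_entry:
  assumes "l < sum_list \<alpha>"
  shows "of_nat (min_index (breaks \<alpha>) l) / 2 \<le> \<psi> (T (node \<mu> \<alpha> l))"
proof (rule min_index_le)
  have D: "node \<mu> \<alpha> l \<in> nodes (pair_shape \<mu> \<alpha>)" if "l < sum_list \<alpha>" for l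
    using that nodes_pair_shape_eq[OF \<alpha>_comp] by auto
  show "T (node \<mu> \<alpha> l) \<in> letters S" if "l < sum_list \<alpha>" for l
    using T D[OF that] by (auto simp: pair_tableaux_iff[OF C])
  have ss: "T \<in> semistandard S (nodes (pair_shape \<mu> \<alpha>))"
    using T by (auto simp: pair_tableaux_def)
  have "\<alpha> \<noteq> []" using assms by auto
  then show "0 < \<psi> (T (node \<mu> \<alpha> 0))"
    using joint_positive[OF C ss] by (simp add: node_0[OF \<alpha>_comp])
  show "compatible (breaks \<alpha>) (sum_list \<alpha>) (\<lambda>l. T (node \<mu> \<alpha> l))"
    using T by (simp add: pair_tableaux_path_iff[OF C])
qed (use assms in simp)

text \<open>A ribbon may be too long for the alphabet. The filling \<open>T\<close> lies above the
  greedy sequence and thus shows that the latter does not run out of letters.\<close>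

lemma min_index_bound:
  assumes "l < sum_list \<alpha>"
  shows "min_index (breaks \<alpha>) l \<le> 2 * q"
proof -
  have D: "node \<mu> \<alpha> l \<in> nodes (pair_shape \<mu> \<alpha>)"
    using assms nodes_pair_shape_eq[OF \<alpha>_comp] by auto
  then have l: "T (node \<mu> \<alpha> l) \<in> letters S" using T by (auto simp: pair_tableaux_iff[OF C])
  have "(0 :: rat) < of_nat (min_index (breaks \<alpha>) l) / 2" using min_index_pos[of "breaks \<alpha>" l] by simp
  then have pos: "0 < \<psi> (T (node \<mu> \<alpha> l))" using min_index_le_entry[OF assms] by simp
  obtain k where k: "\<psi> (T (node \<mu> \<alpha> l)) = of_nat k / 2" "k \<le> 2 * q"
    using positive_letter_cases[OF l pos] by blast
  have "min_index (breaks \<alpha>) l \<le> k" using min_index_le_entry[OF assms] k(1) by (simp add: divide_le_cancel)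
  then show ?thesis using k(2) by simp
qed

lemma young_row_less_p: "x \<in> young \<mu> \<Longrightarrow> fst x < p"
  using length_\<mu> by (cases x) (auto simp: mem_young)

lemma \<psi>_min_tableau_young:
  assumes "x \<in> young \<mu>"
  shows "min_tableau \<mu> \<alpha> x \<in> letters S" "\<psi> (min_tableau \<mu> \<alpha> x) = of_int (int (fst x) - int p)"
  using letter[OF negative_value[OF young_row_less_p[OF assms]]] assms by (simp_all add: min_tableau_def)

lemma \<psi>_min_tableau_node:
  assumes "l < sum_list \<alpha>"
  shows "min_tableau \<mu> \<alpha> (node \<mu> \<alpha> l) \<in> letters S"
    "\<psi> (min_tableau \<mu> \<alpha> (node \<mu> \<alpha> l)) = of_nat (min_index (breaks \<alpha>) l) / 2"
  using letter[OF positive_value[OF min_index_pos min_index_bound[OF assms]]]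
  by (simp_all add: min_tableau_node[OF \<alpha>_comp assms])

lemma min_tableau_le:
  assumes "x \<in> nodes (pair_shape \<mu> \<alpha>)"
  shows "\<psi> (min_tableau \<mu> \<alpha> x) \<le> \<psi> (T x)"
proof -
  have ss: "T \<in> semistandard S (nodes (pair_shape \<mu> \<alpha>))"
    using T by (auto simp: pair_tableaux_def)
  consider "x \<in> young \<mu>" | l where "l < sum_list \<alpha>" "x = node \<mu> \<alpha> l"
    using assms nodes_pair_shape_eq[OF \<alpha>_comp] by auto
  then show ?thesis
  proof cases
    case 1
    have "of_int (int (fst x) - int p) \<le> \<psi> (T (fst x, snd x))"
    proof (rule column_lower_bound[OF ss])
      fix i' assume "i' \<le> fst x"
      then have "(i', snd x) \<in> young \<mu>" using 1 young_down_closed[OF \<mu>_partition, of "fst x" "snd x"] by simp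
      then show "(i', snd x) \<in> nodes (pair_shape \<mu> \<alpha>)" by (rule young_subset_D[OF C])
    qed (use young_row_less_p[OF 1] in simp)
    then show ?thesis using \<psi>_min_tableau_young(2)[OF 1] by simp
  next
    case 2
    then show ?thesis using min_index_le_entry[OF 2(1)] \<psi>_min_tableau_node(2)[OF 2(1)] by simp
  qed
qed

lemma min_tableau_in: "min_tableau \<mu> \<alpha> \<in> pair_tableaux S \<psi> \<mu> \<alpha>"
  unfolding pair_tableaux_path_iff[OF C]
proof (intro conjI ballI impI)
  note eq = nodes_pair_shape_eq[OF \<alpha>_comp, of \<mu>]
  show "min_tableau \<mu> \<alpha> \<in> nodes (pair_shape \<mu> \<alpha>) \<rightarrow>\<^sub>E letters S"
  proof (rule PiE_I)
    fix x assume "x \<in> nodes (pair_shape \<mu> \<alpha>)"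
    then show "min_tableau \<mu> \<alpha> x \<in> letters S"
      unfolding eq using \<psi>_min_tableau_young(1) \<psi>_min_tableau_node(1) by blast
  next
    fix x assume "x \<notin> nodes (pair_shape \<mu> \<alpha>)"
    then show "min_tableau \<mu> \<alpha> x = undefined" unfolding min_tableau_def eq by auto
  qed
  show "rowrel (min_tableau \<mu> \<alpha> x) (min_tableau \<mu> \<alpha> y)" if "x \<in> young \<mu>" "y \<in> young \<mu>" "row_pair x y" for x y
    using that \<psi>_min_tableau_young(2)[OF that(1)]
    by (auto simp: rowrel_def row_pair_def min_tableau_def simp del: of_int_diff)
  show "colrel (min_tableau \<mu> \<alpha> x) (min_tableau \<mu> \<alpha> y)" if "x \<in> young \<mu>" "y \<in> young \<mu>" "col_pair x y" for x y
    using that \<psi>_min_tableau_young(2)[OF that(1)] \<psi>_min_tableau_young(2)[OF that(2)]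
    by (auto simp: colrel_def col_pair_def)
  show "colrel (min_tableau \<mu> \<alpha> x) (min_tableau \<mu> \<alpha> (node \<mu> \<alpha> 0))" if "\<alpha> \<noteq> []" "x \<in> young \<mu>" for x
  proof -
    have "0 < sum_list \<alpha>" using that(1) \<alpha>_comp by (cases \<alpha>) (auto simp: compositions_def)
    then have "\<psi> (min_tableau \<mu> \<alpha> (node \<mu> \<alpha> 0)) = 1 / 2" using \<psi>_min_tableau_node(2)[of 0] by simp
    moreover have "(of_int (int (fst x) - int p) :: rat) < of_int 0"
      using young_row_less_p[OF that(2)] by (simp only: of_int_less_iff)
    ultimately show ?thesis using \<psi>_min_tableau_young(2)[OF that(2)] by (simp add: colrel_def)
  qed
  show "compatible (breaks \<alpha>) (sum_list \<alpha>) (\<lambda>l. min_tableau \<mu> \<alpha> (node \<mu> \<alpha> l))"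
    unfolding compatible_def
  proof (intro allI impI)
    fix l assume l: "Suc l < sum_list \<alpha>"
    then have l': "l < sum_list \<alpha>" by simp
    define k where "k = min_index (breaks \<alpha>) l"
    have k: "\<psi> (min_tableau \<mu> \<alpha> (node \<mu> \<alpha> l)) = of_nat k / 2"
      using \<psi>_min_tableau_node(2)[OF l'] by (simp add: k_def)
    show "if Suc l \<in> breaks \<alpha> then colrel (min_tableau \<mu> \<alpha> (node \<mu> \<alpha> l)) (min_tableau \<mu> \<alpha> (node \<mu> \<alpha> (Suc l)))
        else rowrel (min_tableau \<mu> \<alpha> (node \<mu> \<alpha> l)) (min_tableau \<mu> \<alpha> (node \<mu> \<alpha> (Suc l)))"
    proof (cases "(Suc l \<in> breaks \<alpha>) = odd k")
      case True
      then have "min_tableau \<mu> \<alpha> (node \<mu> \<alpha> (Suc l)) = min_tableau \<mu> \<alpha> (node \<mu> \<alpha> l)"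
        unfolding min_tableau_node[OF \<alpha>_comp l] min_tableau_node[OF \<alpha>_comp l'] by (simp add: k_def)
      moreover have "\<psi> (min_tableau \<mu> \<alpha> (node \<mu> \<alpha> l)) \<in> \<int> \<longleftrightarrow> even k" unfolding k by (rule half_in_Ints_iff)
      ultimately show ?thesis using True by (auto simp: colrel_def rowrel_def)
    next
      case False
      then have "\<psi> (min_tableau \<mu> \<alpha> (node \<mu> \<alpha> (Suc l))) = of_nat (Suc k) / 2"
        using \<psi>_min_tableau_node(2)[OF l] by (simp add: k_def)
      then show ?thesis using k by (simp add: colrel_def rowrel_def divide_less_cancel)
    qed
  qed
qed

end

section \<open>Extremal weights and linear independence of characters\<close>

text \<open>Each letter is weighted by the number of letters from it upwards, a strictly decreasing
  function of the letter. Lowering an entry raises the height, so the entrywise least tableau is its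
  unique maximum.\<close>

definition height :: "('a \<Rightarrow> int) \<Rightarrow> int" where
  "height w = (\<Sum>d\<in>letters S. w d * int (card {c \<in> letters S. \<psi> d \<le> \<psi> c}))"

lemma finite_nodes: "finite (nodes rs)"
  using set_cells[of rs] by (metis List.finite_set)

lemma height_wt:
  assumes C: "(\<mu>, \<alpha>) \<in> pairs_C p" and T: "T \<in> pair_tableaux S \<psi> \<mu> \<alpha>"
  shows "height (wt (pair_crystal S \<psi> (\<mu>, \<alpha>)) T) =
    (\<Sum>x\<in>nodes (pair_shape \<mu> \<alpha>). int (card {c \<in> letters S. \<psi> (T x) \<le> \<psi> c}))"
proof -
  have "T ` nodes (pair_shape \<mu> \<alpha>) \<subseteq> letters S" using T by (auto simp: pair_tableaux_iff[OF C])
  from sum.group[OF finite_nodes finite_letters this, of "\<lambda>x. int (card {c \<in> letters S. \<psi> (T x) \<le> \<psi> c})"]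
  show ?thesis by (simp add: height_def wt_pair_crystal[OF C T] flip: of_nat_mult)
qed

lemma height_min_tableau:
  assumes C: "(\<mu>, \<alpha>) \<in> pairs_C p" and T: "T \<in> pair_tableaux S \<psi> \<mu> \<alpha>"
  shows "height (wt (pair_crystal S \<psi> (\<mu>, \<alpha>)) T) \<le> height (wt (pair_crystal S \<psi> (\<mu>, \<alpha>)) (min_tableau \<mu> \<alpha>))"
    and "height (wt (pair_crystal S \<psi> (\<mu>, \<alpha>)) T) = height (wt (pair_crystal S \<psi> (\<mu>, \<alpha>)) (min_tableau \<mu> \<alpha>)) \<Longrightarrow>
      T = min_tableau \<mu> \<alpha>"
proof -
  let ?D = "nodes (pair_shape \<mu> \<alpha>)" and ?M = "min_tableau \<mu> \<alpha>"
  define \<rho> where "\<rho> d = int (card {c \<in> letters S. \<psi> d \<le> \<psi> c})" for d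
  note M = min_tableau_in[OF C T] and le = min_tableau_le[OF C T]
  have le_\<rho>: "\<rho> (T x) \<le> \<rho> (?M x)" if "x \<in> ?D" for x
  proof -
    have "{c \<in> letters S. \<psi> (T x) \<le> \<psi> c} \<subseteq> {c \<in> letters S. \<psi> (?M x) \<le> \<psi> c}" using le[OF that] by auto
    then show ?thesis unfolding \<rho>_def using finite_letters by (auto intro: card_mono)
  qed
  show "height (wt (pair_crystal S \<psi> (\<mu>, \<alpha>)) T) \<le> height (wt (pair_crystal S \<psi> (\<mu>, \<alpha>)) ?M)"
    unfolding height_wt[OF C T] height_wt[OF C M] using le_\<rho> by (intro sum_mono) (simp add: \<rho>_def)
  assume "height (wt (pair_crystal S \<psi> (\<mu>, \<alpha>)) T) = height (wt (pair_crystal S \<psi> (\<mu>, \<alpha>)) ?M)"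
  then have eq: "(\<Sum>x\<in>?D. \<rho> (T x)) = (\<Sum>x\<in>?D. \<rho> (?M x))"
    unfolding height_wt[OF C T] height_wt[OF C M] by (simp add: \<rho>_def)
  have P: "T \<in> ?D \<rightarrow>\<^sub>E letters S" "?M \<in> ?D \<rightarrow>\<^sub>E letters S"
    using T M by (simp_all add: pair_tableaux_iff[OF C])
  have "T x = ?M x" if x: "x \<in> ?D" for x
  proof (rule ccontr)
    assume ne: "T x \<noteq> ?M x"
    have l: "T x \<in> letters S" "?M x \<in> letters S" using P x by auto
    then have less: "\<psi> (?M x) < \<psi> (T x)" using le[OF x] ne \<psi>_eq_iff[OF l] by simp
    have "?M x \<in> {c \<in> letters S. \<psi> (?M x) \<le> \<psi> c} - {c \<in> letters S. \<psi> (T x) \<le> \<psi> c}"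
      using less l by simp
    moreover have "{c \<in> letters S. \<psi> (T x) \<le> \<psi> c} \<subseteq> {c \<in> letters S. \<psi> (?M x) \<le> \<psi> c}"
      using less by auto
    ultimately have "{c \<in> letters S. \<psi> (T x) \<le> \<psi> c} \<subset> {c \<in> letters S. \<psi> (?M x) \<le> \<psi> c}" by blast
    then have "\<rho> (T x) < \<rho> (?M x)" unfolding \<rho>_def using finite_letters by (auto intro: psubset_card_mono)
    then have "(\<Sum>x\<in>?D. \<rho> (T x)) < (\<Sum>x\<in>?D. \<rho> (?M x))"
      using x le_\<rho> by (intro sum_strict_mono_ex1[OF finite_nodes]) auto
    then show False using eq by simp
  qed
  then show "T = ?M" using P by (metis PiE_ext)
qed

text \<open>The negative letters of the least tableau count the rows of the body. The positive ones
  count the values of the greedy sequence, which is weakly increasing and hence determined by these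
  counts; its steps then give back the breaks.\<close>

lemma min_tableau_weight_inj:
  assumes C: "(\<mu>, \<alpha>) \<in> pairs_C p" and T: "T \<in> pair_tableaux S \<psi> \<mu> \<alpha>"
    and C': "(\<mu>', \<alpha>') \<in> pairs_C p" and T': "T' \<in> pair_tableaux S \<psi> \<mu>' \<alpha>'"
    and eq: "wt (pair_crystal S \<psi> (\<mu>, \<alpha>)) (min_tableau \<mu> \<alpha>) = wt (pair_crystal S \<psi> (\<mu>', \<alpha>')) (min_tableau \<mu>' \<alpha>')"
  shows "(\<mu>, \<alpha>) = (\<mu>', \<alpha>')"
proof -
  have eq': "card {x \<in> nodes (pair_shape \<mu> \<alpha>). min_tableau \<mu> \<alpha> x = c} =
      card {x \<in> nodes (pair_shape \<mu>' \<alpha>'). min_tableau \<mu>' \<alpha>' x = c}" for c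
    using fun_cong[OF eq, of c]
    by (simp add: wt_pair_crystal[OF C min_tableau_in[OF C T]] wt_pair_crystal[OF C' min_tableau_in[OF C' T']])
  have row: "card {x \<in> nodes (pair_shape \<mu> \<alpha>). min_tableau \<mu> \<alpha> x = letter (of_int (int i - int p))} = part \<mu> i"
    if C: "(\<mu>, \<alpha>) \<in> pairs_C p" and T: "T \<in> pair_tableaux S \<psi> \<mu> \<alpha>" and "i < p" for \<mu> \<alpha> T i
  proof -
    have neg: "(of_int (int i - int p) :: rat) < of_int 0" using \<open>i < p\<close> by (simp only: of_int_less_iff)
    have "{x \<in> nodes (pair_shape \<mu> \<alpha>). min_tableau \<mu> \<alpha> x = letter (of_int (int i - int p))} = Pair i ` {..<part \<mu> i}"
      (is "?A = ?B")
    proof -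
      have iff: "min_tableau \<mu> \<alpha> x = letter (of_int (int i - int p)) \<longleftrightarrow> \<psi> (min_tableau \<mu> \<alpha> x) = of_int (int i - int p)"
        if "min_tableau \<mu> \<alpha> x \<in> letters S" for x
        using \<psi>_eq_iff[OF that, of "letter (of_int (int i - int p))"] letter[OF negative_value[OF \<open>i < p\<close>]] by simp
      have "x \<in> ?A \<longleftrightarrow> x \<in> ?B" if "x \<in> young \<mu>" for x
        using iff[OF \<psi>_min_tableau_young(1)[OF C T that]] \<psi>_min_tableau_young(2)[OF C T that] that young_subset_D[OF C that]
        by (cases x) (auto simp: mem_young part_def simp del: of_int_diff)
      moreover have "x \<in> young \<mu>" if "x \<in> ?B" for x
        using that by (auto simp: mem_young part_def split: if_splits)
      moreover have "x \<in> young \<mu>" if x: "x \<in> ?A" for x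
      proof (rule ccontr)
        assume "x \<notin> young \<mu>"
        then obtain l where l: "l < sum_list \<alpha>" "x = node \<mu> \<alpha> l"
          using x nodes_pair_shape_eq[OF pairs_C_D(2)[OF C], of \<mu>] by auto
        have "(0 :: rat) \<le> of_nat (min_index (breaks \<alpha>) l) / 2" by simp
        then show False
          using x iff[of x] \<psi>_min_tableau_node[OF C T l(1)] l(2) neg by auto
      qed
      ultimately show ?thesis by blast
    qed
    then show ?thesis by (simp add: card_image inj_on_def)
  qed
  have col: "card {x \<in> nodes (pair_shape \<mu> \<alpha>). min_tableau \<mu> \<alpha> x = letter (of_nat k / 2)} =
      count_list (map (min_index (breaks \<alpha>)) [0..<sum_list \<alpha>]) k"
    if C: "(\<mu>, \<alpha>) \<in> pairs_C p" and T: "T \<in> pair_tableaux S \<psi> \<mu> \<alpha>" and k: "1 \<le> k" "k \<le> 2 * q" for \<mu> \<alpha> T k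
  proof -
    have pos: "(0 :: rat) < of_nat k / 2" using k by simp
    have "{x \<in> nodes (pair_shape \<mu> \<alpha>). min_tableau \<mu> \<alpha> x = letter (of_nat k / 2)} =
        node \<mu> \<alpha> ` {l \<in> {..<sum_list \<alpha>}. min_index (breaks \<alpha>) l = k}" (is "?A = ?B")
    proof -
      have iff: "min_tableau \<mu> \<alpha> x = letter (of_nat k / 2) \<longleftrightarrow> \<psi> (min_tableau \<mu> \<alpha> x) = of_nat k / 2"
        if "min_tableau \<mu> \<alpha> x \<in> letters S" for x
        using \<psi>_eq_iff[OF that, of "letter (of_nat k / 2)"] letter[OF positive_value[OF k]] by simp
      have node: "min_tableau \<mu> \<alpha> (node \<mu> \<alpha> l) = letter (of_nat k / 2) \<longleftrightarrow> min_index (breaks \<alpha>) l = k"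
        if "l < sum_list \<alpha>" for l
        using iff[OF \<psi>_min_tableau_node(1)[OF C T that]] \<psi>_min_tableau_node(2)[OF C T that] by simp
      have "x \<notin> ?A" if x: "x \<in> young \<mu>" for x
      proof -
        have "(of_int (int (fst x) - int p) :: rat) < of_int 0"
          using young_row_less_p[OF C T x] by (simp only: of_int_less_iff)
        then show ?thesis
          using iff[OF \<psi>_min_tableau_young(1)[OF C T x]] \<psi>_min_tableau_young(2)[OF C T x] pos by auto
      qed
      then show ?thesis unfolding nodes_pair_shape_eq[OF pairs_C_D(2)[OF C], of \<mu>] using node by auto
    qed
    then have "card ?A = card {l \<in> {..<sum_list \<alpha>}. min_index (breaks \<alpha>) l = k}"
      using inj_on_node[OF pairs_C_D(2)[OF C], of \<mu>] by (simp add: card_image inj_on_def)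
    also have "\<dots> = count_list (map (min_index (breaks \<alpha>)) [0..<sum_list \<alpha>]) k"
      by (subst count_list_map_distinct) (auto intro!: arg_cong[where f = card])
    finally show ?thesis .
  qed
  note c = pairs_C_D(2)[OF C] pairs_C_D(2)[OF C'] and m = pairs_C_D(1)[OF C] pairs_C_D(1)[OF C']
  have parts: "part \<mu> i = part \<mu>' i" for i
    using row[OF C T, of i] row[OF C' T', of i] eq' pairs_C_D(3)[OF C] pairs_C_D(3)[OF C']
    by (cases "i < p") (auto simp: part_def)
  have pos: "0 < part \<nu> i \<longleftrightarrow> i < length \<nu>" if "\<nu> \<in> partitions" for \<nu> i
    using that by (auto simp: part_def partitions_def) (metis gr0I nth_mem)
  have "length \<mu> = length \<mu>'"
    using pos[OF m(1)] pos[OF m(2)] parts by (metis linorder_neqE_nat less_irrefl)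
  then have \<mu>: "\<mu> = \<mu>'" using parts by (auto simp: part_def intro!: nth_equalityI) metis
  define f f' where "f = map (min_index (breaks \<alpha>)) [0..<sum_list \<alpha>]" and "f' = map (min_index (breaks \<alpha>')) [0..<sum_list \<alpha>']"
  have "count_list f k = count_list f' k" for k
  proof (cases "1 \<le> k \<and> k \<le> 2 * q")
    case True
    then show ?thesis using col[OF C T] col[OF C' T'] eq' by (simp add: f_def f'_def)
  next
    case False
    then have "k \<notin> set f" "k \<notin> set f'"
      using min_index_pos min_index_bound[OF C T] min_index_bound[OF C' T'] by (auto simp: f_def f'_def)
    then show ?thesis by (metis count_list_0_iff)
  qed
  \<comment> \<open>Equal counts make the multisets equal, and two sorted lists with the same
    multiset coincide.\<close>
  then have "mset f = mset f'" by (intro multiset_eqI) (simp add: count_mset)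
  moreover have "sorted f" "sorted f'"
    by (auto simp: f_def f'_def sorted_iff_nth_mono intro!: min_index_mono)
  ultimately have ff': "f = f'" by (metis properties_for_sort)
  then have r: "sum_list \<alpha> = sum_list \<alpha>'" by (metis f_def f'_def length_map length_upt diff_zero)
  have idx: "min_index (breaks \<alpha>) l = min_index (breaks \<alpha>') l" if "l < sum_list \<alpha>" for l
    using arg_cong[OF ff', of "\<lambda>f. f ! l"] that r by (simp add: f_def f'_def)
  have "b \<in> breaks \<alpha> \<longleftrightarrow> b \<in> breaks \<alpha>'" for b
  proof (cases "b \<in> {1..<sum_list \<alpha>}")
    case True
    then obtain l where "b = Suc l" "Suc l < sum_list \<alpha>" by (cases b) auto
    then show ?thesis using idx[of l] idx[of "Suc l"] break_iff_min_index[of l] by (metis Suc_lessD)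
  next
    case False
    then show ?thesis using breaks_subset[OF c(1)] breaks_subset[OF c(2)] r by auto
  qed
  then have b: "breaks \<alpha> = breaks \<alpha>'" by blast
  have "\<alpha> = \<alpha>'"
  proof (cases "sum_list \<alpha> = 0")
    case True
    then have "\<alpha> = []" "\<alpha>' = []" using c r by (cases \<alpha>; cases \<alpha>'; auto simp: compositions_def)+
    then show ?thesis by simp
  next
    case False
    then have "\<alpha> \<noteq> []" "\<alpha>' \<noteq> []" using r by auto
    then show ?thesis using composition_from_breaks[OF c(1)] composition_from_breaks[OF c(2)] b r by simp
  qed
  then show ?thesis using \<mu> by simp
qed

text \<open>Of the crystal isomorphisms only the weights are used. Among the pairs with different
  multiplicities one of greatest extremal height is chosen; at its extremal weight no other of these
  pairs contributes, so the two decompositions would have different numbers of elements of that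
  weight.\<close>

lemma multiplicity_unique:
  assumes c: "is_decomposition S \<psi> p q K c" and N: "is_decomposition S \<psi> p q K N"
    and fin: "finite (elems K)" and x: "x \<in> pairs_C p" "elems (pair_crystal S \<psi> x) \<noteq> {}"
  shows "c x = N x"
proof (rule ccontr)
  assume "c x \<noteq> N x"
  define F where "F = (\<lambda>(x, k :: nat). pair_crystal S \<psi> x)"
  define DS where "DS c = direct_sum (SIGMA x:pairs_C p. {..<c x}) F" for c
  define E where "E c w = {z \<in> elems (DS c).
      wt (DS c) z = w}" for c :: "nat list \<times> nat list \<Rightarrow> nat" and w
  have mem_E: "((x, k), T) \<in> E c w \<longleftrightarrow> x \<in> pairs_C p \<and> k < c x \<and> T \<in> elems (pair_crystal S \<psi> x) \<and>
      wt (pair_crystal S \<psi> x) T = w" for x k T c w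
    by (auto simp: E_def DS_def direct_sum_def F_def)
  have card_E: "finite (elems (DS c)) \<and>
      card (E c w) = card {b \<in> elems K. wt K b = w}" if dec: "is_decomposition S \<psi> p q K c" for c w
  proof -
    obtain h where h: "bij_betw h (elems K) (elems (DS c))"
      and wt: "\<forall>b\<in>elems K. wt (DS c) (h b) = wt K b"
      using dec unfolding is_decomposition_def crystal_iso_def F_def DS_def by blast
    have "elems (DS c) = h ` elems K"
      using h by (simp add: bij_betw_def)
    then have "E c w = h ` {b \<in> elems K. wt (DS c) (h b) = w}"
      unfolding E_def by auto
    also have "\<dots> = h ` {b \<in> elems K. wt K b = w}"
      using wt by (intro image_cong Collect_cong conj_cong) auto
    finally have "E c w = h ` {b \<in> elems K. wt K b = w}" .
    moreover have "inj_on h {b \<in> elems K. wt K b = w}"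
      using h by (auto simp: bij_betw_def intro: inj_on_subset)
    ultimately show ?thesis using h fin by (auto simp: card_image bij_betw_finite)
  qed
  have fin_E: "finite (E c w)" "finite (E N w)" for w
    using card_E[OF c] card_E[OF N] by (auto simp: E_def)
  \<comment> \<open>This set is finite because each of its pairs contributes an element to one of
    the two direct sums, and both are as large as \<open>K\<close>.\<close>
  define X where "X = {x \<in> pairs_C p. elems (pair_crystal S \<psi> x) \<noteq> {} \<and> c x \<noteq> N x}"
  have "X \<subseteq> (fst \<circ> fst) ` (elems (DS c) \<union>
      elems (DS N))"
  proof
    fix y assume "y \<in> X"
    then obtain T where y: "y \<in> pairs_C p" "T \<in> elems (pair_crystal S \<psi> y)" "c y \<noteq> N y" by (auto simp: X_def)
    then have "((y, 0), T) \<in> elems (DS c) \<union>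
      elems (DS N)" by (auto simp: DS_def direct_sum_def F_def)
    then show "y \<in> (fst \<circ> fst) ` (elems (DS c) \<union>
      elems (DS N))" by force
  qed
  then have "finite X"
    by (rule finite_subset) (simp add: card_E[OF c, THEN conjunct1] card_E[OF N, THEN conjunct1])
  define H where "H = (\<lambda>(\<mu>, \<alpha>). height (wt (pair_crystal S \<psi> (\<mu>, \<alpha>)) (min_tableau \<mu> \<alpha>)))"
  have "x \<in> X" using x \<open>c x \<noteq> N x\<close> by (simp add: X_def)
  then have "Max (H ` X) \<in> H ` X" using \<open>finite X\<close> by (intro Max_in) auto
  then obtain y where y: "y \<in> X" "Max (H ` X) = H y" by blast
  then have y_max: "H z \<le> H y" if "z \<in> X" for z
    using Max_ge[of "H ` X" "H z"] \<open>finite X\<close> that by simp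
  obtain \<mu> \<alpha> where y_eq: "y = (\<mu>, \<alpha>)" by (cases y)
  obtain T where C: "(\<mu>, \<alpha>) \<in> pairs_C p" and T: "T \<in> pair_tableaux S \<psi> \<mu> \<alpha>" and ne: "c y \<noteq> N y"
    using y(1) y_eq by (auto simp: X_def elems_pair_crystal)
  define w where "w = wt (pair_crystal S \<psi> y) (min_tableau \<mu> \<alpha>)"
  \<comment> \<open>The height of \<open>w\<close> is at most that of the least tableau for
    \<open>z\<close>, which by maximality is at most that of \<open>w\<close>. Equality makes
    \<open>U\<close> this least tableau, and its weight determines the pair.\<close>
  have other: "z = y" if z: "z \<in> X" and U: "U \<in> elems (pair_crystal S \<psi> z)" "wt (pair_crystal S \<psi> z) U = w" for z U
  proof -
    obtain \<mu>' \<alpha>' where z_eq: "z = (\<mu>', \<alpha>')" by (cases z)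
    have C': "(\<mu>', \<alpha>') \<in> pairs_C p" and U': "U \<in> pair_tableaux S \<psi> \<mu>' \<alpha>'"
      using z U z_eq by (auto simp: X_def elems_pair_crystal)
    have "height w \<le> H z" using height_min_tableau(1)[OF C' U'] U(2) by (simp add: H_def z_eq)
    moreover have "H z \<le> height w" using y_max[OF z] by (simp add: H_def y_eq w_def)
    ultimately have "U = min_tableau \<mu>' \<alpha>'"
      using height_min_tableau(2)[OF C' U'] U(2) by (simp add: H_def z_eq)
    then show ?thesis
      using min_tableau_weight_inj[OF C T C' U'] U(2) by (simp add: w_def y_eq z_eq)
  qed
  define Y where "Y = {T \<in> elems (pair_crystal S \<psi> y). wt (pair_crystal S \<psi> y) T = w}"
  have "min_tableau \<mu> \<alpha> \<in> Y"
    using min_tableau_in[OF C T] by (simp add: Y_def w_def y_eq elems_pair_crystal)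
  have at_y: "{z \<in> E c' w. fst (fst z) = y} = ({y} \<times> {..<c' y}) \<times> Y" for c'
    using C by (auto simp: mem_E Y_def y_eq)
  have off_y: "{z \<in> E c w. fst (fst z) \<noteq> y} = {z \<in> E N w. fst (fst z) \<noteq> y}"
  proof -
    have "((z, k), U) \<in> E c w \<longleftrightarrow> ((z, k), U) \<in> E N w" if "z \<noteq> y" for z k U
    proof (cases "z \<in> X")
      case True
      then show ?thesis using other[OF True] that by (auto simp: mem_E)
    next
      case False
      then show ?thesis by (auto simp: mem_E X_def)
    qed
    then show ?thesis by fastforce
  qed
  have split: "card (E c' w) = card {z \<in> E c' w. fst (fst z) \<noteq> y} + card {z \<in> E c' w. fst (fst z) = y}"
    if "finite (E c' w)" for c'
  proof -
    have "E c' w = {z \<in> E c' w. fst (fst z) \<noteq> y} \<union> {z \<in> E c' w. fst (fst z) = y}" by auto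
    moreover have "card \<dots> = card {z \<in> E c' w. fst (fst z) \<noteq> y} + card {z \<in> E c' w. fst (fst z) = y}"
      using that by (intro card_Un_disjoint) auto
    ultimately show ?thesis by simp
  qed
  have "card (E c w) = card (E N w)" using card_E[OF c] card_E[OF N] by simp
  then have "c y * card Y = N y * card Y"
    using split[OF fin_E(1)[of w]] split[OF fin_E(2)[of w]] off_y by (simp add: at_y card_cartesian_product)
  moreover have "finite Y"
  proof -
    have "finite (pair_tableaux S \<psi> \<mu> \<alpha>)"
      by (rule finite_subset[OF _ finite_PiE[OF finite_nodes finite_letters]]) (auto simp: pair_tableaux_iff[OF C])
    then show ?thesis by (simp add: Y_def y_eq elems_pair_crystal)
  qed
  then have "card Y \<noteq> 0" using \<open>min_tableau \<mu> \<alpha> \<in> Y\<close> by auto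
  ultimately show False using ne by simp
qed

end

section \<open>Standardization\<close>

lemma down_closed_nat_set:
  assumes "finite A" "\<And>j j'. j \<in> A \<Longrightarrow> j' \<le> j \<Longrightarrow> j' \<in> (A :: nat set)"
  shows "j \<in> A \<longleftrightarrow> j < card A"
proof -
  obtain m where m: "m \<notin> A" "\<And>k. k < m \<Longrightarrow> k \<in> A"
    using exists_least_iff[of "\<lambda>k. k \<notin> A"] ex_new_if_finite[OF infinite_UNIV_nat assms(1)] by blast
  have "A = {..<m}" using m assms(2) by (auto simp: not_le[symmetric])
  then show ?thesis by simp
qed

text \<open>Needed because in the surjectivity proof the body arises as an order ideal of nodes and
  not as a list of parts.\<close>

lemma down_closed_set_young:
  assumes "finite M" and down: "\<And>i j i' j'. (i, j) \<in> M \<Longrightarrow> i' \<le> i \<Longrightarrow> j' \<le> j \<Longrightarrow> (i', j') \<in> M"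
  obtains \<mu> where "\<mu> \<in> partitions" "young \<mu> = M"
proof -
  define row where "row i = card {j. (i, j) \<in> M}" for i
  define n where "n = card {i. (i, 0) \<in> M}"
  have fin_row: "finite {j. (i, j) \<in> M}" for i
    by (rule finite_subset[OF _ finite_imageI[OF assms(1), of snd]]) force
  have fin_col: "finite {i. (i, 0) \<in> M}"
    by (rule finite_subset[OF _ finite_imageI[OF assms(1), of fst]]) force
  have row: "(i, j) \<in> M \<longleftrightarrow> j < row i" for i j
    using down_closed_nat_set[OF fin_row, of i j] down by (auto simp: row_def)
  have col: "(i, 0) \<in> M \<longleftrightarrow> i < n" for i
    using down_closed_nat_set[OF fin_col, of i] down by (auto simp: n_def)
  have row_pos: "0 < row i" if "i < n" for i using row[of i 0] col[of i] that by simp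
  have "row i' \<le> row i" if "i \<le> i'" for i i'
    unfolding row_def using that down by (intro card_mono[OF fin_row]) blast
  then have "map row [0..<n] \<in> partitions"
    using row_pos by (fastforce simp: partitions_def sorted_wrt_iff_nth_less)
  moreover have "young (map row [0..<n]) = M"
  proof -
    have "(i, j) \<in> young (map row [0..<n]) \<longleftrightarrow> (i, j) \<in> M" for i j
      using row[of i j] col[of i] down[of i j i 0] by (auto simp: mem_young)
    then show ?thesis by auto
  qed
  ultimately show ?thesis by (rule that)
qed

lemma young_inject:
  assumes "\<mu> \<in> partitions" "\<nu> \<in> partitions" "young \<mu> = young \<nu>"
  shows "\<mu> = \<nu>"
proof (rule nth_equalityI)
  show len: "length \<mu> = length \<nu>"
    using young_first_column[OF assms(1)] young_first_column[OF assms(2)] assms(3)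
    by (metis linorder_neqE_nat less_irrefl)
  fix i assume i: "i < length \<mu>"
  have "j < \<mu> ! i \<longleftrightarrow> j < \<nu> ! i" for j
    using mem_young[of i j \<mu>] mem_young[of i j \<nu>] assms(3) i len by simp
  then show "\<mu> ! i = \<nu> ! i" by (metis linorder_neqE_nat less_irrefl)
qed

lemma finite_young: "finite (young \<mu>)"
  unfolding young_def using set_cells by (metis List.finite_set)

text \<open>Standard tableaux start with the entry 1 and ribbon positions with 0; the shift lets the
  two be compared directly.\<close>

definition cell :: "(nat \<times> nat) set \<Rightarrow> (nat \<times> nat \<Rightarrow> nat) \<Rightarrow> nat \<Rightarrow> nat \<times> nat" where
  "cell R T l = inv_into R T (Suc l)"

lemma descents_eq:
  "descents R T = {k. 1 \<le> k \<and> k < card R \<and> snd (cell R T k) \<le> snd (cell R T (k - 1))}"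
  by (auto simp: descents_def entry_column_def cell_def)

lemma descent_composition_breaks:
  assumes "finite R"
  shows "descent_composition R T \<in> compositions" "sum_list (descent_composition R T) = card R"
    "breaks (descent_composition R T) = descents R T" "descent_composition R T = [] \<longleftrightarrow> R = {}"
proof -
  have "descent_composition R T \<in> compositions \<and> sum_list (descent_composition R T) = card R \<and>
    breaks (descent_composition R T) = descents R T \<and> (descent_composition R T = [] \<longleftrightarrow> R = {})"
  proof (cases "R = {}")
    case True
    then show ?thesis by (auto simp: descent_composition_def compositions_def breaks_def descents_def)
  next
    case False
    have "descents R T \<subseteq> {1..<card R}" by (auto simp: descents_def)
    moreover have "0 < card R" using False assms by (simp add: card_gt_0_iff)
    moreover have "descent_composition R T =
        (let ds = sorted_list_of_set (descents R T) in map2 (-) (ds @ [card R]) (0 # ds))"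
      using False by (simp add: descent_composition_def)
    ultimately show ?thesis using composition_of_breaks False by metis
  qed
  then show "descent_composition R T \<in> compositions" "sum_list (descent_composition R T) = card R"
    "breaks (descent_composition R T) = descents R T" "descent_composition R T = [] \<longleftrightarrow> R = {}"
    by blast+
qed

context crystal_alphabet
begin

text \<open>Equal even letters form a horizontal strip, with at most one node per column, and equal
  odd letters a vertical strip. The tie-breaks therefore compare any two nodes of a semistandard
  filling.\<close>

definition std_less :: "(nat \<times> nat \<Rightarrow> 'a) \<Rightarrow> nat \<times> nat \<Rightarrow> nat \<times> nat \<Rightarrow> bool" where
  "std_less T c d \<longleftrightarrow> \<psi> (T c) < \<psi> (T d) \<or>
     (T c = T d \<and> (if \<psi> (T c) \<in> \<int> then snd c < snd d else fst c < fst d))"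

lemma std_less_asym: "std_less T c d \<Longrightarrow> \<not> std_less T d c"
  unfolding std_less_def by (metis less_asym less_irrefl)

lemma std_less_irrefl: "\<not> std_less T c c"
  by (auto simp: std_less_def)

lemma std_less_trans: "std_less T c d \<Longrightarrow> std_less T d e \<Longrightarrow> std_less T c e"
  by (auto simp: std_less_def split: if_splits)

lemma std_less_total:
  assumes "T \<in> semistandard S D" "c \<in> D" "d \<in> D" "c \<noteq> d"
  shows "std_less T c d \<or> std_less T d c"
proof (cases "T c = T d")
  case True
  have "\<psi> (T c) \<notin> \<int>" if "col_pair c d \<or> col_pair d c"
  proof -
    have "colrel (T c) (T d) \<or> colrel (T d) (T c)" using that assms by (auto simp: semistandard_iff)
    then show ?thesis using True by (auto simp: colrel_def)
  qed
  moreover have "\<psi> (T c) \<in> \<int>" if "row_pair c d \<or> row_pair d c"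
  proof -
    have "rowrel (T c) (T d) \<or> rowrel (T d) (T c)" using that assms by (auto simp: semistandard_iff)
    then show ?thesis using True by (auto simp: rowrel_def)
  qed
  ultimately have "if \<psi> (T c) \<in> \<int> then snd c \<noteq> snd d else fst c \<noteq> fst d"
    using assms(4) unfolding col_pair_def row_pair_def prod_eq_iff by (metis linorder_neq_iff)
  then show ?thesis using True by (cases "\<psi> (T c) \<in> \<int>") (simp_all add: std_less_def linorder_neq_iff)
next
  case False
  then have "\<psi> (T c) \<noteq> \<psi> (T d)" using \<psi>_eq_iff[of "T c" "T d"] assms by (auto simp: semistandard_iff)
  then show ?thesis by (auto simp: std_less_def)
qed

lemma row_pair_std_less:
  assumes "T \<in> semistandard S D" "c \<in> D" "d \<in> D" "row_pair c d"
  shows "std_less T c d"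
proof -
  have "rowrel (T c) (T d)" using assms by (simp add: semistandard_iff)
  then show ?thesis using assms(4) by (auto simp: std_less_def rowrel_def row_pair_def)
qed

lemma col_pair_std_less:
  assumes "T \<in> semistandard S D" "c \<in> D" "d \<in> D" "col_pair c d"
  shows "std_less T c d"
proof -
  have "colrel (T c) (T d)" using assms by (simp add: semistandard_iff)
  then show ?thesis using assms(4) by (auto simp: std_less_def colrel_def col_pair_def)
qed

section \<open>From a standard tableau and a pair filling back to a semistandard filling\<close>

text \<open>The inverse of standardization: \<open>Q\<close> says at which node each ribbon entry is
  placed.\<close>

definition destd :: "nat list \<Rightarrow> nat list \<Rightarrow> nat list \<Rightarrow> (nat \<times> nat \<Rightarrow> nat) \<Rightarrow> (nat \<times> nat \<Rightarrow> 'a) \<Rightarrow> nat \<times> nat \<Rightarrow> 'a" where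
  "destd lam \<mu> \<alpha> Q U c = (if c \<in> young \<mu> then U c
     else if c \<in> young lam then U (node \<mu> \<alpha> (Q c - 1)) else undefined)"

context
  fixes lam \<mu> \<alpha> :: "nat list" and Q U R V T
  assumes lam: "lam \<in> partitions" and C: "(\<mu>, \<alpha>) \<in> pairs_C p"
    and Q: "Q \<in> special_tableaux lam \<mu> \<alpha>" and U: "U \<in> pair_tableaux S \<psi> \<mu> \<alpha>"
  defines "R \<equiv> young lam - young \<mu>" and "V \<equiv> \<lambda>l. U (node \<mu> \<alpha> l)" and "T \<equiv> destd lam \<mu> \<alpha> Q U"
begin

lemma special_facts:
  "young \<mu> \<subseteq> young lam" "Q \<in> extensional R" "bij_betw Q R {1..card R}"
  "\<And>c d. c \<in> R \<Longrightarrow> d \<in> R \<Longrightarrow> row_pair c d \<or> col_pair c d \<Longrightarrow> Q c < Q d"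
  "\<alpha> = descent_composition R Q" "R \<noteq> {} \<Longrightarrow> snd (cell R Q 0) = 0"
proof -
  have *: "young \<mu> \<subseteq> young lam" "Q \<in> extensional R" "bij_betw Q R {1..card R}"
   "\<forall>i j j'. (i, j) \<in> R \<and> (i, j') \<in> R \<and> j < j' \<longrightarrow> Q (i, j) < Q (i, j')"
   "\<forall>i i' j. (i, j) \<in> R \<and> (i', j) \<in> R \<and> i < i' \<longrightarrow> Q (i, j) < Q (i', j)"
   "descent_composition R Q = \<alpha>" "R \<noteq> {} \<longrightarrow> entry_column R Q 1 = 0"
    using Q by (simp_all add: special_tableaux_def standard_tableaux_def skew_nodes_def R_def)
  then show "young \<mu> \<subseteq> young lam" "Q \<in> extensional R" "bij_betw Q R {1..card R}" "\<alpha> = descent_composition R Q"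
    by simp_all
  show "R \<noteq> {} \<Longrightarrow> snd (cell R Q 0) = 0" using * by (simp add: entry_column_def cell_def)
  show "Q c < Q d" if "c \<in> R" "d \<in> R" "row_pair c d \<or> col_pair c d" for c d
    using that *(4,5) by (cases c; cases d) (auto simp: row_pair_def col_pair_def)
qed

lemma finite_R: "finite R"
  using finite_young by (simp add: R_def)

lemma \<alpha>_facts: "\<alpha> \<in> compositions" "sum_list \<alpha> = card R" "breaks \<alpha> = descents R Q" "\<alpha> = [] \<longleftrightarrow> R = {}"
  using descent_composition_breaks[OF finite_R, of Q] by (simp_all flip: special_facts(5))

lemma Q_bounds: "c \<in> R \<Longrightarrow> 1 \<le> Q c \<and> Q c \<le> card R"
proof -
  assume "c \<in> R"
  then have "Q c \<in> Q ` R" by simp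
  then show "1 \<le> Q c \<and> Q c \<le> card R" using special_facts(3) unfolding bij_betw_def by simp
qed

lemma cell_Q: "c \<in> R \<Longrightarrow> cell R Q (Q c - 1) = c"
  using special_facts(3) Q_bounds[of c] inv_into_f_f[of Q R c] by (simp add: cell_def bij_betw_def)

lemma Q_cell: "l < card R \<Longrightarrow> Q (cell R Q l) = Suc l" and cell_in_R: "l < card R \<Longrightarrow> cell R Q l \<in> R"
proof -
  assume "l < card R"
  then have "Suc l \<in> Q ` R" using special_facts(3) by (auto simp: bij_betw_def)
  then show "Q (cell R Q l) = Suc l" "cell R Q l \<in> R" by (simp_all add: cell_def f_inv_into_f inv_into_into)
qed

lemma V_letter: "l < card R \<Longrightarrow> V l \<in> letters S"
  using U nodes_pair_shape_eq[OF \<alpha>_facts(1), of \<mu>] by (auto simp: V_def pair_tableaux_iff[OF C] \<alpha>_facts(2))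

lemma V_compatible: "compatible (breaks \<alpha>) (card R) V"
  using U by (simp add: V_def pair_tableaux_path_iff[OF C] \<alpha>_facts(2))

text \<open>The breaks of the ribbon are the descents of \<open>Q\<close>, and inside a run of equal
  letters either every step is a break or none is. The columns of the run are compared by chaining
  these steps.\<close>

lemma plateau_columns:
  assumes "l < l'" "l' < card R" "V l = V l'"
  shows "if \<psi> (V l) \<in> \<int> then snd (cell R Q l) < snd (cell R Q l') else snd (cell R Q l') \<le> snd (cell R Q l)"
proof -
  have break_iff: "Suc t \<in> descents R Q \<longleftrightarrow> \<psi> (V l) \<notin> \<int>" if "l \<le> t" "t < l'" for t
    using compatible_plateau[OF V_compatible V_letter assms(1,2,3), of "Suc t"] that by (simp add: \<alpha>_facts(3))
  show ?thesis
  proof (cases "\<psi> (V l) \<in> \<int>")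
    case True
    have "snd (cell R Q l) < snd (cell R Q l')"
    proof (rule chain_rel[OF _ _ assms(1), where V = "\<lambda>t. snd (cell R Q t)"])
      show "snd (cell R Q t) < snd (cell R Q (Suc t))" if "l \<le> t" "t < l'" for t
        using break_iff[OF that] True that assms(2) by (auto simp: descents_eq)
    qed (auto intro: transpI)
    then show ?thesis using True by simp
  next
    case False
    have "snd (cell R Q l) \<ge> snd (cell R Q l')"
    proof (rule chain_rel[OF _ _ assms(1), where V = "\<lambda>t. snd (cell R Q t)" and R = "(\<ge>)"])
      show "snd (cell R Q t) \<ge> snd (cell R Q (Suc t))" if "l \<le> t" "t < l'" for t
        using break_iff[OF that] False that assms(2) by (auto simp: descents_eq)
    qed (auto intro: transpI)
    then show ?thesis using False by simp
  qed
qed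

lemma T_young: "c \<in> young \<mu> \<Longrightarrow> T c = U c" and T_R: "c \<in> R \<Longrightarrow> T c = V (Q c - 1)"
  and T_outside: "c \<notin> young lam \<Longrightarrow> T c = undefined"
  using special_facts(1) by (auto simp: T_def destd_def R_def V_def)

lemma young_lam_cases: "c \<in> young lam \<longleftrightarrow> c \<in> young \<mu> \<or> c \<in> R"
  using special_facts(1) by (auto simp: R_def)

text \<open>Skew shapes are convex: the bound from \<open>d\<close> keeps the node inside
  \<open>lam\<close>, the bound from \<open>c\<close> keeps it outside \<open>\<mu>\<close>.\<close>

lemma R_between:
  assumes "c \<in> R" "d \<in> R" "fst c \<le> i" "snd c \<le> j" "i \<le> fst d" "j \<le> snd d"
  shows "(i, j) \<in> R"
proof -
  have "(i, j) \<in> young lam"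
    using young_down_closed[OF lam, of "fst d" "snd d" i j] assms by (simp add: R_def)
  moreover have "(i, j) \<notin> young \<mu>"
    using young_down_closed[OF pairs_C_D(1)[OF C], of i j "fst c" "snd c"] assms by (auto simp: R_def)
  ultimately show ?thesis by (simp add: R_def)
qed

lemma Q_mono:
  assumes "c \<in> R" "d \<in> R" "fst c \<le> fst d" "snd c \<le> snd d"
  shows "Q c \<le> Q d"
proof -
  \<comment> \<open>The path goes along the row of \<open>c\<close> and then down the column of
    \<open>d\<close>; convexity keeps the corner in the skew shape.\<close>
  have m: "(fst c, snd d) \<in> R" using R_between[OF assms(1,2)] assms(3,4) by simp
  have "Q c \<le> Q (fst c, snd d)"
  proof (cases "snd c = snd d")
    case True
    then have "(fst c, snd d) = c" by (simp add: prod_eq_iff)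
    then show ?thesis by simp
  next
    case False
    then show ?thesis using special_facts(4)[OF assms(1) m] assms(4) by (simp add: row_pair_def)
  qed
  also have "\<dots> \<le> Q d"
  proof (cases "fst c = fst d")
    case True
    then have "(fst c, snd d) = d" by (simp add: prod_eq_iff)
    then show ?thesis by simp
  next
    case False
    then show ?thesis using special_facts(4)[OF m assms(2)] assms(3) by (simp add: col_pair_def)
  qed
  finally show ?thesis .
qed

text \<open>The key to recovering \<open>Q\<close> from \<open>T\<close>: the entries of
  \<open>Q\<close> follow the order in which standardization visits the nodes.\<close>

lemma std_less_R:
  assumes "c \<in> R" "d \<in> R" "Q c < Q d"
  shows "std_less T c d"
proof -
  define l l' where "l = Q c - 1" and "l' = Q d - 1"
  have l: "l < l'" "l' < card R" using Q_bounds[OF assms(1)] Q_bounds[OF assms(2)] assms(3) by (auto simp: l_def l'_def)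
  have T: "T c = V l" "T d = V l'" using assms T_R by (simp_all add: l_def l'_def)
  have cells: "cell R Q l = c" "cell R Q l' = d" using cell_Q assms by (simp_all add: l_def l'_def)
  have le: "\<psi> (V l) \<le> \<psi> (V l')" using compatible_mono[OF V_compatible] l by simp
  show ?thesis
  proof (cases "V l = V l'")
    case True
    \<comment> \<open>Otherwise \<open>d\<close> would lie weakly above and weakly to the left of
      \<open>c\<close>, against the order of their entries in \<open>Q\<close>.\<close>
    have "fst c < fst d" if "snd d \<le> snd c"
      using Q_mono[OF assms(2,1)] that assms(3) by (cases "fst d \<le> fst c") auto
    then show ?thesis using plateau_columns[OF l True] True
      by (auto simp: std_less_def T cells split: if_splits)
  next
    case False
    then have "\<psi> (V l) < \<psi> (V l')" using le \<psi>_eq_iff[OF V_letter V_letter, of l l'] l by simp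
    then show ?thesis by (simp add: std_less_def T)
  qed
qed

lemma body_joint: "c \<in> young \<mu> \<Longrightarrow> d \<in> R \<Longrightarrow> colrel (U c) (V 0)"
  using U \<alpha>_facts(4) by (auto simp: pair_tableaux_path_iff[OF C] V_def)

lemma length_\<mu>_eq: "R \<noteq> {} \<Longrightarrow> length \<mu> = p"
  using pairs_C_D(4)[OF C] \<alpha>_facts(4) by simp

lemma first_column_R: "(i, 0) \<in> R \<Longrightarrow> length \<mu> \<le> i"
  using young_first_column[OF pairs_C_D(1)[OF C]] by (auto simp: R_def not_less[symmetric])

text \<open>The first ribbon entry is placed in column 0, by the restriction on the entry 1 of
  \<open>Q\<close>. Inside its run an odd letter moves weakly to the left, so it cannot leave that
  column.\<close>

lemma joint_plateau:
  assumes "d \<in> R" "V 0 = V (Q d - 1)" "\<psi> (V 0) \<notin> \<int>"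
  shows "snd d = 0"
proof (cases "Q d - 1 = 0")
  case True
  have "R \<noteq> {}" using assms(1) by blast
  then show ?thesis using special_facts(6) cell_Q[OF assms(1)] True by simp
next
  case False
  have "Q d - 1 < card R" using Q_bounds[OF assms(1)] by auto
  then have "snd (cell R Q (Q d - 1)) \<le> snd (cell R Q 0)"
    using plateau_columns[of 0 "Q d - 1"] False assms by auto
  moreover have "R \<noteq> {}" using assms(1) by blast
  ultimately show ?thesis using special_facts(6) cell_Q[OF assms(1)] by simp
qed

text \<open>Body entries are bounded by the joint and the joint by all entries on \<open>R\<close>.
  In a tie \<open>d\<close> carries the joint letter, which is then odd and confined to column 0,
  below all rows of the body; this does no harm to rows and is allowed in columns.\<close>

lemma body_less_R:
  assumes "c \<in> young \<mu>" "d \<in> R"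
  shows "\<psi> (T c) < \<psi> (T d) \<or> (T c = T d \<and> \<psi> (T c) \<notin> \<int> \<and> snd d = 0)"
proof -
  have d: "Q d - 1 < card R" using Q_bounds[OF assms(2)] by auto
  then have "\<psi> (V 0) \<le> \<psi> (V (Q d - 1))" using compatible_mono[OF V_compatible, of 0 "Q d - 1"] by simp
  moreover have "\<psi> (V 0) = \<psi> (V (Q d - 1)) \<longleftrightarrow> V 0 = V (Q d - 1)"
    using \<psi>_eq_iff[OF V_letter V_letter[OF d], of 0] d by simp
  ultimately consider "\<psi> (V 0) < \<psi> (V (Q d - 1))" | "V 0 = V (Q d - 1)" by linarith
  then show ?thesis
  proof cases
    case 1
    then have "\<psi> (U c) < \<psi> (V (Q d - 1))" using colrel_le[OF body_joint[OF assms]] by simp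
    then show ?thesis by (simp add: T_young[OF assms(1)] T_R[OF assms(2)])
  next
    case 2
    show ?thesis
      using body_joint[OF assms] joint_plateau[OF assms(2) 2]
      unfolding T_young[OF assms(1)] T_R[OF assms(2)] 2[symmetric] colrel_def by metis
  qed
qed

lemma std_less_body:
  assumes "c \<in> young \<mu>" "d \<in> R"
  shows "std_less T c d"
proof -
  have "fst c < fst d" if "snd d = 0"
    using that first_column_R[of "fst d"] assms by (cases c; cases d) (auto simp: mem_young)
  then show ?thesis using body_less_R[OF assms] by (auto simp: std_less_def)
qed

lemma destd_semistandard: "T \<in> semistandard S (young lam)"
  unfolding semistandard_iff
proof (intro conjI ballI impI)
  have Tl: "T c \<in> letters S" if "c \<in> young lam" for c
  proof (cases "c \<in> young \<mu>")
    case True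
    then show ?thesis using U young_subset_D[OF C True] T_young by (auto simp: pair_tableaux_iff[OF C])
  next
    case False
    then have "c \<in> R" using that by (simp add: R_def)
    then show ?thesis using T_R V_letter[of "Q c - 1"] Q_bounds[of c] by auto
  qed
  then show "T \<in> young lam \<rightarrow>\<^sub>E letters S" using T_outside by (auto intro!: PiE_I)
  have ss: "U \<in> semistandard S (nodes (pair_shape \<mu> \<alpha>))" using U by (simp add: pair_tableaux_def)
  fix c d assume c: "c \<in> young lam" and d: "d \<in> young lam"
  have down: "c \<in> young \<mu>" if "d \<in> young \<mu>" "fst c \<le> fst d" "snd c \<le> snd d"
    using young_down_closed[OF pairs_C_D(1)[OF C], of "fst d" "snd d" "fst c" "snd c"] that by simp
  { assume rp: "row_pair c d"
    show "rowrel (T c) (T d)"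
    proof (cases "d \<in> young \<mu>")
      case True
      then have "c \<in> young \<mu>" using down rp by (simp add: row_pair_def)
      then show ?thesis using True rp ss young_subset_D[OF C] by (simp add: T_young semistandard_iff)
    next
      case False
      then have dR: "d \<in> R" using d by (simp add: R_def)
      show ?thesis
      proof (cases "c \<in> young \<mu>")
        case True
        then show ?thesis using body_less_R[OF True dR] rp by (auto simp: rowrel_def row_pair_def)
      next
        case False
        then have cR: "c \<in> R" using c by (simp add: R_def)
        show ?thesis using std_less_R[OF cR dR special_facts(4)[OF cR dR]] rp
          by (auto simp: std_less_def rowrel_def row_pair_def split: if_splits)
      qed
    qed
  }
  { assume cp: "col_pair c d"
    show "colrel (T c) (T d)"
    proof (cases "d \<in> young \<mu>")
      case True
      then have "c \<in> young \<mu>" using down cp by (simp add: col_pair_def)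
      then show ?thesis using True cp ss young_subset_D[OF C] by (simp add: T_young semistandard_iff)
    next
      case False
      then have dR: "d \<in> R" using d by (simp add: R_def)
      show ?thesis
      proof (cases "c \<in> young \<mu>")
        case True
        then show ?thesis using body_less_R[OF True dR] by (auto simp: colrel_def)
      next
        case False
        then have cR: "c \<in> R" using c by (simp add: R_def)
        show ?thesis using std_less_R[OF cR dR special_facts(4)[OF cR dR]] cp
          by (auto simp: std_less_def colrel_def col_pair_def split: if_splits)
      qed
    qed
  }
qed

text \<open>The rank is computed from \<open>T\<close> and \<open>R\<close> alone, which is the form
  needed for injectivity in \<open>Q\<close>.\<close>

lemma Q_eq_rank:
  assumes "c \<in> R"
  shows "Q c = card {d \<in> R. d = c \<or> std_less T d c}"
proof -
  have iff: "Q d \<le> Q c \<longleftrightarrow> d = c \<or> std_less T d c" if "d \<in> R" for d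
  proof -
    have "Q d = Q c \<longleftrightarrow> d = c" using special_facts(3) that assms by (auto simp: bij_betw_def inj_on_def)
    then show ?thesis
      using std_less_R[OF that assms] std_less_R[OF assms that] std_less_asym[of T c d] by fastforce
  qed
  have "Q ` {d \<in> R. Q d \<le> Q c} = {1..Q c}"
  proof
    show "Q ` {d \<in> R. Q d \<le> Q c} \<subseteq> {1..Q c}" using Q_bounds by auto
    show "{1..Q c} \<subseteq> Q ` {d \<in> R. Q d \<le> Q c}"
    proof
      fix k assume k: "k \<in> {1..Q c}"
      then have "k - 1 < card R" using Q_bounds[OF assms] by auto
      from Q_cell[OF this] cell_in_R[OF this] k show "k \<in> Q ` {d \<in> R. Q d \<le> Q c}"
        by (intro image_eqI[of _ _ "cell R Q (k - 1)"]) auto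
    qed
  qed
  moreover have "inj_on Q {d \<in> R. Q d \<le> Q c}"
    using special_facts(3) by (auto simp: bij_betw_def inj_on_def)
  ultimately have "card {d \<in> R. Q d \<le> Q c} = Q c" by (metis card_atLeastAtMost card_image diff_Suc_1)
  moreover have "{d \<in> R. Q d \<le> Q c} = {d \<in> R. d = c \<or> std_less T d c}" using iff by blast
  ultimately show ?thesis by simp
qed

text \<open>The entry 1 lies in column 0 and must be at the topmost node of \<open>R\<close> there,
  namely \<open>(p, 0)\<close>. All body nodes precede this node and no node of \<open>R\<close>
  does, so \<open>T\<close> alone determines the body.\<close>

lemma body_eq:
  assumes "R \<noteq> {}"
  shows "(p, 0) \<in> R" "young \<mu> = {c \<in> young lam. std_less T c (p, 0)}"
proof -
  have "0 < card R" using assms finite_R by (simp add: card_gt_0_iff)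
  then have c0: "cell R Q 0 \<in> R" "Q (cell R Q 0) = 1" using cell_in_R Q_cell by simp_all
  obtain i where i: "cell R Q 0 = (i, 0)" using special_facts(6)[OF assms] by (cases "cell R Q 0") auto
  have p: "length \<mu> = p" using length_\<mu>_eq[OF assms] .
  have "p \<le> i" using first_column_R c0 i p by simp
  then have "(p, 0) \<in> young lam" using young_down_closed[OF lam, of i 0 p 0] c0 i by (simp add: R_def)
  moreover have "(p, 0) \<notin> young \<mu>" using p by (simp add: mem_young)
  ultimately show z: "(p, 0) \<in> R" by (simp add: R_def)
  have "Q (p, 0) = 1" using Q_mono[OF z c0(1)] \<open>p \<le> i\<close> i c0(2) Q_bounds[OF z] by simp
  then have "c = (p, 0) \<or> std_less T (p, 0) c" if "c \<in> R" for c
    using std_less_R[OF z that] Q_bounds[OF that] cell_Q[OF that] cell_Q[OF z]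
    by (cases "Q c = 1") auto
  then have "\<not> std_less T c (p, 0)" if "c \<in> R" for c
    using that std_less_asym std_less_irrefl by blast
  then show "young \<mu> = {c \<in> young lam. std_less T c (p, 0)}"
    using std_less_body[OF _ z] young_lam_cases by blast
qed

text \<open>Since the size of \<open>lam\<close> decides whether a ribbon is present, two preimages
  of the same filling are of the same type.\<close>

lemma R_empty_iff: "R = {} \<longleftrightarrow> length lam \<le> p"
proof
  assume "R = {}"
  then have "young lam = young \<mu>" using special_facts(1) by (auto simp: R_def)
  then have "lam = \<mu>" using young_inject lam pairs_C_D(1)[OF C] by blast
  then show "length lam \<le> p" using pairs_C_D(3)[OF C] by simp
next
  assume "length lam \<le> p"
  then have "(p, 0) \<notin> R" by (simp add: R_def mem_young)
  then show "R = {}" using body_eq(1) by blast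
qed

lemma U_node: "l < card R \<Longrightarrow> U (node \<mu> \<alpha> l) = T (cell R Q l)"
  using T_R[OF cell_in_R] Q_cell by (simp add: V_def)

end

section \<open>Injectivity and surjectivity of the reconstruction\<close>

lemma destd_inject:
  assumes lam: "lam \<in> partitions"
    and 1: "(\<mu>, \<alpha>) \<in> pairs_C p" "Q \<in> special_tableaux lam \<mu> \<alpha>" "U \<in> pair_tableaux S \<psi> \<mu> \<alpha>"
    and 2: "(\<mu>', \<alpha>') \<in> pairs_C p" "Q' \<in> special_tableaux lam \<mu>' \<alpha>'" "U' \<in> pair_tableaux S \<psi> \<mu>' \<alpha>'"
    and eq: "destd lam \<mu> \<alpha> Q U = destd lam \<mu>' \<alpha>' Q' U'"
  shows "\<mu> = \<mu>' \<and> \<alpha> = \<alpha>' \<and> Q = Q' \<and> U = U'"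
proof -
  define T where "T = destd lam \<mu> \<alpha> Q U"
  define R where "R = young lam - young \<mu>"
  note f1 = special_facts[OF lam 1] and f2 = special_facts[OF lam 2]
  note r1 = R_empty_iff[OF lam 1] and r2 = R_empty_iff[OF lam 2]
  have "young \<mu> = young \<mu>'"
  proof (cases "length lam \<le> p")
    case True
    then show ?thesis using r1 r2 f1(1) f2(1) by blast
  next
    case False
    then show ?thesis using body_eq(2)[OF lam 1] body_eq(2)[OF lam 2] r1 r2 eq by metis
  qed
  then have \<mu>: "\<mu> = \<mu>'" using young_inject pairs_C_D(1)[OF 1(1)] pairs_C_D(1)[OF 2(1)] by blast
  have Q: "Q = Q'"
  proof (rule extensionalityI)
    show "Q \<in> extensional R" "Q' \<in> extensional R" using f1(2) f2(2) \<mu> by (simp_all add: R_def)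
    show "Q c = Q' c" if "c \<in> R" for c
      using Q_eq_rank[OF lam 1, of c] Q_eq_rank[OF lam 2, of c] that eq \<mu> by (simp add: R_def)
  qed
  have \<alpha>: "\<alpha> = \<alpha>'" using f1(5) f2(5) \<mu> Q by simp
  have "U x = U' x" if x: "x \<in> nodes (pair_shape \<mu> \<alpha>)" for x
  proof (cases "x \<in> young \<mu>")
    case True
    then show ?thesis using T_young[OF lam 1, of x] T_young[OF lam 2, of x] eq \<mu> by simp
  next
    case False
    then obtain l where "l < sum_list \<alpha>" "x = node \<mu> \<alpha> l"
      using x nodes_pair_shape_eq[OF pairs_C_D(2)[OF 1(1)], of \<mu>] by auto
    then show ?thesis
      using U_node[OF lam 1, of l] U_node[OF lam 2, of l] \<alpha>_facts(2)[OF lam 1] eq \<mu> \<alpha> Q by simp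
  qed
  moreover have "U \<in> nodes (pair_shape \<mu> \<alpha>) \<rightarrow>\<^sub>E letters S" "U' \<in> nodes (pair_shape \<mu> \<alpha>) \<rightarrow>\<^sub>E letters S"
    using 1(3) 2(3)[folded \<mu> \<alpha>] unfolding pair_tableaux_iff[OF 1(1)] by blast+
  ultimately have "U = U'" by (metis PiE_ext)
  then show ?thesis using \<mu> \<alpha> Q by simp
qed

lemma semistandard_outside: "T \<in> semistandard S D \<Longrightarrow> c \<notin> D \<Longrightarrow> T c = undefined"
  unfolding semistandard_iff by (metis PiE_arb)

text \<open>Without a node in row \<open>p\<close> there is nothing to cut off: the whole filling is
  the body, and the empty skew shape has exactly one tableau.\<close>

lemma destd_surj_short:
  assumes lam: "lam \<in> partitions" and T: "T \<in> semistandard S (young lam)" and len: "length lam \<le> p"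
  obtains Q where "(lam, []) \<in> pairs_C p" "Q \<in> special_tableaux lam lam []" "T \<in> pair_tableaux S \<psi> lam []"
    "T = destd lam lam [] Q T"
proof
  show "(lam, []) \<in> pairs_C p" using lam len by (simp add: pairs_C_def compositions_def)
  show "(\<lambda>_. undefined) \<in> special_tableaux lam lam []"
    by (auto simp: special_tableaux_def standard_tableaux_def skew_nodes_def descent_composition_def bij_betw_def)
  show "T \<in> pair_tableaux S \<psi> lam []" using T by (simp add: pair_tableaux_def young_def)
  show "T = destd lam lam [] (\<lambda>_. undefined) T"
    using semistandard_outside[OF T] by (intro ext) (simp add: destd_def)
qed

lemma destd_surj_long:
  assumes lam: "lam \<in> partitions" and T: "T \<in> semistandard S (young lam)" and len: "p < length lam"
  obtains \<mu> \<alpha> Q U where "(\<mu>, \<alpha>) \<in> pairs_C p" "Q \<in> special_tableaux lam \<mu> \<alpha>"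
    "U \<in> pair_tableaux S \<psi> \<mu> \<alpha>" "T = destd lam \<mu> \<alpha> Q U"
proof -
  define z where "z = (p, 0 :: nat)"
  have z: "z \<in> young lam" using young_first_column[OF lam] len by (simp add: z_def)
  define M where "M = {c \<in> young lam. std_less T c z}"
  \<comment> \<open>The standardization order extends the northwest order on nodes, so the set
    \<open>M\<close> of nodes preceding \<open>z\<close> is an order ideal and hence the diagram of
    a partition.\<close>
  have NW: "std_less T c d" if cd: "d \<in> young lam" "fst c \<le> fst d" "snd c \<le> snd d" "c \<noteq> d" for c d
  proof -
    have m: "(fst c, snd d) \<in> young lam" "c \<in> young lam"
      using young_down_closed[OF lam, of "fst d" "snd d"] cd by (cases c; simp)+
    consider "fst c = fst d" | "snd c = snd d" | "fst c < fst d" "snd c < snd d" using cd by linarith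
    then show ?thesis
    proof cases
      case 1
      then have "row_pair c d" using cd by (auto simp: row_pair_def prod_eq_iff)
      then show ?thesis using row_pair_std_less[OF T m(2) cd(1)] by simp
    next
      case 2
      then have "col_pair c d" using cd by (auto simp: col_pair_def prod_eq_iff)
      then show ?thesis using col_pair_std_less[OF T m(2) cd(1)] by simp
    next
      case 3
      then have "std_less T c (fst c, snd d)" "std_less T (fst c, snd d) d"
        using row_pair_std_less[OF T m(2,1)] col_pair_std_less[OF T m(1) cd(1)]
        by (simp_all add: row_pair_def col_pair_def)
      then show ?thesis by (rule std_less_trans)
    qed
  qed
  have "finite M" using finite_young[of lam] by (simp add: M_def)
  moreover have "(i', j') \<in> M" if M: "(i, j) \<in> M" and le: "i' \<le> i" "j' \<le> j" for i j i' j'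
  proof -
    have "(i', j') \<in> young lam" using young_down_closed[OF lam _ le] M by (simp add: M_def)
    moreover have "(i', j') = (i, j) \<or> std_less T (i', j') (i, j)"
      using NW[of "(i, j)" "(i', j')"] M le by (auto simp: M_def)
    ultimately show ?thesis using M std_less_trans[of T "(i', j')" "(i, j)" z] by (auto simp: M_def)
  qed
  ultimately obtain \<mu> where \<mu>: "\<mu> \<in> partitions" "young \<mu> = M" by (rule down_closed_set_young)
  \<comment> \<open>Column 0 is cut exactly at \<open>z\<close>, so the body has \<open>p\<close>
    rows, as a pair with nonempty ribbon requires.\<close>
  have "i < length \<mu> \<longleftrightarrow> i < p" for i
  proof -
    have "i < length \<mu> \<longleftrightarrow> (i, 0) \<in> M" using young_first_column[OF \<mu>(1)] \<mu>(2) by simp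
    also have "\<dots> \<longleftrightarrow> i < p"
    proof (cases "i < p")
      case True
      then have "(i, 0) \<in> young lam" using young_first_column[OF lam] len by simp
      then show ?thesis using True NW[OF z, of "(i, 0)"] by (simp add: M_def z_def)
    next
      case False
      then have "\<not> std_less T (i, 0) z" if "(i, 0) \<in> young lam"
        using NW[OF that, of z] std_less_asym std_less_irrefl by (cases "i = p") (auto simp: z_def)
      then show ?thesis using False by (auto simp: M_def)
    qed
    finally show ?thesis .
  qed
  then have p: "length \<mu> = p" by (metis linorder_neqE_nat less_irrefl)
  define R where "R = young lam - young \<mu>"
  have fin: "finite R" using finite_young by (simp add: R_def)
  have zR: "z \<in> R" using z std_less_irrefl by (auto simp: R_def \<mu> M_def)
  have R_lam: "c \<in> young lam" if "c \<in> R" for c using that by (simp add: R_def)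
  have total: "c = d \<or> std_less T c d \<or> std_less T d c" if "c \<in> R" "d \<in> R" for c d
    using std_less_total[OF T R_lam[OF that(1)] R_lam[OF that(2)]] by blast
  \<comment> \<open>Counting \<open>c\<close> itself makes the entries start at 1.\<close>
  define rank where "rank c = card {d \<in> R. d = c \<or> std_less T d c}" for c
  have rank_less: "rank c < rank d" if "c \<in> R" "d \<in> R" "std_less T c d" for c d
  proof -
    have "{e \<in> R. e = c \<or> std_less T e c} \<subseteq> {e \<in> R. e = d \<or> std_less T e d}"
      using that(3) by (auto intro: std_less_trans)
    moreover have "d \<noteq> c" "\<not> std_less T d c" using that(3) std_less_asym std_less_irrefl by metis+
    ultimately have "{e \<in> R. e = c \<or> std_less T e c} \<subset> {e \<in> R. e = d \<or> std_less T e d}"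
      using that(2) by blast
    then show ?thesis unfolding rank_def using fin by (intro psubset_card_mono) auto
  qed
  have rank_iff: "rank c < rank d \<longleftrightarrow> std_less T c d" if "c \<in> R" "d \<in> R" for c d
    using rank_less[OF that] rank_less[OF that(2,1)] total[OF that] by fastforce
  define Q where "Q = restrict rank R"
  have Q: "Q c = rank c" if "c \<in> R" for c using that by (simp add: Q_def)
  have "inj_on Q R"
  proof (rule inj_onI)
    fix c d assume "c \<in> R" "d \<in> R" "Q c = Q d"
    then show "c = d" using total[of c d] rank_less[of c d] rank_less[of d c] Q by auto
  qed
  moreover have "Q ` R \<subseteq> {1..card R}"
  proof
    fix k assume "k \<in> Q ` R"
    then obtain c where c: "c \<in> R" "k = rank c" using Q by auto
    have "rank c \<le> card R" unfolding rank_def using fin by (intro card_mono) auto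
    moreover have "c \<in> {d \<in> R. d = c \<or> std_less T d c}" using c(1) by simp
    then have "0 < rank c" unfolding rank_def using fin by (subst card_gt_0_iff) fastforce
    ultimately show "k \<in> {1..card R}" using c(2) by simp
  qed
  ultimately have bij: "bij_betw Q R {1..card R}"
    unfolding bij_betw_def by (metis card_atLeastAtMost card_image card_subset_eq diff_Suc_1 finite_atLeastAtMost)
  define \<alpha> where "\<alpha> = descent_composition R Q"
  note \<alpha> = descent_composition_breaks[OF fin, of Q, folded \<alpha>_def]
  have cell_R: "cell R Q l \<in> R" and Q_cell: "rank (cell R Q l) = Suc l" if "l < card R" for l
  proof -
    have "Suc l \<in> Q ` R" using bij that by (simp add: bij_betw_def)
    then have "cell R Q l \<in> R" "Q (cell R Q l) = Suc l" by (simp_all add: cell_def f_inv_into_f inv_into_into)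
    then show "cell R Q l \<in> R" "rank (cell R Q l) = Suc l" using Q by simp_all
  qed
  have cell_Q: "cell R Q (Q c - 1) = c" and Q_less: "Q c - 1 < card R" if "c \<in> R" for c
  proof -
    have "Q c \<in> {1..card R}" using bij that by (auto simp: bij_betw_def)
    then show "Q c - 1 < card R" by auto
    show "cell R Q (Q c - 1) = c"
      using \<open>Q c \<in> {1..card R}\<close> inv_into_f_f[OF \<open>inj_on Q R\<close> that] by (simp add: cell_def)
  qed
  \<comment> \<open>All nodes preceding \<open>z\<close> went into the body, so \<open>z\<close>
    comes first in \<open>R\<close> and receives the entry 1; this puts the entry 1 into column
    0.\<close>
  have "c = z \<or> std_less T z c" if "c \<in> R" for c
    using total[OF that zR] that by (auto simp: R_def \<mu> M_def)
  then have "{d \<in> R. d = z \<or> std_less T d z} = {z}" using zR std_less_asym by blast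
  then have "rank z = 1" by (simp add: rank_def)
  then have cell_0: "cell R Q 0 = z" using cell_Q[OF zR] Q[OF zR] by simp
  have special: "Q \<in> special_tableaux lam \<mu> \<alpha>"
  proof -
    have "young \<mu> \<subseteq> young lam" by (auto simp: \<mu> M_def)
    moreover have "Q (i, j) < Q (i, j')" if "(i, j) \<in> R" "(i, j') \<in> R" "j < j'" for i j j'
      using that rank_less[OF that(1,2)] row_pair_std_less[OF T R_lam[OF that(1)] R_lam[OF that(2)]]
      by (simp add: row_pair_def Q)
    moreover have "Q (i, j) < Q (i', j)" if "(i, j) \<in> R" "(i', j) \<in> R" "i < i'" for i i' j
      using that rank_less[OF that(1,2)] col_pair_std_less[OF T R_lam[OF that(1)] R_lam[OF that(2)]]
      by (simp add: col_pair_def Q)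
    moreover have "entry_column R Q 1 = 0" using cell_0 by (simp add: entry_column_def cell_def z_def)
    ultimately show ?thesis
      using bij by (simp add: special_tableaux_def standard_tableaux_def skew_nodes_def R_def[symmetric]
        Q_def \<alpha>_def)
  qed
  have C: "(\<mu>, \<alpha>) \<in> pairs_C p" using \<mu>(1) \<alpha>(1) p by (simp add: pairs_C_def)
  \<comment> \<open>The index of \<open>cell\<close> is the ribbon row plus the column, that is, the
    position of the node on the path.\<close>
  define U where "U x = (if x \<in> young \<mu> then T x
     else if x \<in> nodes (pair_shape \<mu> \<alpha>) then T (cell R Q (fst x - length \<mu> + snd x)) else undefined)" for x
  have U_node: "U (node \<mu> \<alpha> l) = T (cell R Q l)" if "l < card R" for l
    using that rowidx_le[OF \<alpha>(1), of l] nodes_pair_shape_eq[OF \<alpha>(1), of \<mu>] node_notin_young[of \<mu> \<alpha> l] \<alpha>(2)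
    by (auto simp: U_def) (simp add: node_def)
  have T_letter: "T c \<in> letters S" if "c \<in> young lam" for c using T that by (auto simp: semistandard_iff)
  have "U \<in> pair_tableaux S \<psi> \<mu> \<alpha>"
    unfolding pair_tableaux_path_iff[OF C]
  proof (intro conjI ballI impI)
    show "U \<in> nodes (pair_shape \<mu> \<alpha>) \<rightarrow>\<^sub>E letters S"
    proof (rule PiE_I)
      fix x assume "x \<in> nodes (pair_shape \<mu> \<alpha>)"
      then consider "x \<in> young \<mu>" | l where "l < card R" "x = node \<mu> \<alpha> l"
        using nodes_pair_shape_eq[OF \<alpha>(1), of \<mu>] \<alpha>(2) by auto
      then show "U x \<in> letters S"
      proof cases
        case 1
        then show ?thesis using T_letter[of x] by (simp add: U_def) (simp add: \<mu> M_def)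
      next
        case 2
        then show ?thesis using U_node T_letter R_lam cell_R by simp
      qed
    next
      fix x assume "x \<notin> nodes (pair_shape \<mu> \<alpha>)"
      then show "U x = undefined" using young_subset_D[OF C, of x] by (auto simp: U_def)
    qed
    have sub: "x \<in> young lam" if "x \<in> young \<mu>" for x using that by (simp add: \<mu> M_def)
    show "rowrel (U x) (U y)" if "x \<in> young \<mu>" "y \<in> young \<mu>" "row_pair x y" for x y
      using T that sub by (simp add: U_def semistandard_iff)
    show "colrel (U x) (U y)" if "x \<in> young \<mu>" "y \<in> young \<mu>" "col_pair x y" for x y
      using T that sub by (simp add: U_def semistandard_iff)
    show "colrel (U x) (U (node \<mu> \<alpha> 0))" if "x \<in> young \<mu>" for x
    proof -
      have "0 < card R" using fin zR by (auto simp: card_gt_0_iff)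
      then have "U (node \<mu> \<alpha> 0) = T z" using U_node cell_0 by simp
      moreover have "std_less T x z" using that by (simp add: \<mu> M_def)
      ultimately show ?thesis using that by (auto simp: U_def std_less_def colrel_def z_def split: if_splits)
    qed
    show "compatible (breaks \<alpha>) (sum_list \<alpha>) (\<lambda>l. U (node \<mu> \<alpha> l))"
      unfolding compatible_def \<alpha>(2)
    proof (intro allI impI)
      fix l assume l: "Suc l < card R"
      define c d where "c = cell R Q l" and "d = cell R Q (Suc l)"
      have cd: "c \<in> R" "d \<in> R" "rank c = Suc l" "rank d = Suc (Suc l)"
        using cell_R Q_cell l by (simp_all add: c_def d_def)
      then have less: "std_less T c d" using rank_iff[of c d] by simp
      have U: "U (node \<mu> \<alpha> l) = T c" "U (node \<mu> \<alpha> (Suc l)) = T d"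
        using U_node l by (simp_all add: c_def d_def)
      have brk: "Suc l \<in> breaks \<alpha> \<longleftrightarrow> snd d \<le> snd c"
        using l by (simp add: \<alpha>(3) descents_eq c_def d_def)
      \<comment> \<open>If \<open>d\<close> lay strictly to the right of \<open>c\<close>, the node
        in the row of \<open>d\<close> and the column of \<open>c\<close> would be squeezed to the
        same odd letter, which cannot repeat in that row.\<close>
      have odd_case: "snd d \<le> snd c" if "T c = T d" "\<psi> (T c) \<notin> \<int>"
      proof (rule ccontr)
        assume "\<not> snd d \<le> snd c"
        moreover have "fst c < fst d" using less that by (simp add: std_less_def)
        ultimately have m: "(fst d, snd c) \<in> young lam"
          and cp: "col_pair c (fst d, snd c)" and rp: "row_pair (fst d, snd c) d"
          using young_down_closed[OF lam, of "fst d" "snd d"] R_lam[OF cd(2)] by (simp_all add: col_pair_def row_pair_def)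
        have "colrel (T c) (T (fst d, snd c))" "rowrel (T (fst d, snd c)) (T d)"
          using T m cp rp R_lam[OF cd(1)] R_lam[OF cd(2)] by (simp_all add: semistandard_iff)
        then show False using that unfolding colrel_def rowrel_def by (metis less_asym less_irrefl)
      qed
      show "if Suc l \<in> breaks \<alpha> then colrel (U (node \<mu> \<alpha> l)) (U (node \<mu> \<alpha> (Suc l)))
          else rowrel (U (node \<mu> \<alpha> l)) (U (node \<mu> \<alpha> (Suc l)))"
        unfolding U brk using less odd_case unfolding std_less_def colrel_def rowrel_def
        by (metis linorder_not_less)
    qed
  qed
  moreover have "T = destd lam \<mu> \<alpha> Q U"
  proof
    fix c
    show "T c = destd lam \<mu> \<alpha> Q U c"
    proof (cases "c \<in> R")
      case True
      then show ?thesis using U_node[OF Q_less[OF True]] cell_Q[OF True] by (simp add: destd_def R_def)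
    next
      case False
      then show ?thesis using semistandard_outside[OF T, of c] by (simp add: destd_def R_def U_def)
    qed
  qed
  ultimately show ?thesis using that C special by blast
qed

lemma standardization_bij:
  assumes lam: "lam \<in> partitions"
  shows "bij_betw (\<lambda>((\<mu>, \<alpha>), (Q, U)). destd lam \<mu> \<alpha> Q U)
    (SIGMA (\<mu>, \<alpha>):pairs_C p. special_tableaux lam \<mu> \<alpha> \<times> pair_tableaux S \<psi> \<mu> \<alpha>)
    (semistandard S (young lam))"
proof (rule bij_betwI')
  fix x y
  assume "x \<in> (SIGMA (\<mu>, \<alpha>):pairs_C p. special_tableaux lam \<mu> \<alpha> \<times> pair_tableaux S \<psi> \<mu> \<alpha>)"
    and "y \<in> (SIGMA (\<mu>, \<alpha>):pairs_C p. special_tableaux lam \<mu> \<alpha> \<times> pair_tableaux S \<psi> \<mu> \<alpha>)"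
  then show "(\<lambda>((\<mu>, \<alpha>), (Q, U)). destd lam \<mu> \<alpha> Q U) x = (\<lambda>((\<mu>, \<alpha>), (Q, U)). destd lam \<mu> \<alpha> Q U) y \<longleftrightarrow> x = y"
    using destd_inject[OF lam] by (auto; blast)
next
  fix x
  assume "x \<in> (SIGMA (\<mu>, \<alpha>):pairs_C p. special_tableaux lam \<mu> \<alpha> \<times> pair_tableaux S \<psi> \<mu> \<alpha>)"
  then show "(\<lambda>((\<mu>, \<alpha>), (Q, U)). destd lam \<mu> \<alpha> Q U) x \<in> semistandard S (young lam)"
    using destd_semistandard[OF lam] by auto
next
  fix T assume T: "T \<in> semistandard S (young lam)"
  obtain \<mu> \<alpha> Q U where "(\<mu>, \<alpha>) \<in> pairs_C p" "Q \<in> special_tableaux lam \<mu> \<alpha>"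
    "U \<in> pair_tableaux S \<psi> \<mu> \<alpha>" "T = destd lam \<mu> \<alpha> Q U"
  proof (cases "length lam \<le> p")
    case True
    from destd_surj_short[OF lam T True] that show ?thesis by metis
  next
    case False
    then have "p < length lam" by simp
    from destd_surj_long[OF lam T this] that show ?thesis by metis
  qed
  then show "\<exists>x\<in>(SIGMA (\<mu>, \<alpha>):pairs_C p. special_tableaux lam \<mu> \<alpha> \<times> pair_tableaux S \<psi> \<mu> \<alpha>).
      T = (\<lambda>((\<mu>, \<alpha>), (Q, U)). destd lam \<mu> \<alpha> Q U) x"
    by (intro bexI[of _ "((\<mu>, \<alpha>), (Q, U))"]) auto
qed

end

section \<open>Independence of the order of the alphabet\<close>

definition diagram :: "(nat \<Rightarrow> nat) \<Rightarrow> (nat \<times> nat) set" where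
  "diagram f = {(i, j). j < f i}"

definition profile :: "(nat \<Rightarrow> nat) \<Rightarrow> bool" where
  "profile f \<longleftrightarrow> antimono f \<and> (\<exists>L. f L = 0)"

text \<open>The shapes left after deleting the largest letter, according to its parity.\<close>

definition strips :: "bool \<Rightarrow> (nat \<Rightarrow> nat) \<Rightarrow> (nat \<Rightarrow> nat) set" where
  "strips od f = {g. antimono g \<and> (\<forall>i. g i \<le> f i \<and> (if od then f i \<le> Suc (g i) else f (Suc i) \<le> g i))}"

text \<open>A filling is a chain of shapes shrinking to the empty one, one strip for each letter.
  The list holds the parities of the letters, the largest letter first.\<close>

fun count_chains :: "bool list \<Rightarrow> (nat \<Rightarrow> nat) \<Rightarrow> nat" where
  "count_chains [] f = of_bool (f = (\<lambda>_. 0))"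
| "count_chains (b # bs) f = (\<Sum>g\<in>strips b f. count_chains bs g)"

lemma profile_zero: "profile f \<Longrightarrow> \<exists>L. \<forall>i\<ge>L. f i = 0"
  unfolding profile_def by (metis antimonoD le_zero_eq)

lemma antimono_SucI: "(\<And>i. f (Suc i) \<le> (f i :: nat)) \<Longrightarrow> antimono f"
  by (rule antimonoI) (rule lift_Suc_antimono_le)

lemma box_image:
  fixes L :: nat
  assumes "\<forall>i\<ge>L. b i = (0 :: nat)" "\<forall>i\<ge>L. a i = 0"
  shows "{g. \<forall>i. a i \<le> g i \<and> g i \<le> b i} = (\<lambda>g i. if i < L then g i else 0) ` (\<Pi>\<^sub>E i\<in>{..<L}. {a i..b i})"
    (is "?A = ?h ` ?B")
proof
  show "?A \<subseteq> ?h ` ?B"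
  proof
    fix g assume g: "g \<in> ?A"
    have "g i = 0" if "i \<ge> L" for i
    proof -
      have "g i \<le> b i" using g by blast
      moreover have "b i = 0" using assms(1) that by blast
      ultimately show ?thesis by simp
    qed
    then have "g = ?h (restrict g {..<L})" by (auto simp: fun_eq_iff)
    moreover have "restrict g {..<L} \<in> ?B" using g by auto
    ultimately show "g \<in> ?h ` ?B" by blast
  qed
  show "?h ` ?B \<subseteq> ?A" using assms by (auto simp: PiE_iff)
qed

lemma card_box:
  fixes L :: nat
  assumes "\<forall>i\<ge>L. b i = (0 :: nat)" "\<forall>i\<ge>L. a i = 0"
  shows "card {g. \<forall>i. a i \<le> g i \<and> g i \<le> b i} = (\<Prod>i<L. Suc (b i) - a i)"
proof -
  have "inj_on (\<lambda>g i. if i < L then g i else 0) (\<Pi>\<^sub>E i\<in>{..<L}. {a i..b i})"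
  proof (rule inj_onI)
    fix g h :: "nat \<Rightarrow> nat"
    assume gh: "g \<in> (\<Pi>\<^sub>E i\<in>{..<L}. {a i..b i})" "h \<in> (\<Pi>\<^sub>E i\<in>{..<L}. {a i..b i})"
      and eq: "(\<lambda>i. if i < L then g i else 0) = (\<lambda>i. if i < L then h i else 0)"
    have "g i = h i" if "i \<in> {..<L}" for i using fun_cong[OF eq, of i] that by simp
    then show "g = h" by (rule PiE_ext[OF gh])
  qed
  then show ?thesis by (simp add: box_image[OF assms] card_image card_PiE)
qed

lemma finite_below: "profile f \<Longrightarrow> finite {g :: nat \<Rightarrow> nat. \<forall>i. g i \<le> f i}"
proof -
  assume "profile f"
  then obtain L where "\<forall>i\<ge>L. f i = 0" using profile_zero by blast
  then have "{g. \<forall>i. 0 \<le> g i \<and> g i \<le> f i} = (\<lambda>g i. if i < L then g i else 0) ` (\<Pi>\<^sub>E i\<in>{..<L}. {0..f i})"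
    by (intro box_image) auto
  then show ?thesis by (simp add: finite_PiE)
qed

lemma strips_profile: "profile f \<Longrightarrow> g \<in> strips od f \<Longrightarrow> profile g"
  unfolding profile_def strips_def by (auto, metis le_zero_eq)

lemma finite_strips: "profile f \<Longrightarrow> finite (strips od f)"
  by (rule finite_subset[OF _ finite_below[of f]]) (auto simp: strips_def)

text \<open>
  Both counts are products of lengths of intervals, one for each row. Row by row the lengths
  agree up to a factor 2 passed from one row to the next.
\<close>

lemma card_strips_swap:
  assumes f: "profile f" and h: "profile h"
  shows "card {g \<in> strips True f. h \<in> strips False g} = card {g \<in> strips False f. h \<in> strips True g}"
proof -
  obtain L1 L2 where L12: "\<forall>i\<ge>L1. f i = 0" "\<forall>i\<ge>L2. h i = 0"
    using profile_zero[OF f] profile_zero[OF h] by blast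
  define L where "L = max L1 L2"
  have L: "f i = 0" "h i = 0" if "i \<ge> L" for i using L12 that by (auto simp: L_def)
  have fS: "f (Suc i) \<le> f i" and hS: "h (Suc i) \<le> h i" for i
    using f h by (auto simp: profile_def antimono_def)
  \<comment> \<open>The upper bound for row \<open>i\<close> of the intermediate shape: besides
    \<open>f i\<close>, the horizontal strip bounds it by the row of \<open>h\<close> above, which
    exists for positive \<open>i\<close> only.\<close>
  define u where "u i = (case i of 0 \<Rightarrow> f 0 | Suc k \<Rightarrow> min (f i) (h k))" for i
  \<comment> \<open>Here and in \<open>y\<close>, truncated subtraction gives the length 0 to an
    empty interval.\<close>
  define x where "x i = Suc (u i) - max (h i) (f i - 1)" for i
  define y where "y i = Suc (min (f i) (Suc (h i))) - max (h i) (f (Suc i))" for i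
  have "{g \<in> strips True f. h \<in> strips False g} = {g. \<forall>i. max (h i) (f i - 1) \<le> g i \<and> g i \<le> u i}"
  proof (intro set_eqI iffI)
    fix g assume g: "g \<in> {g \<in> strips True f. h \<in> strips False g}"
    show "g \<in> {g. \<forall>i. max (h i) (f i - 1) \<le> g i \<and> g i \<le> u i}"
    proof (intro CollectI allI)
      fix i
      have "g i \<le> f i" "f i \<le> Suc (g i)" "h i \<le> g i" using g by (auto simp: strips_def)
      moreover have "g (Suc k) \<le> h k" for k using g by (auto simp: strips_def)
      ultimately show "max (h i) (f i - 1) \<le> g i \<and> g i \<le> u i" by (cases i) (auto simp: u_def)
    qed
  next
    fix g assume "g \<in> {g. \<forall>i. max (h i) (f i - 1) \<le> g i \<and> g i \<le> u i}"
    then have g: "max (h i) (f i - 1) \<le> g i" "g i \<le> u i" for i by auto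
    have up: "g i \<le> f i" "g (Suc i) \<le> h i" for i using g(2)[of i] g(2)[of "Suc i"] by (auto simp: u_def split: nat.splits)
    have lo: "h i \<le> g i" "f i \<le> Suc (g i)" for i using g(1)[of i] by auto
    have "antimono g" by (rule antimono_SucI) (use up lo order_trans in blast)
    then show "g \<in> {g \<in> strips True f. h \<in> strips False g}" using up lo h by (auto simp: strips_def profile_def)
  qed
  then have lhs: "card {g \<in> strips True f. h \<in> strips False g} = (\<Prod>i<L. x i)"
    unfolding x_def using L by (subst card_box[symmetric]) (auto simp: u_def split: nat.splits)
  have "{g \<in> strips False f. h \<in> strips True g} = {g. \<forall>i. max (h i) (f (Suc i)) \<le> g i \<and> g i \<le> min (f i) (Suc (h i))}"
  proof (intro set_eqI iffI)
    fix g assume "g \<in> {g \<in> strips False f. h \<in> strips True g}"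
    then show "g \<in> {g. \<forall>i. max (h i) (f (Suc i)) \<le> g i \<and> g i \<le> min (f i) (Suc (h i))}"
      by (auto simp: strips_def)
  next
    fix g assume g: "g \<in> {g. \<forall>i. max (h i) (f (Suc i)) \<le> g i \<and> g i \<le> min (f i) (Suc (h i))}"
    have "g (Suc i) \<le> g i" for i
    proof -
      have "g (Suc i) \<le> f (Suc i)" "f (Suc i) \<le> g i" using g by auto
      then show ?thesis by simp
    qed
    then have "antimono g" by (rule antimono_SucI)
    then show "g \<in> {g \<in> strips False f. h \<in> strips True g}" using g h by (auto simp: strips_def profile_def)
  qed
  then have rhs: "card {g \<in> strips False f. h \<in> strips True g} = (\<Prod>i<L. y i)"
    unfolding y_def using L by (subst card_box[symmetric]) auto
  have "(\<Prod>i<L. x i) = (\<Prod>i<L. y i)"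
  \<comment> \<open>When \<open>h\<close> violates these bounds there is no intermediate shape and
    both products have a zero factor, possibly in neighbouring rows.\<close>
  proof (cases "\<forall>i. h i \<le> f i \<and> f (Suc i) \<le> Suc (h i)")
    case False
    then consider i where "f i < h i" | i where "Suc (h i) < f (Suc i)" by (auto simp: not_le)
    then show ?thesis
    proof cases
      case 1
      then have "i < L" using L[of i] by (cases "i < L") auto
      moreover have "x i = 0" "y i = 0" using 1 by (auto simp: x_def y_def u_def split: nat.splits)
      ultimately show ?thesis by (metis finite_lessThan lessThan_iff prod_zero_iff)
    next
      case 2
      then have "Suc i < L" using L[of "Suc i"] by (cases "Suc i < L") auto
      moreover have "x (Suc i) = 0" "y i = 0" using 2 by (auto simp: x_def y_def u_def)
      ultimately have zero: "(\<Prod>i<L. x i) = 0" "(\<Prod>i<L. y i) = 0"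
        by (auto intro: bexI[of _ i] bexI[of _ "Suc i"])
      show ?thesis by (simp only: zero)
    qed
  next
    case True
    then have le: "h i \<le> f i" "f (Suc i) \<le> Suc (h i)" for i by auto
    \<comment> \<open>The correction is 2 where \<open>f (Suc k) = Suc (h k)\<close>. Then one
      choice is lost: in the first product in row \<open>Suc k\<close>, where the upper bound drops
      to \<open>h k\<close>, and in the second in row \<open>k\<close>, where the lower bound rises
      to \<open>Suc (h k)\<close>. Corrected, every row has 2 choices or 1 according to
      \<open>h i < f i\<close>.\<close>
    define \<gamma> :: "nat \<Rightarrow> nat" where "\<gamma> i = (case i of 0 \<Rightarrow> 1 | Suc k \<Rightarrow> if f i = Suc (h k) then 2 else 1)" for i
    have x: "x i * \<gamma> i = (if h i < f i then 2 else 1)" for i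
    proof (cases i)
      case 0
      then show ?thesis using le(1)[of 0] by (auto simp: x_def u_def \<gamma>_def max_def)
    next
      case (Suc k)
      then show ?thesis using le(1)[of i] le(2)[of k] hS[of k] by (auto simp: x_def u_def \<gamma>_def max_def min_def)
    qed
    have y: "y i * \<gamma> (Suc i) = (if h i < f i then 2 else 1)" for i
      using le(1)[of i] le(2)[of i] fS[of i] by (auto simp: y_def \<gamma>_def max_def min_def)
    have "\<gamma> L = 1" using L[of L] by (cases L) (auto simp: \<gamma>_def)
    moreover have "\<gamma> 0 = 1" by (simp add: \<gamma>_def)
    ultimately have \<gamma>: "(\<Prod>i<L. \<gamma> (Suc i)) = (\<Prod>i<L. \<gamma> i)"
      using prod.lessThan_Suc_shift[of \<gamma> L] by simp
    have "(\<Prod>i<L. x i) * (\<Prod>i<L. \<gamma> i) = (\<Prod>i<L. y i) * (\<Prod>i<L. \<gamma> (Suc i))"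
      by (simp add: x y flip: prod.distrib)
    moreover have "(\<Prod>i<L. \<gamma> i) \<noteq> 0" by (auto simp: \<gamma>_def split: nat.splits)
    ultimately show ?thesis unfolding \<gamma> by simp
  qed
  then show ?thesis using lhs rhs by simp
qed

lemma chains_swap:
  assumes f: "profile f"
  shows "count_chains (a # b # bs) f = count_chains (b # a # bs) f"
proof -
  \<comment> \<open>A finite range for the shape after two deletions that does not depend on the
    intermediate shape, so that the two sums can be interchanged.\<close>
  define H where "H = {h. profile h \<and> (\<forall>i. h i \<le> f i)}"
  have "finite H" by (rule finite_subset[OF _ finite_below[OF f]]) (auto simp: H_def)
  have sub: "strips b g \<subseteq> H" if "g \<in> strips a f" for a b g
  proof
    fix h assume "h \<in> strips b g"
    moreover have "profile g" using strips_profile[OF f that] .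
    ultimately have "profile h" "\<forall>i. h i \<le> g i" "\<forall>i. g i \<le> f i"
      using strips_profile that by (auto simp: strips_def)
    then show "h \<in> H" unfolding H_def using order_trans by blast
  qed
  have expand: "count_chains (a # b # bs) f = (\<Sum>h\<in>H. card {g \<in> strips a f. h \<in> strips b g} * count_chains bs h)" for a b
  proof -
    have "count_chains (a # b # bs) f = (\<Sum>g\<in>strips a f. \<Sum>h\<in>H. if h \<in> strips b g then count_chains bs h else 0)"
      unfolding count_chains.simps
      by (intro sum.cong refl sum.mono_neutral_cong_left \<open>finite H\<close> sub) auto
    also have "\<dots> = (\<Sum>h\<in>H. \<Sum>g\<in>strips a f. if h \<in> strips b g then count_chains bs h else 0)" by (rule sum.swap)
    also have "\<dots> = (\<Sum>h\<in>H. card {g \<in> strips a f. h \<in> strips b g} * count_chains bs h)"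
      using finite_strips[OF f] by (intro sum.cong) (auto simp: sum.inter_filter[symmetric])
    finally show ?thesis .
  qed
  have "card {g \<in> strips a f. h \<in> strips b g} = card {g \<in> strips b f. h \<in> strips a g}" if "h \<in> H" for h
    using card_strips_swap[OF f, of h] that by (cases a; cases b) (auto simp: H_def)
  then show ?thesis unfolding expand by simp
qed

text \<open>Insertion is a sequence of adjacent exchanges, so every list of parities can be compared
  with its sorted version.\<close>

lemma chains_insort: "profile f \<Longrightarrow> count_chains (insort b bs) f = count_chains (b # bs) f"
proof (induction bs arbitrary: f)
  case (Cons c bs)
  show ?case
  proof (cases "b \<le> c")
    case False
    have "count_chains (insort b (c # bs)) f = count_chains (c # b # bs) f"
      using False Cons.IH strips_profile[OF Cons.prems] by simp
    then show ?thesis using chains_swap[OF Cons.prems] by simp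
  qed simp
qed simp

lemma chains_sort: "profile f \<Longrightarrow> count_chains (sort bs) f = count_chains bs f"
proof (induction bs arbitrary: f)
  case (Cons b bs)
  have "count_chains (sort (b # bs)) f = count_chains (b # sort bs) f" using chains_insort[OF Cons.prems] by simp
  also have "\<dots> = count_chains (b # bs) f" using Cons.IH strips_profile[OF Cons.prems] by simp
  finally show ?case .
qed simp

lemma chains_cong: "profile f \<Longrightarrow> mset bs = mset cs \<Longrightarrow> count_chains bs f = count_chains cs f"
  using chains_sort[of f bs] chains_sort[of f cs] by (metis properties_for_sort mset_sort sorted_sort)

section \<open>Fillings as chains of shapes\<close>

definition add_strip :: "'a \<Rightarrow> (nat \<Rightarrow> nat) \<Rightarrow> (nat \<Rightarrow> nat) \<Rightarrow> (nat \<times> nat \<Rightarrow> 'a) \<Rightarrow> nat \<times> nat \<Rightarrow> 'a" where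
  "add_strip z f g T = (\<lambda>c. if c \<in> diagram g then T c else if c \<in> diagram f then z else undefined)"

text \<open>Nothing exceeds the largest letter, so the nodes carrying it form the ends of rows and
  columns and deleting them leaves a diagram. The parity decides whether they may repeat in rows or
  in columns, which is the condition in \<open>strips\<close>.\<close>

lemma semistandard_step:
  assumes z: "z \<in> letters S" "\<And>c. c \<in> letters S \<Longrightarrow> c \<noteq> z \<Longrightarrow> lt S c z \<and> \<not> lt S z c" "\<not> lt S z z"
    and f: "profile f"
  defines "S' \<equiv> S\<lparr>letters := letters S - {z}\<rparr>"
  shows "card (semistandard S (diagram f)) =
    card (SIGMA g:strips (odd_letter S z) f. semistandard S' (diagram g))"
proof -
  have fS: "f i' \<le> f i" if "i \<le> i'" for i i' using f that by (auto simp: profile_def antimono_def)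
  have "bij_betw (\<lambda>(g, T). add_strip z f g T) (SIGMA g:strips (odd_letter S z) f. semistandard S' (diagram g))
    (semistandard S (diagram f))"
  proof (rule bij_betwI')
    fix x y
    assume x: "x \<in> (SIGMA g:strips (odd_letter S z) f. semistandard S' (diagram g))"
      and y: "y \<in> (SIGMA g:strips (odd_letter S z) f. semistandard S' (diagram g))"
    show "(\<lambda>(g, T). add_strip z f g T) x = (\<lambda>(g, T). add_strip z f g T) y \<longleftrightarrow> x = y"
    proof
      obtain g T g' T' where xy: "x = (g, T)" "y = (g', T')" by (cases x; cases y)
      assume "(\<lambda>(g, T). add_strip z f g T) x = (\<lambda>(g, T). add_strip z f g T) y"
      then have eq: "add_strip z f g T = add_strip z f g' T'" by (simp add: xy)
      have diag: "c \<in> diagram g \<longleftrightarrow> c \<in> diagram f \<and> add_strip z f g T c \<noteq> z"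
        if "(g, T) \<in> (SIGMA g:strips (odd_letter S z) f. semistandard S' (diagram g))" for g T c
      proof -
        have "T c \<noteq> z" if "c \<in> diagram g" for c
          using that \<open>(g, T) \<in> _\<close> by (auto simp: semistandard_def S'_def)
        moreover have "c \<in> diagram f" if "c \<in> diagram g"
          using that \<open>(g, T) \<in> _\<close> by (cases c) (auto simp: strips_def diagram_def intro: less_le_trans)
        ultimately show ?thesis by (auto simp: add_strip_def)
      qed
      have d: "c \<in> diagram g \<longleftrightarrow> c \<in> diagram g'" for c
        using diag[of g T c] diag[of g' T' c] x y eq by (simp add: xy)
      have "j < g i \<longleftrightarrow> j < g' i" for i j using d[of "(i, j)"] by (simp add: diagram_def)
      then have g: "g = g'" by (intro ext) (metis linorder_neqE_nat less_irrefl)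
      have "T c = T' c" if "c \<in> diagram g" for c
        using fun_cong[OF eq, of c] that d by (simp add: add_strip_def)
      moreover have "T \<in> diagram g \<rightarrow>\<^sub>E letters S'" "T' \<in> diagram g \<rightarrow>\<^sub>E letters S'"
        using x y g by (auto simp: xy semistandard_def)
      ultimately have "T = T'" by (metis PiE_ext)
      then show "x = y" using g by (simp add: xy)
    qed simp
  next
    fix x assume "x \<in> (SIGMA g:strips (odd_letter S z) f. semistandard S' (diagram g))"
    then obtain g T where x: "x = (g, T)" and g: "g \<in> strips (odd_letter S z) f"
      and T: "T \<in> semistandard S' (diagram g)" by auto
    have gf: "g i \<le> f i" "antimono g" for i using g by (auto simp: strips_def)
    have Tl: "T c \<in> letters S" "T c \<noteq> z" if "c \<in> diagram g" for c
      using T that by (auto simp: semistandard_def S'_def)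
    have gS: "g i' \<le> g i" if "i \<le> i'" for i i' using gf(2) that by (auto simp: antimono_def)
    have sub: "diagram g \<subseteq> diagram f" using gf(1) by (auto simp: diagram_def intro: less_le_trans)
    let ?T = "add_strip z f g T"
    have "?T \<in> diagram f \<rightarrow>\<^sub>E letters S"
      using Tl z(1) sub by (intro PiE_I) (auto simp: add_strip_def)
    moreover have "lt S (?T (i, j)) (?T (i, j')) \<or> (?T (i, j) = ?T (i, j') \<and> \<not> odd_letter S (?T (i, j)))"
      if ij: "(i, j) \<in> diagram f" "(i, j') \<in> diagram f" "j < j'" for i j j'
    proof (cases "(i, j') \<in> diagram g")
      case True
      then have "(i, j) \<in> diagram g" using ij(3) by (simp add: diagram_def)
      then show ?thesis using True T ij(3) by (auto simp: add_strip_def semistandard_def S'_def)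
    next
      case False
      show ?thesis
      proof (cases "(i, j) \<in> diagram g")
        case True
        then show ?thesis using False ij Tl z(2) by (auto simp: add_strip_def)
      next
        case F: False
        have "\<not> odd_letter S z"
        proof
          assume "odd_letter S z"
          then have "f i \<le> Suc (g i)" using g by (auto simp: strips_def)
          then show False using F ij by (auto simp: diagram_def)
        qed
        then show ?thesis using F False ij by (simp add: add_strip_def)
      qed
    qed
    moreover have "lt S (?T (i, j)) (?T (i', j)) \<or> (?T (i, j) = ?T (i', j) \<and> odd_letter S (?T (i, j)))"
      if ij: "(i, j) \<in> diagram f" "(i', j) \<in> diagram f" "i < i'" for i i' j
    proof (cases "(i', j) \<in> diagram g")
      case True
      then have "(i, j) \<in> diagram g" using ij(3) gS[of i i'] by (simp add: diagram_def)
      then show ?thesis using True T ij(3) by (auto simp: add_strip_def semistandard_def S'_def)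
    next
      case False
      show ?thesis
      proof (cases "(i, j) \<in> diagram g")
        case True
        then show ?thesis using False ij Tl z(2) by (auto simp: add_strip_def)
      next
        case F: False
        have "odd_letter S z"
        proof (rule ccontr)
          assume "\<not> odd_letter S z"
          then have "f (Suc i) \<le> g i" using g by (auto simp: strips_def)
          then show False using F ij fS[of "Suc i" i'] by (auto simp: diagram_def)
        qed
        then show ?thesis using F False ij by (simp add: add_strip_def)
      qed
    qed
    ultimately show "(\<lambda>(g, T). add_strip z f g T) x \<in> semistandard S (diagram f)"
      by (auto simp: x semistandard_def)
  next
    fix T assume T: "T \<in> semistandard S (diagram f)"
    have Tl: "T c \<in> letters S" if "c \<in> diagram f" for c using T that by (auto simp: semistandard_def)
    have row: "T (i, j) = T (i, j') \<and> \<not> odd_letter S (T (i, j))"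
      if "j < j'" "j' < f i" "T (i, j) = z" for i j j'
    proof -
      have "(i, j) \<in> diagram f" "(i, j') \<in> diagram f" using that by (auto simp: diagram_def)
      then have "lt S (T (i, j)) (T (i, j')) \<or> (T (i, j) = T (i, j') \<and> \<not> odd_letter S (T (i, j)))" "T (i, j') \<in> letters S"
        using T that(1) Tl unfolding semistandard_def by blast+
      then show ?thesis using z(2,3) that(3) by metis
    qed
    have col: "T (i, j) = T (i', j) \<and> odd_letter S (T (i, j))"
      if "i < i'" "j < f i'" "T (i, j) = z" for i i' j
    proof -
      have "(i, j) \<in> diagram f" "(i', j) \<in> diagram f" using that fS[of i i'] by (auto simp: diagram_def)
      then have "lt S (T (i, j)) (T (i', j)) \<or> (T (i, j) = T (i', j) \<and> odd_letter S (T (i, j)))" "T (i', j) \<in> letters S"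
        using T that(1) Tl unfolding semistandard_def by blast+
      then show ?thesis using z(2,3) that(3) by metis
    qed
    \<comment> \<open>In each row only \<open>z\<close> can follow \<open>z\<close>, so the nodes
      with other letters form an initial segment, of which this is the length.\<close>
    define g where "g i = card {j. j < f i \<and> T (i, j) \<noteq> z}" for i
    have g: "j < g i \<longleftrightarrow> j < f i \<and> T (i, j) \<noteq> z" for i j
    proof -
      have "j' \<in> {j. j < f i \<and> T (i, j) \<noteq> z}" if "j \<in> {j. j < f i \<and> T (i, j) \<noteq> z}" "j' \<le> j" for j j'
        using that row[of j' j i] by (cases "j' = j") auto
      then show ?thesis
        using down_closed_nat_set[of "{j. j < f i \<and> T (i, j) \<noteq> z}" j] by (auto simp: g_def)
    qed
    have gf: "g i \<le> f i" for i using g[of "f i" i] by simp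
    have "antimono g"
    proof (rule antimono_SucI)
      fix i
      show "g (Suc i) \<le> g i"
      proof (rule ccontr)
        assume "\<not> g (Suc i) \<le> g i"
        then have "g i < g (Suc i)" by simp
        then have "g i < f (Suc i)" "T (Suc i, g i) \<noteq> z" using g[of "g i" "Suc i"] by auto
        moreover from this have "T (i, g i) = z" using g[of "g i" i] fS[of i "Suc i"] by auto
        ultimately show False using col[of i "Suc i" "g i"] by simp
      qed
    qed
    moreover have "f i \<le> Suc (g i)" if "odd_letter S z" for i
    proof (rule ccontr)
      assume "\<not> f i \<le> Suc (g i)"
      then have "Suc (g i) < f i" by simp
      moreover from this have "T (i, g i) = z" using g[of "g i" i] by auto
      ultimately show False using row[of "g i" "Suc (g i)" i] that by simp
    qed
    moreover have "f (Suc i) \<le> g i" if "\<not> odd_letter S z" for i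
    proof (rule ccontr)
      assume "\<not> f (Suc i) \<le> g i"
      then have "g i < f (Suc i)" by simp
      moreover from this have "T (i, g i) = z" using g[of "g i" i] fS[of i "Suc i"] by auto
      ultimately show False using col[of i "Suc i" "g i"] that by simp
    qed
    ultimately have g_strip: "g \<in> strips (odd_letter S z) f" using gf by (auto simp: strips_def)
    have dg: "c \<in> diagram g \<longleftrightarrow> c \<in> diagram f \<and> T c \<noteq> z" for c
      by (cases c) (simp add: diagram_def g)
    have "restrict T (diagram g) \<in> semistandard S' (diagram g)"
      using T dg by (auto simp: semistandard_def S'_def)
    moreover have "T = add_strip z f g (restrict T (diagram g))"
    proof
      fix c
      have "T c = undefined" if "c \<notin> diagram f"
        using T that by (metis (no_types, lifting) PiE_arb mem_Collect_eq semistandard_def)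
      then show "T c = add_strip z f g (restrict T (diagram g)) c"
        using dg[of c] by (auto simp: add_strip_def)
    qed
    ultimately show "\<exists>x\<in>(SIGMA g:strips (odd_letter S z) f. semistandard S' (diagram g)).
        T = (\<lambda>(g, T). add_strip z f g T) x"
      using g_strip by (intro bexI[of _ "(g, restrict T (diagram g))"]) auto
  qed
  then show ?thesis by (simp add: bij_betw_same_card)
qed

lemma finite_diagram: "profile f \<Longrightarrow> finite (diagram f)"
proof -
  assume "profile f"
  then obtain L where L: "\<forall>i\<ge>L. f i = 0" using profile_zero by blast
  have "diagram f \<subseteq> (SIGMA i:{..<L}. {..<f i})" using L by (auto simp: diagram_def) (metis not_le not_less0)
  then show ?thesis by (rule finite_subset) auto
qed

lemma finite_semistandard: "finite (letters S) \<Longrightarrow> finite D \<Longrightarrow> finite (semistandard S D)"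
  by (rule finite_subset[OF _ finite_PiE[of D "\<lambda>_. letters S"]]) (auto simp: semistandard_def)

text \<open>Chains are built by deleting the largest letter first, hence the \<open>rev\<close> and
  the induction from the end of the increasing list.\<close>

lemma card_semistandard_chains:
  assumes "distinct xs" "set xs = letters S" "sorted_wrt (lt S) xs" "profile f"
    and "\<And>c d. c \<in> letters S \<Longrightarrow> d \<in> letters S \<Longrightarrow> lt S c d \<Longrightarrow> \<not> lt S d c"
  shows "card (semistandard S (diagram f)) = count_chains (rev (map (odd_letter S) xs)) f"
  using assms
proof (induction xs arbitrary: S f rule: rev_induct)
  case Nil
  have empty: "diagram f = {} \<longleftrightarrow> f = (\<lambda>_. 0)"
    by (auto simp: diagram_def fun_eq_iff)
  show ?case
  proof (cases "diagram f = {}")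
    case True
    then have "semistandard S (diagram f) = {\<lambda>_. undefined}" by (auto simp: semistandard_def)
    then show ?thesis using True empty by simp
  next
    case False
    then have "semistandard S (diagram f) = {}" using Nil.prems(2) by (auto simp: semistandard_def PiE_eq_empty_iff)
    then show ?thesis using False empty by simp
  qed
next
  case (snoc z xs)
  define S' where "S' = S\<lparr>letters := letters S - {z}\<rparr>"
  have zl: "z \<in> letters S" using snoc.prems(2) by auto
  have z: "lt S c z \<and> \<not> lt S z c" if "c \<in> letters S" "c \<noteq> z" for c
  proof -
    have "lt S c z" using snoc.prems(2,3) that by (auto simp: sorted_wrt_append)
    then show ?thesis using snoc.prems(5)[OF that(1) zl] by blast
  qed
  have irr: "\<not> lt S z z" using snoc.prems(5)[OF zl zl] by blast
  have IH: "card (semistandard S' (diagram g)) = count_chains (rev (map (odd_letter S) xs)) g"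
    if "g \<in> strips (odd_letter S z) f" for g
  proof -
    have "card (semistandard S' (diagram g)) = count_chains (rev (map (odd_letter S') xs)) g"
    proof (rule snoc.IH)
      show "set xs = letters S'" using snoc.prems(1,2) by (auto simp: S'_def)
      show "profile g" using strips_profile[OF snoc.prems(4) that] .
    qed (use snoc.prems in \<open>auto simp: S'_def sorted_wrt_append\<close>)
    then show ?thesis by (simp add: S'_def)
  qed
  have fin: "finite (semistandard S' (diagram g))" if "g \<in> strips (odd_letter S z) f" for g
  proof (rule finite_semistandard)
    show "finite (letters S')" using snoc.prems(2) unfolding S'_def by (metis List.finite_set finite_Diff alphabet.simps(1) alphabet.simps(7) alphabet.surjective alphabet.update_convs(1))
    show "finite (diagram g)" using finite_diagram strips_profile[OF snoc.prems(4) that] by blast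
  qed
  have "card (semistandard S (diagram f)) =
    card (SIGMA g:strips (odd_letter S z) f. semistandard S' (diagram g))"
    unfolding S'_def using z irr zl snoc.prems(4) by (intro semistandard_step) auto
  also have "\<dots> = (\<Sum>g\<in>strips (odd_letter S z) f. card (semistandard S' (diagram g)))"
    using finite_strips[OF snoc.prems(4)] fin by (intro card_SigmaI) auto
  also have "\<dots> = (\<Sum>g\<in>strips (odd_letter S z) f. count_chains (rev (map (odd_letter S) xs)) g)"
    using IH by simp
  finally show ?case by simp
qed

lemma ex_sorted_letters:
  fixes \<kappa> :: "'a \<Rightarrow> 'b :: linorder"
  assumes "finite (letters S)" "inj_on \<kappa> (letters S)"
    and lt: "\<And>c d. c \<in> letters S \<Longrightarrow> d \<in> letters S \<Longrightarrow> lt S c d \<longleftrightarrow> \<kappa> c < \<kappa> d"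
  shows "\<exists>xs. distinct xs \<and> set xs = letters S \<and> sorted_wrt (lt S) xs"
proof -
  define ys where "ys = sorted_list_of_set (\<kappa> ` letters S)"
  define xs where "xs = map (inv_into (letters S) \<kappa>) ys"
  have ys: "set ys = \<kappa> ` letters S" "sorted_wrt (<) ys" "distinct ys" using assms(1) by (simp_all add: ys_def)
  have "map \<kappa> xs = ys" unfolding xs_def map_map
    by (rule map_idI) (simp add: ys(1) f_inv_into_f)
  have "set xs = letters S"
    using ys(1) assms(2) by (simp add: xs_def image_image)
  moreover have "distinct xs" using \<open>map \<kappa> xs = ys\<close> ys(3) by (metis distinct_map)
  moreover have "sorted_wrt (\<lambda>c d. \<kappa> c < \<kappa> d) xs"
    using ys(2) by (simp flip: \<open>map \<kappa> xs = ys\<close> add: sorted_wrt_map)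
  then have "sorted_wrt (lt S) xs"
    by (rule sorted_wrt_mono_rel[rotated]) (use lt \<open>set xs = letters S\<close> in auto)
  ultimately show ?thesis by blast
qed

lemma young_eq_diagram: "young lam = diagram (part lam)"
  by (auto simp: mem_young diagram_def part_def split: if_splits)

lemma profile_part: "lam \<in> partitions \<Longrightarrow> profile (part lam)"
  unfolding profile_def
proof
  assume "lam \<in> partitions"
  then show "antimono (part lam)"
    using partition_nth_antimono[of lam] by (auto intro!: antimonoI simp: part_def)
  show "\<exists>L. part lam L = 0" by (rule exI[of _ "length lam"]) (simp add: part_def)
qed

text \<open>Two orders on the same letters give lists of parities that are permutations of each
  other. The keys may have different types because one order is that of the integers and the other
  is read off rational values.\<close>

lemma card_semistandard_order_independent:
  fixes \<kappa> :: "'a \<Rightarrow> 'b :: linorder" and \<kappa>' :: "'a \<Rightarrow> 'c :: linorder"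
  assumes fin: "finite (letters S)" and same: "letters S' = letters S"
    "\<And>c. c \<in> letters S \<Longrightarrow> odd_letter S' c = odd_letter S c"
    and \<kappa>: "inj_on \<kappa> (letters S)"
      "\<And>c d. c \<in> letters S \<Longrightarrow> d \<in> letters S \<Longrightarrow> lt S c d \<longleftrightarrow> \<kappa> c < \<kappa> d"
    and \<kappa>': "inj_on \<kappa>' (letters S)"
      "\<And>c d. c \<in> letters S \<Longrightarrow> d \<in> letters S \<Longrightarrow> lt S' c d \<longleftrightarrow> \<kappa>' c < \<kappa>' d"
    and lam: "lam \<in> partitions"
  shows "card (semistandard S (young lam)) = card (semistandard S' (young lam))"
proof -
  obtain xs where xs: "distinct xs" "set xs = letters S" "sorted_wrt (lt S) xs"
    using ex_sorted_letters[OF fin \<kappa>] by blast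
  obtain ys where ys: "distinct ys" "set ys = letters S'" "sorted_wrt (lt S') ys"
    using ex_sorted_letters[of S' \<kappa>'] fin \<kappa>' same by auto
  have "mset xs = mset ys" using xs ys same(1) set_eq_iff_mset_eq_distinct by metis
  then have "mset (map (odd_letter S) xs) = mset (map (odd_letter S) ys)" by simp
  also have "map (odd_letter S) ys = map (odd_letter S') ys" using ys(2) same by simp
  finally have m: "mset (rev (map (odd_letter S) xs)) = mset (rev (map (odd_letter S') ys))" by simp
  have "card (semistandard S (diagram (part lam))) = count_chains (rev (map (odd_letter S) xs)) (part lam)"
    using \<kappa>(2) by (intro card_semistandard_chains xs profile_part lam) auto
  also have "\<dots> = count_chains (rev (map (odd_letter S') ys)) (part lam)"
    by (rule chains_cong[OF profile_part[OF lam] m])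
  also have "\<dots> = card (semistandard S' (diagram (part lam)))"
    using \<kappa>'(2) same(1) by (intro card_semistandard_chains[symmetric] ys profile_part lam) auto
  finally show ?thesis by (simp add: young_eq_diagram)
qed

section \<open>Transport to the fillings\<close>

lemma finite_special_tableaux: "finite (special_tableaux lam \<mu> \<alpha>)"
proof (rule finite_subset)
  let ?R = "skew_nodes lam \<mu>"
  show "special_tableaux lam \<mu> \<alpha> \<subseteq> ?R \<rightarrow>\<^sub>E {1..card ?R}"
  proof
    fix T assume "T \<in> special_tableaux lam \<mu> \<alpha>"
    then have "T \<in> extensional ?R" "bij_betw T ?R {1..card ?R}"
      by (simp_all add: special_tableaux_def standard_tableaux_def)
    then show "T \<in> ?R \<rightarrow>\<^sub>E {1..card ?R}" by (simp add: PiE_def bij_betw_imp_funcset)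
  qed
  show "finite (?R \<rightarrow>\<^sub>E {1..card ?R})"
    by (rule finite_PiE) (simp_all add: skew_nodes_def finite_young)
qed

text \<open>Along a bijection onto all of \<open>L\<close> the image is closed under the operators,
  so any set of the right size carries a copy of \<open>L\<close>.\<close>

lemma crystal_iso_pullback:
  assumes L: "gl_crystal S \<psi> p q L" and g: "bij_betw g A (elems L)"
  shows "gl_crystal S \<psi> p q (pullback A g L)" "crystal_iso p q (pullback A g L) L"
proof -
  have inj: "inj_on g A" and img: "g ` A = elems L" using g by (auto simp: bij_betw_def)
  have closed: "b \<in> elems L" if "i \<in> root_index p q" "x \<in> elems L" "e_op L i x = Some b \<or> f_op L i x = Some b" for i x b
  proof -
    note ax = L[unfolded gl_crystal_def, THEN conjunct2, rule_format, OF that(1,2)]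
    have "set_option (e_op L i x) \<subseteq> elems L" "set_option (f_op L i x) \<subseteq> elems L"
      using ax by blast+
    then show ?thesis using that(3) by auto
  qed
  show "gl_crystal S \<psi> p q (pullback A g L)"
  proof (rule gl_crystal_pullback[OF L inj])
    fix i x b assume i: "i \<in> root_index p q" and "x \<in> A"
    then have "g x \<in> elems L" using img by blast
    then show "e_op L i (g x) = Some b \<Longrightarrow> b \<in> g ` A" "f_op L i (g x) = Some b \<Longrightarrow> b \<in> g ` A"
      using closed[OF i] unfolding img by blast+
  qed (simp add: img)
  have f: "f_op L i (g b) = Some (g b') \<longleftrightarrow> f_op (pullback A g L) i b = Some b'"
    if i: "i \<in> root_index p q" and b: "b \<in> A" "b' \<in> A" for i b b'
  proof (cases "f_op L i (g b)")
    case None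
    then show ?thesis by (simp add: pullback_def)
  next
    case (Some y)
    then have "y \<in> g ` A" using closed[OF i, of "g b" y] b img by auto
    then obtain c where c: "c \<in> A" "y = g c" by blast
    then show ?thesis using Some b inj by (auto simp: pullback_def inv_into_f_f inj_on_def)
  qed
  show "crystal_iso p q (pullback A g L) L"
    unfolding crystal_iso_def
  proof (intro exI[of _ g] conjI ballI)
    fix i b b' assume "i \<in> root_index p q" "b \<in> elems (pullback A g L)" "b' \<in> elems (pullback A g L)"
    then show "(f_op L i (g b) = Some (g b')) = (f_op (pullback A g L) i b = Some b')"
      using f by (simp add: pullback_def)
  qed (use g in \<open>auto simp: pullback_def\<close>)
qed

theorem proposition5p6:
  fixes m n :: nat and \<omega> :: "int \<Rightarrow> int" and \<psi> :: "int \<Rightarrow> rat" and lam :: "nat list"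
  assumes "1 \<le> n" and "n \<le> m"
    and "\<omega> permutes letters (alph_mn m n)"
    and "\<forall>a\<in>letters (alph_mn m n). \<forall>b\<in>letters (alph_mn m n).
           odd_letter (alph_mn m n) a = odd_letter (alph_mn m n) b \<and> a < b \<longrightarrow> inv \<omega> a < inv \<omega> b"
    and "alphabet_iso (reorder (alph_mn m n) \<omega>) (alph_N (m - n) n) \<psi>"
    and "lam \<in> hook_partitions m n"
  shows "\<exists>K :: (nat \<times> nat \<Rightarrow> int, int) crystal.
           gl_crystal (reorder (alph_mn m n) \<omega>) \<psi> (m - n) n K \<and>
           elems K = semistandard (alph_mn m n) (young lam) \<and>
           multiplicities (reorder (alph_mn m n) \<omega>) \<psi> (m - n) n K
             (\<lambda>(\<mu>, \<alpha>). card (special_tableaux lam \<mu> \<alpha>))"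
proof -
  define S where "S = reorder (alph_mn m n) \<omega>"
  define p where "p = m - n"
  define N where "N = (\<lambda>(\<mu>, \<alpha>). card (special_tableaux lam \<mu> \<alpha>))"
  interpret crystal_alphabet S \<psi> p n
    using assms(1,5) by unfold_locales (simp_all add: S_def p_def)
  have lam: "lam \<in> partitions" using assms(6) by (simp add: hook_partitions_def)
  define A where "A = semistandard (alph_mn m n) (young lam)"
  have same: "letters S = letters (alph_mn m n)" "odd_letter S = odd_letter (alph_mn m n)"
    by (simp_all add: S_def reorder_def alph_mn_def)
  have card_A: "card A = card (semistandard S (young lam))"
    unfolding A_def
  proof (rule card_semistandard_order_independent[where \<kappa> = "\<lambda>c. c" and \<kappa>' = \<psi>])
    show "lt S c d \<longleftrightarrow> \<psi> c < \<psi> d" if "c \<in> letters (alph_mn m n)" "d \<in> letters (alph_mn m n)" for c d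
      using lt_iff that by (simp add: same)
  qed (use lam inj_\<psi> finite_letters in \<open>auto simp: same alph_mn_def\<close>)
  define F where "F = (\<lambda>(x, k :: nat). pair_crystal S \<psi> x)"
  define L where "L = direct_sum (SIGMA x:pairs_C p. {..<N x}) F"
  have L: "gl_crystal S \<psi> p n L"
    unfolding L_def F_def using gl_crystal_pair by (intro gl_crystal_direct_sum) auto
  let ?Y = "SIGMA (\<mu>, \<alpha>):pairs_C p. special_tableaux lam \<mu> \<alpha> \<times> pair_tableaux S \<psi> \<mu> \<alpha>"
  \<comment> \<open>The special tableaux serve as names for the numbered copies of a pair crystal;
    this matches the direct sum with the domain of the standardization bijection.\<close>
  have "\<exists>h. bij_betw h {..<N x} (special_tableaux lam (fst x) (snd x))" for x
    using ex_bij_betw_nat_finite[OF finite_special_tableaux[of lam "fst x" "snd x"]]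
    by (simp add: N_def case_prod_beta atLeast0LessThan)
  then obtain h where h: "bij_betw (h x) {..<N x} (special_tableaux lam (fst x) (snd x))" for x
    by metis
  have "bij_betw (\<lambda>((x, k), U). (x, (h x k, U))) (elems L) ?Y"
  proof (rule bij_betwI')
    fix y z assume "y \<in> elems L" "z \<in> elems L"
    then show "(\<lambda>((x, k), U). (x, (h x k, U))) y = (\<lambda>((x, k), U). (x, (h x k, U))) z \<longleftrightarrow> y = z"
      using h by (fastforce simp: L_def direct_sum_def bij_betw_def inj_on_def)
  next
    fix y assume "y \<in> elems L"
    then obtain \<mu> \<alpha> k U where y: "y = (((\<mu>, \<alpha>), k), U)" "(\<mu>, \<alpha>) \<in> pairs_C p" "k < N (\<mu>, \<alpha>)"
      "U \<in> pair_tableaux S \<psi> \<mu> \<alpha>"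
      by (auto simp: L_def direct_sum_def F_def elems_pair_crystal)
    then have "h (\<mu>, \<alpha>) k \<in> special_tableaux lam \<mu> \<alpha>" using h[of "(\<mu>, \<alpha>)"] by (auto simp: bij_betw_def)
    then show "(\<lambda>((x, k), U). (x, (h x k, U))) y \<in> ?Y" using y by simp
  next
    fix y assume "y \<in> ?Y"
    then obtain \<mu> \<alpha> Q U where y: "y = ((\<mu>, \<alpha>), (Q, U))" "(\<mu>, \<alpha>) \<in> pairs_C p"
      "Q \<in> special_tableaux lam \<mu> \<alpha>" "U \<in> pair_tableaux S \<psi> \<mu> \<alpha>" by auto
    have "Q \<in> h (\<mu>, \<alpha>) ` {..<N (\<mu>, \<alpha>)}" using h[of "(\<mu>, \<alpha>)"] y(3) by (simp add: bij_betw_def)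
    then obtain k where "k < N (\<mu>, \<alpha>)" "h (\<mu>, \<alpha>) k = Q" by blast
    then show "\<exists>x\<in>elems L. y = (\<lambda>((x, k), U). (x, (h x k, U))) x"
      using y by (intro bexI[of _ "(((\<mu>, \<alpha>), k), U)"]) (auto simp: L_def direct_sum_def F_def elems_pair_crystal)
  qed
  from bij_betw_trans[OF this standardization_bij[OF lam]]
  have L_S: "\<exists>g. bij_betw g (elems L) (semistandard S (young lam))" by blast
  have fin: "finite A" "finite (semistandard S (young lam))"
    unfolding A_def using finite_letters same(1) by (auto intro!: finite_semistandard finite_young)
  \<comment> \<open>Equal cardinality supplies some bijection, and the crystal structure on
    \<open>A\<close> is whatever this bijection carries over from \<open>L\<close>.\<close>
  obtain g where g: "bij_betw g A (elems L)"
    using finite_same_card_bij[OF fin card_A] L_S bij_betw_trans bij_betw_inv by metis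
  define K where "K = pullback A g L"
  have K: "gl_crystal S \<psi> p n K" "crystal_iso p n K L"
    using crystal_iso_pullback[OF L g] by (simp_all add: K_def)
  have elems_K: "elems K = A" by (simp add: K_def pullback_def)
  have dec: "is_decomposition S \<psi> p n K N"
    using K(2) by (simp add: is_decomposition_def L_def F_def)
  have "multiplicities S \<psi> p n K N"
    unfolding multiplicities_def using dec multiplicity_unique[OF _ dec] fin(1) elems_K by blast
  then show ?thesis using K(1) elems_K by (auto simp: S_def p_def N_def A_def)
qed

end
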